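(* Let $c\in\mathbb{C}$, $c\neq0$, let $\tau_1=4$, $\tau_2=-3$, $\tau_3=0$, and let $\sigma_1,\sigma_2\in\mathbb{C}$ be constants, not necessarily distinct, with $\sigma_j\ne\tau_k$ for all $j,k$. Then all transcendental meromorphic solutions on $\mathbb{C}$ of the equation $$S(u,z)^3=c\,\frac{(u-\sigma_1)^3(u-\sigma_2)^3}{(u-\tau_1)^3(u-\tau_2)^2(u-\tau_3)}$$ are elliptic functions. Moreover, such solutions exist if and only if $$\{\sigma_1,\sigma_2\}=\{\sqrt5\,i,\,-\sqrt5\,i\},$$ and in this case all the transcendental meromorphic solutions are given by $$u(z)=-\frac{3c}{c-74088\,\wp(z-z_0;g_2,g_3)^3},$$ where $g_2=0$, $g_3=c/10584$, and $z_0\in\mathbb{C}$ is arbitrary.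
   Context: For a nonconstant meromorphic function $u$, the Schwarzian derivative is $S(u,z)=\left(\frac{u''}{u'}\right)'-\frac12\left(\frac{u''}{u'}\right)^2=\frac{u'''}{u'}-\frac32\left(\frac{u''}{u'}\right)^2$. "Transcendental" means not rational. $\wp(z;g_2,g_3)$ is the Weierstrass elliptic function with invariants $g_2,g_3$, satisfying $\wp'^2=4\wp^3-g_2\wp-g_3$. *)

theory Defs
  imports "HOL-Complex_Analysis.Complex_Analysis"
begin

text \<open>
  A meromorphic function on the plane is a function \<open>f\<close> with \<open>f meromorphic_on UNIV\<close>; its
  values at a set of points without accumulation point (such as its poles) carry no information.
  Hence every identity between meromorphic functions is stated to hold outside such a set, which
  is what \<open>\<forall>\<^sub>\<approx>z. P z\<close> expresses.
\<close>

definition rational_fun :: "(complex \<Rightarrow> complex) \<Rightarrow> bool" where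
  "rational_fun f \<longleftrightarrow>
     (\<exists>p q :: complex poly. q \<noteq> 0 \<and> (\<forall>\<^sub>\<approx>z. f z = poly p z / poly q z))"

definition transcendental_meromorphic :: "(complex \<Rightarrow> complex) \<Rightarrow> bool" where
  "transcendental_meromorphic f \<longleftrightarrow> f meromorphic_on UNIV \<and> \<not> rational_fun f"

definition elliptic_fun :: "(complex \<Rightarrow> complex) \<Rightarrow> bool" where
  "elliptic_fun f \<longleftrightarrow> f meromorphic_on UNIV \<and>
     (\<exists>\<omega>1 \<omega>2. \<omega>2 / \<omega>1 \<notin> \<real> \<and>
        (\<forall>\<^sub>\<approx>z. f (z + \<omega>1) = f z) \<and> (\<forall>\<^sub>\<approx>z. f (z + \<omega>2) = f z))"

definition schwarzian :: "(complex \<Rightarrow> complex) \<Rightarrow> complex \<Rightarrow> complex" where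
  "schwarzian u z =
     deriv (\<lambda>w. deriv (deriv u) w / deriv u w) z - 1 / 2 * (deriv (deriv u) z / deriv u z) ^ 2"

text \<open>
  The side condition \<open>\<omega>2 / \<omega>1 \<notin> \<real>\<close> also excludes \<open>\<omega>1 = 0\<close>, since \<open>x / 0 = 0\<close>.
\<close>

definition is_lattice :: "complex set \<Rightarrow> bool" where
  "is_lattice L \<longleftrightarrow>
     (\<exists>\<omega>1 \<omega>2. \<omega>2 / \<omega>1 \<notin> \<real> \<and> L = {of_int m * \<omega>1 + of_int n * \<omega>2 | m n. True})"

definition lattice_g2 :: "complex set \<Rightarrow> complex" where
  "lattice_g2 L = 60 * (\<Sum>\<^sub>\<infinity>\<omega>\<in>L - {0}. 1 / \<omega> ^ 4)"

definition lattice_g3 :: "complex set \<Rightarrow> complex" where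
  "lattice_g3 L = 140 * (\<Sum>\<^sub>\<infinity>\<omega>\<in>L - {0}. 1 / \<omega> ^ 6)"

definition lattice_wp :: "complex set \<Rightarrow> complex \<Rightarrow> complex" where
  "lattice_wp L z = 1 / z ^ 2 + (\<Sum>\<^sub>\<infinity>\<omega>\<in>L - {0}. 1 / (z - \<omega>) ^ 2 - 1 / \<omega> ^ 2)"

text \<open>
  For \<open>g2 ^ 3 \<noteq> 27 * g3 ^ 2\<close> there is exactly one lattice with invariants \<open>g2\<close> and \<open>g3\<close>.
  Otherwise there is none, and the value below is unspecified.
\<close>

definition weierstrass_wp :: "complex \<Rightarrow> complex \<Rightarrow> complex \<Rightarrow> complex" where
  "weierstrass_wp g2 g3 =
     lattice_wp (SOME L. is_lattice L \<and> lattice_g2 L = g2 \<and> lattice_g3 L = g3)"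

definition schwarzian_solution ::
    "complex \<Rightarrow> complex \<Rightarrow> complex \<Rightarrow> (complex \<Rightarrow> complex) \<Rightarrow> bool" where
  "schwarzian_solution c \<sigma>1 \<sigma>2 u \<longleftrightarrow>
     (\<forall>\<^sub>\<approx>z. schwarzian u z ^ 3 =
        c * ((u z - \<sigma>1) ^ 3 * (u z - \<sigma>2) ^ 3) /
            ((u z - 4) ^ 3 * (u z - (-3)) ^ 2 * (u z - 0)))"

end

theory Submission
  imports Defs
begin

text \<open>
  Write \<open>B x = (x - 4) ^ 3 * (x + 3) ^ 4 * x ^ 5\<close> (below \<open>branch_poly\<close>). Let \<open>u\<close> be a nonconstant meromorphic
  solution. Near a point where \<open>u\<close> takes a value with multiplicity \<open>m \<ge> 2\<close>, its Schwarzian derivative is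
  asymptotic to \<open>(1 - m ^ 2) / 2 / (z - z0) ^ 2\<close>. Comparing this with the right side of the equation shows
  that \<open>u\<close> takes 4, -3 and 0 only with multiplicity 2, 3 and 6, and that all other values and the poles are
  simple. Consequently \<open>F = u' ^ 6 / B u\<close> is an entire function without zeros; moreover the leading
  coefficients in the equation force \<open>F\<close> to have one and the same value at all zeros of \<open>u\<close>
  (\<open>first_integral\<close>).

  Since \<open>1/2 + 1/3 + 1/6 = 1\<close>, the sphere with these branching orders is covered by the plane. The covering
  is \<open>\<phi> = 3 * g3 / (7 * wp ^ 3 - g3)\<close>, where \<open>wp\<close> is the Weierstrass function of a lattice with
  invariants 0 and \<open>g3\<close>, and \<open>\<phi>' ^ 6 = K * B \<phi>\<close> with
  \<open>K = - 27 * g3 / 7\<close>. Hence \<open>u = \<phi> \<circ> h\<close> for an entire function \<open>h\<close> with \<open>h' ^ 6 = F / K\<close>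
  (\<open>lift_through_\<phi>\<close>). The zeros of \<open>u\<close> are the points that \<open>h\<close> maps into the lattice, so \<open>norm h'\<close> is fixed
  there. Because the lattice meets every large disc, a rescaling argument shows that \<open>h'\<close> is bounded
  (\<open>lattice_preimage_derivative_bounded\<close>). By Liouville's theorem \<open>h'\<close> and \<open>F\<close> are constant. This replaces
  the growth estimates of value distribution theory.

  Differentiating \<open>u' ^ 6 = F * B u\<close> with constant \<open>F\<close> gives
  \<open>S ^ 3 = - 2744 * F * (u ^ 2 + 5) ^ 3 / ((u - 4) ^ 3 * (u + 3) ^ 2 * u)\<close> (\<open>schwarzian_of_branch_ode\<close>). As \<open>u\<close>
  takes infinitely many values, this must be the given right side: \<open>\<sigma>1\<close> and \<open>\<sigma>2\<close> are the roots of
  \<open>x ^ 2 + 5\<close>, and \<open>F = - c / 2744\<close>, which is \<open>K\<close> if \<open>g3 = c / 10584\<close>. Now \<open>h' ^ 6 = 1\<close>, and the lift can be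
  chosen with \<open>h' = 1\<close>, so \<open>u\<close> is a translate of \<open>\<phi>\<close> (\<open>solution_classification\<close>). Conversely the same
  differentiation, applied to \<open>\<phi>\<close>, shows that these translates are solutions.

  The classical facts about \<open>wp\<close> are derived from its defining series: periodicity, the differential
  equation, surjectivity, and the existence of a lattice with invariants 0 and \<open>g3\<close> for every \<open>g3 \<noteq> 0\<close>.
\<close>

section \<open>Lattices in the plane\<close>

locale period_lattice =
  fixes L :: "complex set"
  assumes lattice: "is_lattice L"
begin

lemma basis:
  obtains \<omega>1 \<omega>2 where "\<omega>2 / \<omega>1 \<notin> \<real>" "L = {of_int m * \<omega>1 + of_int n * \<omega>2 | m n. True}"
  using lattice unfolding is_lattice_def by blast

lemma zero_in [simp]: "0 \<in> L"
proof -
  obtain \<omega>1 \<omega>2 where "L = {of_int m * \<omega>1 + of_int n * \<omega>2 | m n. True}" using basis .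
  then show ?thesis by (auto intro!: exI[of _ "0::int"])
qed

lemma add_in: "x \<in> L \<Longrightarrow> y \<in> L \<Longrightarrow> x + y \<in> L"
proof -
  obtain \<omega>1 \<omega>2 where L: "L = {of_int m * \<omega>1 + of_int n * \<omega>2 | m n. True}" using basis .
  assume "x \<in> L" "y \<in> L"
  then obtain m n m' n' where "x = of_int m * \<omega>1 + of_int n * \<omega>2"
    "y = of_int m' * \<omega>1 + of_int n' * \<omega>2" unfolding L by blast
  then have "x + y = of_int (m + m') * \<omega>1 + of_int (n + n') * \<omega>2" by (simp add: algebra_simps)
  then show ?thesis unfolding L by blast
qed

lemma uminus_in: "x \<in> L \<Longrightarrow> - x \<in> L"
proof -
  obtain \<omega>1 \<omega>2 where L: "L = {of_int m * \<omega>1 + of_int n * \<omega>2 | m n. True}" using basis .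
  assume "x \<in> L"
  then obtain m n where "x = of_int m * \<omega>1 + of_int n * \<omega>2" unfolding L by blast
  then have "- x = of_int (- m) * \<omega>1 + of_int (- n) * \<omega>2" by (simp add: algebra_simps)
  then show ?thesis unfolding L by blast
qed

lemma uminus_in_iff [simp]: "- x \<in> L \<longleftrightarrow> x \<in> L"
  using uminus_in[of x] uminus_in[of "- x"] by auto

lemma add_in_iff: "y \<in> L \<Longrightarrow> x + y \<in> L \<longleftrightarrow> x \<in> L"
  using add_in[of x y] add_in[of "x + y" "- y"] by auto

lemma diff_in_iff: "y \<in> L \<Longrightarrow> x - y \<in> L \<longleftrightarrow> x \<in> L"
  using add_in_iff[of "- y" x] by simp

end

text \<open>
  If \<open>\<tau> = \<omega>2 / \<omega>1\<close> is not real, \<open>y\<close> is controlled by the imaginary part of \<open>x + y \<tau>\<close> and then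
  \<open>x\<close> by the triangle inequality.
\<close>
lemma basis_norm_bound:
  fixes \<omega>1 \<omega>2 :: complex
  assumes "\<omega>2 / \<omega>1 \<notin> \<real>"
  obtains \<delta> where "\<delta> > 0"
    "\<And>x y :: real. \<delta> * (\<bar>x\<bar> + \<bar>y\<bar>) \<le> norm (of_real x * \<omega>1 + of_real y * \<omega>2)"
proof -
  define \<tau> where "\<tau> = \<omega>2 / \<omega>1"
  have im: "Im \<tau> \<noteq> 0" using assms unfolding \<tau>_def by (auto simp: complex_is_Real_iff)
  have nz: "\<omega>1 \<noteq> 0" using assms by auto
  define C where "C = 1 + (norm \<tau> + 1) / \<bar>Im \<tau>\<bar>"
  have C: "C > 0" unfolding C_def using im by (intro add_pos_nonneg) auto
  have main: "\<bar>x\<bar> + \<bar>y\<bar> \<le> C * norm (of_real x + of_real y * \<tau>)" for x y :: real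
  proof -
    let ?N = "norm (of_real x + of_real y * \<tau>)"
    have "\<bar>y * Im \<tau>\<bar> \<le> ?N" using abs_Im_le_cmod[of "of_real x + of_real y * \<tau>"] by simp
    then have y: "\<bar>y\<bar> \<le> ?N / \<bar>Im \<tau>\<bar>" using im by (simp add: field_simps abs_mult)
    have "\<bar>x\<bar> = norm ((of_real x + of_real y * \<tau>) - of_real y * \<tau>)" by simp
    also have "\<dots> \<le> ?N + \<bar>y\<bar> * norm \<tau>"
      using norm_triangle_ineq4[of "of_real x + of_real y * \<tau>" "of_real y * \<tau>"]
      by (simp add: norm_mult)
    finally have "\<bar>x\<bar> + \<bar>y\<bar> \<le> ?N + \<bar>y\<bar> * (norm \<tau> + 1)" by (simp add: algebra_simps)
    also have "\<dots> \<le> ?N + ?N / \<bar>Im \<tau>\<bar> * (norm \<tau> + 1)"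
      using y by (intro add_left_mono mult_right_mono) auto
    also have "\<dots> = C * ?N" unfolding C_def by (simp add: algebra_simps)
    finally show ?thesis .
  qed
  show ?thesis
  proof (rule that[of "norm \<omega>1 / C"])
    show "norm \<omega>1 / C > 0" using C nz by simp
    fix x y :: real
    have "of_real x * \<omega>1 + of_real y * \<omega>2 = \<omega>1 * (of_real x + of_real y * \<tau>)"
      unfolding \<tau>_def using nz by (simp add: field_simps)
    then have "norm (of_real x * \<omega>1 + of_real y * \<omega>2) = norm \<omega>1 * norm (of_real x + of_real y * \<tau>)"
      by (simp add: norm_mult)
    then show "norm \<omega>1 / C * (\<bar>x\<bar> + \<bar>y\<bar>) \<le> norm (of_real x * \<omega>1 + of_real y * \<omega>2)"
      using mult_left_mono[OF main[of x y], of "norm \<omega>1"] C by (simp add: field_simps)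
  qed
qed

lemma summable_on_int_powr:
  "(\<lambda>n::int. (1 + \<bar>real_of_int n\<bar>) powr (-3/2)) summable_on UNIV"
proof -
  let ?f = "\<lambda>n::int. (1 + \<bar>real_of_int n\<bar>) powr (-3/2)"
  have "summable (\<lambda>n. real n powr (-3/2))" by (subst summable_real_powr_iff) auto
  then have s: "summable (\<lambda>n. real (Suc n) powr (-3/2))" by (subst summable_Suc_iff)
  have nat: "(\<lambda>n. real (Suc n) powr (-3/2)) summable_on UNIV"
    by (rule summable_nonneg_imp_summable_on[OF s]) auto
  have "?f summable_on range int"
    by (subst summable_on_reindex) (use nat in \<open>auto simp: o_def\<close>)
  moreover have "?f summable_on range (\<lambda>n. - int n)"
    by (subst summable_on_reindex) (use nat in \<open>auto simp: o_def inj_on_def\<close>)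
  then have "?f summable_on (range (\<lambda>n. - int n) - range int)"
    by (rule summable_on_subset_banach) blast
  ultimately have "?f summable_on (range int \<union> (range (\<lambda>n. - int n) - range int))"
    by (rule summable_on_Un_disjoint) blast
  moreover have "n \<in> range int \<union> (range (\<lambda>n. - int n) - range int)" for n :: int
    by (cases n rule: int_cases2) auto
  then have "range int \<union> (range (\<lambda>n. - int n) - range int) = (UNIV :: int set)"
    by auto
  ultimately show ?thesis by simp
qed

context period_lattice
begin

text \<open>
  With \<open>s = \<bar>m\<bar> + \<bar>n\<bar> \<ge> 1\<close>, both \<open>1 + \<bar>m\<bar>\<close> and \<open>1 + \<bar>n\<bar>\<close> are at most \<open>2 * s\<close>, so the double
  series is dominated by a product of two convergent simple series.
\<close>
lemma summable_inverse_cube: "(\<lambda>\<omega>. 1 / norm \<omega> ^ 3) summable_on (L - {0})"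
proof -
  obtain \<omega>1 \<omega>2 where B: "\<omega>2 / \<omega>1 \<notin> \<real>"
    and L: "L = {of_int m * \<omega>1 + of_int n * \<omega>2 | m n. True}" using basis .
  obtain \<delta> where \<delta>: "\<delta> > 0"
    "\<And>x y :: real. \<delta> * (\<bar>x\<bar> + \<bar>y\<bar>) \<le> norm (of_real x * \<omega>1 + of_real y * \<omega>2)"
    by (rule basis_norm_bound[OF B]) blast
  define g :: "int \<times> int \<Rightarrow> complex" where "g = (\<lambda>(m,n). of_int m * \<omega>1 + of_int n * \<omega>2)"
  have gb: "\<delta> * (\<bar>real_of_int m\<bar> + \<bar>real_of_int n\<bar>) \<le> norm (g (m, n))" for m n
    using \<delta>(2)[of "of_int m" "of_int n"] unfolding g_def by simp
  have inj: "inj g"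
  proof (rule injI, clarify)
    fix m n m' n' assume eq: "g (m, n) = g (m', n')"
    have "g (m - m', n - n') = g (m, n) - g (m', n')" unfolding g_def by (simp add: algebra_simps)
    then have "\<delta> * (\<bar>real_of_int (m - m')\<bar> + \<bar>real_of_int (n - n')\<bar>) \<le> 0"
      using gb[of "m - m'" "n - n'"] eq by simp
    then have "\<bar>real_of_int (m - m')\<bar> + \<bar>real_of_int (n - n')\<bar> \<le> 0"
      using \<delta>(1) by (simp add: mult_le_0_iff)
    then show "m = m' \<and> n = n'" by linarith
  qed
  have Lg: "L - {0} = g ` (UNIV - {(0, 0)})"
  proof -
    have "L = range g" unfolding L g_def by auto
    moreover have "g (0, 0) = 0" unfolding g_def by simp
    ultimately show ?thesis using image_set_diff[OF inj, of UNIV "{(0, 0)}"] by simp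
  qed
  let ?p = "\<lambda>n::int. (1 + \<bar>real_of_int n\<bar>) powr (-3/2)"
  have "(\<lambda>(m, n). ?p m * ?p n) summable_on (UNIV \<times> UNIV)"
  proof (rule summable_on_SigmaI[where g = "\<lambda>m. ?p m * infsum ?p UNIV"])
    show "((\<lambda>n. case (m, n) of (m, n) \<Rightarrow> ?p m * ?p n) has_sum ?p m * infsum ?p UNIV) UNIV" for m
      using summable_on_int_powr by (auto intro!: has_sum_cmult_right)
    show "(\<lambda>m. ?p m * infsum ?p UNIV) summable_on UNIV"
      using summable_on_int_powr by (auto intro!: summable_on_cmult_left)
  qed auto
  then have "(\<lambda>x. (8 / \<delta> ^ 3) * (case x of (m, n) \<Rightarrow> ?p m * ?p n)) summable_on (UNIV - {(0, 0)})"
    by (intro summable_on_cmult_right) (rule summable_on_subset_banach, auto)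
  then have "(\<lambda>x. norm (1 / norm (g x) ^ 3)) summable_on (UNIV - {(0, 0)})"
  proof (rule Infinite_Sum.abs_summable_on_comparison_test'[of _ _ "\<lambda>x. 1 / norm (g x) ^ 3"])
    fix x :: "int \<times> int" assume x: "x \<in> UNIV - {(0, 0)}"
    obtain m n where mn: "x = (m, n)" by (cases x)
    define s where "s = \<bar>real_of_int m\<bar> + \<bar>real_of_int n\<bar>"
    have s: "s \<ge> 1" using x unfolding mn s_def by (cases "m = 0") auto
    have "(1 + \<bar>real_of_int m\<bar>) * (1 + \<bar>real_of_int n\<bar>) \<le> (2 * s) * (2 * s)"
      using s unfolding s_def by (intro mult_mono) auto
    then have "((2 * s) * (2 * s)) powr (-3/2)
        \<le> ((1 + \<bar>real_of_int m\<bar>) * (1 + \<bar>real_of_int n\<bar>)) powr (-3/2)"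
      by (intro powr_mono2') (auto intro!: mult_pos_pos add_pos_nonneg)
    also have "\<dots> = ?p m * ?p n" by (rule powr_mult)
    also have "(2 * s) * (2 * s) = (2 * s) powr 2"
      using s by (simp add: powr_numeral power2_eq_square)
    also have "((2 * s) powr 2) powr (-3/2) = (2 * s) powr (-3)" by (simp add: powr_powr)
    also have "\<dots> = 1 / (2 * s) ^ 3"
      using s by (simp add: powr_minus powr_numeral divide_simps)
    finally have le: "1 / (2 * s) ^ 3 \<le> ?p m * ?p n" .
    have pos: "0 < \<delta> * s" using s \<delta>(1) by simp
    moreover have "\<delta> * s \<le> norm (g x)" using gb[of m n] unfolding mn s_def .
    ultimately have "1 / norm (g x) ^ 3 \<le> 1 / (\<delta> * s) ^ 3"
      by (intro frac_le power_mono zero_less_power) linarith+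
    also have "\<dots> = (8 / \<delta> ^ 3) * (1 / (2 * s) ^ 3)" by (simp add: power_mult_distrib)
    also have "\<dots> \<le> (8 / \<delta> ^ 3) * (?p m * ?p n)" using le \<delta>(1) by (intro mult_left_mono) auto
    finally show "norm (1 / norm (g x) ^ 3) \<le> (8 / \<delta> ^ 3) * (case x of (m, n) \<Rightarrow> ?p m * ?p n)"
      unfolding mn by simp
  qed
  then show ?thesis
    unfolding Lg by (subst summable_on_reindex) (use inj in \<open>auto simp: o_def inj_on_def\<close>)
qed

lemma finite_bounded_part: "finite {\<omega>\<in>L. norm \<omega> \<le> R}"
proof -
  obtain \<omega>1 \<omega>2 where B: "\<omega>2 / \<omega>1 \<notin> \<real>"
    and L: "L = {of_int m * \<omega>1 + of_int n * \<omega>2 | m n. True}" using basis .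
  obtain \<delta> where \<delta>: "\<delta> > 0"
    "\<And>x y :: real. \<delta> * (\<bar>x\<bar> + \<bar>y\<bar>) \<le> norm (of_real x * \<omega>1 + of_real y * \<omega>2)"
    by (rule basis_norm_bound[OF B]) blast
  define N where "N = \<lceil>R / \<delta>\<rceil>"
  have "{\<omega>\<in>L. norm \<omega> \<le> R} \<subseteq> (\<lambda>(m,n). of_int m * \<omega>1 + of_int n * \<omega>2) ` ({-N..N} \<times> {-N..N})"
  proof clarify
    fix \<omega> assume \<omega>: "\<omega> \<in> L" "norm \<omega> \<le> R"
    then obtain m n where mn: "\<omega> = of_int m * \<omega>1 + of_int n * \<omega>2" unfolding L by blast
    have "\<delta> * (\<bar>real_of_int m\<bar> + \<bar>real_of_int n\<bar>) \<le> R"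
      using \<delta>(2)[of "of_int m" "of_int n"] \<omega>(2) unfolding mn by simp
    then have "\<bar>real_of_int m\<bar> + \<bar>real_of_int n\<bar> \<le> R / \<delta>" using \<delta>(1) by (simp add: field_simps)
    also have "\<dots> \<le> real_of_int N" unfolding N_def by simp
    finally have "m \<in> {-N..N}" "n \<in> {-N..N}" by auto
    then show "\<omega> \<in> (\<lambda>(m,n). of_int m * \<omega>1 + of_int n * \<omega>2) ` ({-N..N} \<times> {-N..N})"
      unfolding mn by force
  qed
  then show ?thesis by (rule finite_subset) auto
qed

lemma not_islimpt: "\<not> z islimpt L"
proof
  assume "z islimpt L"
  then have inf: "infinite (L \<inter> ball z 1)"
    unfolding islimpt_eq_infinite_ball by simp
  have "L \<inter> ball z 1 \<subseteq> {\<omega>\<in>L. norm \<omega> \<le> norm z + 1}"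
  proof safe
    fix \<omega> assume "\<omega> \<in> ball z 1"
    then show "norm \<omega> \<le> norm z + 1"
      using norm_triangle_ineq3[of \<omega> z] by (auto simp: dist_norm norm_minus_commute)
  qed
  then show False using inf finite_bounded_part finite_subset by blast
qed

lemma closed_L: "closed L"
  using not_islimpt closed_limpt by blast

lemma open_complement [simp, intro]: "open (- L)"
  using closed_L by blast

lemma eventually_not_in_L: "eventually (\<lambda>w. w \<notin> L) (at z)"
  using not_islimpt[of z] unfolding islimpt_conv_frequently_at frequently_def by simp

lemma cosparse_not_in_L: "\<forall>\<^sub>\<approx>w. w \<notin> L"
  by (simp add: eventually_cosparse_open_eq eventually_not_in_L)

lemma countable_L: "countable L"
proof -
  obtain \<omega>1 \<omega>2 where L: "L = {of_int m * \<omega>1 + of_int n * \<omega>2 | m n. True}" using basis .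
  have "L = range (\<lambda>(m::int, n::int). of_int m * \<omega>1 + of_int n * \<omega>2)" unfolding L by auto
  then show ?thesis by (metis countable_image uncountable_def countableI_type)
qed

lemma connected_complement: "connected (- L)"
  by (intro path_connected_imp_connected path_connected_complement_countable countable_L) auto

text \<open>
  Reducing both real coordinates modulo 1 moves a point into the period parallelogram. This is what
  makes periodic functions bounded, and what puts lattice points into every large disc.
\<close>
lemma lattice_covering:
  obtains B where "B > 0" "\<And>z. \<exists>\<omega>\<in>L. norm (z - \<omega>) \<le> B"
proof -
  obtain \<omega>1 \<omega>2 where B: "\<omega>2 / \<omega>1 \<notin> \<real>"
    and L: "L = {of_int m * \<omega>1 + of_int n * \<omega>2 | m n. True}" using basis .
  define \<tau> where "\<tau> = \<omega>2 / \<omega>1"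
  have im: "Im \<tau> \<noteq> 0" using B unfolding \<tau>_def by (auto simp: complex_is_Real_iff)
  have nz: "\<omega>1 \<noteq> 0" using B by auto
  show ?thesis
  proof (rule that[of "norm \<omega>1 + norm \<omega>2"])
    show "norm \<omega>1 + norm \<omega>2 > 0" using nz by (simp add: add_pos_nonneg)
    fix z
    define y where "y = Im (z / \<omega>1) / Im \<tau>"
    define x where "x = Re (z / \<omega>1) - y * Re \<tau>"
    have "z / \<omega>1 = of_real x + of_real y * \<tau>"
      unfolding x_def y_def using im by (simp add: complex_eq_iff)
    then have z: "z = of_real x * \<omega>1 + of_real y * \<omega>2"
      using nz unfolding \<tau>_def by (simp add: field_simps)
    define \<omega> where "\<omega> = of_int \<lfloor>x\<rfloor> * \<omega>1 + of_int \<lfloor>y\<rfloor> * \<omega>2"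
    have "z - \<omega> = of_real (frac x) * \<omega>1 + of_real (frac y) * \<omega>2"
      unfolding z \<omega>_def frac_def by (simp add: algebra_simps)
    also have "norm \<dots> \<le> norm (of_real (frac x) * \<omega>1) + norm (of_real (frac y) * \<omega>2)"
      by (rule norm_triangle_ineq)
    also have "\<dots> \<le> 1 * norm \<omega>1 + 1 * norm \<omega>2"
      unfolding norm_mult by (intro add_mono mult_right_mono) (auto simp: less_imp_le[OF frac_lt_1])
    finally show "\<exists>\<omega>\<in>L. norm (z - \<omega>) \<le> norm \<omega>1 + norm \<omega>2"
      unfolding L \<omega>_def by auto
  qed
qed

end

section \<open>The Weierstrass function\<close>

text \<open>
  The partial sums converge uniformly by the majorant \<open>M\<close>, and for holomorphic functions this
  entails convergence of the derivatives of the partial sums to the derivative of the limit.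
\<close>
lemma infsum_has_field_derivative:
  fixes f f' :: "'a \<Rightarrow> complex \<Rightarrow> complex"
  assumes deriv: "\<And>x z. x \<in> X \<Longrightarrow> z \<in> ball a R \<Longrightarrow> (f x has_field_derivative f' x z) (at z)"
    and bound: "\<And>x z. x \<in> X \<Longrightarrow> z \<in> ball a R \<Longrightarrow> norm (f x z) \<le> M x"
    and M: "M summable_on X"
    and sum': "\<And>z. z \<in> ball a R \<Longrightarrow> (\<lambda>x. f' x z) summable_on X"
    and w: "w \<in> ball a R"
  shows "((\<lambda>z. \<Sum>\<^sub>\<infinity>x\<in>X. f x z) has_field_derivative (\<Sum>\<^sub>\<infinity>x\<in>X. f' x w)) (at w)"
proof -
  obtain r where r: "r > 0" "cball w r \<subseteq> ball a R"
    using w by (metis open_ball open_contains_cball)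
  let ?F = "finite_subsets_at_top X"
  have ev: "\<forall>\<^sub>F Y in ?F. finite Y \<and> Y \<subseteq> X"
    by (auto simp: eventually_finite_subsets_at_top_weakI)
  have cont: "\<forall>\<^sub>F Y in ?F. continuous_on (cball w r) (\<lambda>z. \<Sum>x\<in>Y. f x z) \<and>
      (\<forall>z\<in>ball w r. ((\<lambda>z. \<Sum>x\<in>Y. f x z) has_field_derivative (\<Sum>x\<in>Y. f' x z)) (at z))"
    using ev
  proof eventually_elim
    case (elim Y)
    have d: "((\<lambda>z. \<Sum>x\<in>Y. f x z) has_field_derivative (\<Sum>x\<in>Y. f' x z)) (at z)"
      if "z \<in> cball w r" for z
      by (rule DERIV_sum) (use elim deriv that r in blast)
    show ?case
      using d by (auto intro!: continuous_at_imp_continuous_on DERIV_isCont[OF d])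
  qed
  have ulim: "uniform_limit (cball w r) (\<lambda>Y z. \<Sum>x\<in>Y. f x z) (\<lambda>z. \<Sum>\<^sub>\<infinity>x\<in>X. f x z) ?F"
    by (rule Weierstrass_m_test_general[OF _ M]) (use bound r in blast)
  obtain g' where g': "\<And>z. z \<in> ball w r \<Longrightarrow>
      ((\<lambda>z. \<Sum>\<^sub>\<infinity>x\<in>X. f x z) has_field_derivative g' z) (at z) \<and>
      ((\<lambda>Y. \<Sum>x\<in>Y. f' x z) \<longlongrightarrow> g' z) ?F"
    using has_complex_derivative_uniform_limit[OF cont ulim _ r(1)] by auto
  have "((\<lambda>Y. \<Sum>x\<in>Y. f' x w) \<longlongrightarrow> (\<Sum>\<^sub>\<infinity>x\<in>X. f' x w)) ?F"
    by (rule infsum_tendsto[OF sum'[OF w]])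
  with g'[of w] r(1) have "g' w = (\<Sum>\<^sub>\<infinity>x\<in>X. f' x w)"
    by (auto intro: tendsto_unique[of ?F])
  with g'[of w] r(1) show ?thesis by auto
qed

context period_lattice
begin

text \<open>
  Splitting off the finitely many lattice points of norm at most \<open>2 * R\<close> leaves series that converge
  uniformly for \<open>norm z < R\<close>.
\<close>
definition far :: "real \<Rightarrow> complex set" where
  "far R = {\<omega>\<in>L. 2 * R < norm \<omega>}"

definition near :: "real \<Rightarrow> complex set" where
  "near R = {\<omega>\<in>L. norm \<omega> \<le> 2 * R} - {0}"

definition far_sum :: "real \<Rightarrow> nat \<Rightarrow> complex \<Rightarrow> complex" where
  "far_sum R k z = (\<Sum>\<^sub>\<infinity>\<omega>\<in>far R. 1 / (z - \<omega>) ^ k)"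

lemma finite_near: "finite (near R)"
  unfolding near_def using finite_bounded_part by simp

lemma near_far: "0 < R \<Longrightarrow> L - {0} = near R \<union> far R" "near R \<inter> far R = {}"
  unfolding near_def far_def by auto

lemma far_distance:
  assumes "0 < R" "\<omega> \<in> far R" "z \<in> ball 0 R"
  shows "norm \<omega> \<le> 2 * norm (z - \<omega>)" "norm \<omega> > 0" "z \<noteq> \<omega>"
proof -
  have "norm \<omega> \<le> norm (z - \<omega>) + norm z"
    using norm_triangle_ineq4[of z "z - \<omega>"] by simp
  then show "norm \<omega> \<le> 2 * norm (z - \<omega>)" "norm \<omega> > 0" "z \<noteq> \<omega>"
    using assms unfolding far_def by auto
qed

lemma far_term_bound:
  assumes "0 < R" "\<omega> \<in> far R" "z \<in> ball 0 R" "3 \<le> k"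
  shows "norm (1 / (z - \<omega>) ^ k) \<le> 8 / R ^ (k - 3) * (1 / norm \<omega> ^ 3)"
proof -
  have d: "norm \<omega> \<le> 2 * norm (z - \<omega>)" "norm \<omega> > 0" using far_distance[OF assms(1-3)] by auto
  have R: "R \<le> norm (z - \<omega>)" using d(1) assms(2) unfolding far_def by simp
  have "R ^ (k - 3) * norm \<omega> ^ 3 \<le> norm (z - \<omega>) ^ (k - 3) * (2 * norm (z - \<omega>)) ^ 3"
    using R d assms(1) by (intro mult_mono power_mono) auto
  also have "\<dots> = 8 * norm (z - \<omega>) ^ k"
    using assms(4) by (simp add: power_mult_distrib flip: power_add)
  finally have "R ^ (k - 3) * norm \<omega> ^ 3 \<le> 8 * norm (z - \<omega>) ^ k" .
  moreover have "0 < norm (z - \<omega>)" using R assms(1) by linarith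
  ultimately show ?thesis
    using d(2) assms(1) by (simp add: norm_divide norm_power field_simps)
qed

lemma far_wp_term_bound:
  assumes "0 < R" "\<omega> \<in> far R" "z \<in> ball 0 R"
  shows "norm (1 / (z - \<omega>) ^ 2 - 1 / \<omega> ^ 2) \<le> 10 * R * (1 / norm \<omega> ^ 3)"
proof -
  have d: "norm \<omega> \<le> 2 * norm (z - \<omega>)" "norm \<omega> > 0" "z \<noteq> \<omega>"
    using far_distance[OF assms] by auto
  have z: "norm z \<le> R" using assms(3) by simp
  have R: "2 * R < norm \<omega>" using assms(2) unfolding far_def by simp
  have "1 / (z - \<omega>) ^ 2 - 1 / \<omega> ^ 2 = (\<omega> ^ 2 - (z - \<omega>) ^ 2) / (\<omega> ^ 2 * (z - \<omega>) ^ 2)"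
    using d by (simp add: diff_frac_eq mult.commute)
  also have "\<omega> ^ 2 - (z - \<omega>) ^ 2 = z * (2 * \<omega> - z)"
    by (simp add: power2_eq_square algebra_simps)
  finally have "1 / (z - \<omega>) ^ 2 - 1 / \<omega> ^ 2 = z * (2 * \<omega> - z) / (\<omega> ^ 2 * (z - \<omega>) ^ 2)" .
  then have "norm (1 / (z - \<omega>) ^ 2 - 1 / \<omega> ^ 2)
      = norm z * norm (2 * \<omega> - z) / (norm \<omega> ^ 2 * norm (z - \<omega>) ^ 2)"
    by (simp add: norm_mult norm_divide norm_power)
  also have "\<dots> \<le> R * (5/2 * norm \<omega>) / (norm \<omega> ^ 2 * (norm \<omega> / 2) ^ 2)"
  proof (rule frac_le)
    have "norm (2 * \<omega> - z) \<le> 2 * norm \<omega> + norm z"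
      using norm_triangle_ineq4[of "2 * \<omega>" z] by (simp add: norm_mult)
    then show "norm z * norm (2 * \<omega> - z) \<le> R * (5/2 * norm \<omega>)"
      using z R assms(1) by (intro mult_mono) auto
    show "norm \<omega> ^ 2 * (norm \<omega> / 2) ^ 2 \<le> norm \<omega> ^ 2 * norm (z - \<omega>) ^ 2"
      using d by (intro mult_left_mono power_mono) auto
  qed (use d assms(1) in auto)
  also have "\<dots> = 10 * R * (1 / norm \<omega> ^ 3)"
    using d(2) by (simp add: field_simps eval_nat_numeral)
  finally show ?thesis .
qed

lemma summable_far: "0 < R \<Longrightarrow> (\<lambda>\<omega>. C * (1 / norm \<omega> ^ 3)) summable_on far R"
  by (intro summable_on_cmult_right summable_on_subset_banach[OF summable_inverse_cube])
     (auto simp: far_def)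

lemma summable_far_power:
  assumes "0 < R" "z \<in> ball 0 R" "3 \<le> k"
  shows "(\<lambda>\<omega>. 1 / (z - \<omega>) ^ k) summable_on far R"
  by (rule abs_summable_summable, rule Infinite_Sum.abs_summable_on_comparison_test'[OF summable_far[of R "8 / R ^ (k - 3)"]])
     (use far_term_bound assms in auto)

lemma summable_far_wp:
  assumes "0 < R" "z \<in> ball 0 R"
  shows "(\<lambda>\<omega>. 1 / (z - \<omega>) ^ 2 - 1 / \<omega> ^ 2) summable_on far R"
  by (rule abs_summable_summable, rule Infinite_Sum.abs_summable_on_comparison_test'[OF summable_far[of R "10 * R"]])
     (use far_wp_term_bound assms in auto)

lemma inverse_power_has_field_derivative:
  fixes z \<omega> :: complex
  assumes "z \<noteq> \<omega>"
  shows "((\<lambda>z. 1 / (z - \<omega>) ^ k) has_field_derivative (- of_nat k) * (1 / (z - \<omega>) ^ Suc k)) (at z)"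
proof (cases k)
  case (Suc n)
  define w where "w = z - \<omega>"
  have w: "w \<noteq> 0" using assms unfolding w_def by simp
  have "((\<lambda>z. (z - \<omega>) ^ k) has_field_derivative of_nat k * w ^ n) (at z)"
  proof -
    have "((\<lambda>z. z - \<omega>) has_field_derivative 1) (at z)" by (auto intro!: derivative_eq_intros)
    from DERIV_power_Suc[OF this, of n] show ?thesis unfolding w_def Suc by simp
  qed
  from DERIV_inverse'[OF this]
  have "((\<lambda>z. 1 / (z - \<omega>) ^ k) has_field_derivative
      - (inverse (w ^ k) * (of_nat k * w ^ n) * inverse (w ^ k))) (at z)"
    using w unfolding w_def by (simp add: inverse_eq_divide)
  moreover have "- (inverse (w ^ k) * (of_nat k * w ^ n) * inverse (w ^ k))
      = (- of_nat k) * (1 / w ^ Suc k)"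
    unfolding Suc using w by (simp add: field_simps)
  ultimately show ?thesis unfolding w_def by simp
qed auto

lemma far_sum_has_field_derivative:
  assumes "0 < R" "z \<in> ball 0 R" "3 \<le> k"
  shows "(far_sum R k has_field_derivative (- of_nat k) * far_sum R (Suc k) z) (at z)"
proof -
  have "((\<lambda>z. \<Sum>\<^sub>\<infinity>\<omega>\<in>far R. 1 / (z - \<omega>) ^ k) has_field_derivative
      (\<Sum>\<^sub>\<infinity>\<omega>\<in>far R. (- of_nat k) * (1 / (z - \<omega>) ^ Suc k))) (at z)"
  proof (rule infsum_has_field_derivative[where a = 0 and R = R])
    show "(\<lambda>\<omega>. (- of_nat k) * (1 / (z - \<omega>) ^ Suc k)) summable_on far R" if "z \<in> ball 0 R" for z
      by (intro summable_on_cmult_right summable_far_power) (use assms that in auto)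
    show "((\<lambda>z. 1 / (z - \<omega>) ^ k) has_field_derivative (- of_nat k) * (1 / (z - \<omega>) ^ Suc k)) (at z)"
      if "\<omega> \<in> far R" "z \<in> ball 0 R" for \<omega> z
      by (rule inverse_power_has_field_derivative) (use far_distance assms that in blast)
    show "norm (1 / (z - \<omega>) ^ k) \<le> 8 / R ^ (k - 3) * (1 / norm \<omega> ^ 3)"
      if "\<omega> \<in> far R" "z \<in> ball 0 R" for \<omega> z
      by (rule far_term_bound) (use assms that in auto)
    show "(\<lambda>\<omega>. 8 / R ^ (k - 3) * (1 / norm \<omega> ^ 3)) summable_on far R"
      by (rule summable_far) fact
  qed (use assms in auto)
  then show ?thesis
    unfolding far_sum_def by (simp only: infsum_cmult_right')
qed

lemma far_wp_has_field_derivative: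
  assumes "0 < R" "z \<in> ball 0 R"
  shows "((\<lambda>z. \<Sum>\<^sub>\<infinity>\<omega>\<in>far R. 1 / (z - \<omega>) ^ 2 - 1 / \<omega> ^ 2) has_field_derivative
           - 2 * far_sum R 3 z) (at z)"
proof -
  have "((\<lambda>z. \<Sum>\<^sub>\<infinity>\<omega>\<in>far R. 1 / (z - \<omega>) ^ 2 - 1 / \<omega> ^ 2) has_field_derivative
      (\<Sum>\<^sub>\<infinity>\<omega>\<in>far R. - 2 * (1 / (z - \<omega>) ^ 3))) (at z)"
  proof (rule infsum_has_field_derivative[where a = 0 and R = R])
    show "(\<lambda>\<omega>. - 2 * (1 / (z - \<omega>) ^ 3)) summable_on far R" if "z \<in> ball 0 R" for z
      by (intro summable_on_cmult_right summable_far_power) (use assms that in auto)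
    show "((\<lambda>z. 1 / (z - \<omega>) ^ 2 - 1 / \<omega> ^ 2) has_field_derivative - 2 * (1 / (z - \<omega>) ^ 3)) (at z)"
      if "\<omega> \<in> far R" "z \<in> ball 0 R" for \<omega> z
      using DERIV_diff[OF inverse_power_has_field_derivative[of z \<omega> 2] DERIV_const[of "1 / \<omega> ^ 2"]]
        far_distance(3)[OF assms(1) that] by (simp add: eval_nat_numeral)
  qed (use assms far_wp_term_bound summable_far in auto)
  then show ?thesis
    unfolding far_sum_def by (simp only: infsum_cmult_right')
qed

abbreviation wp :: "complex \<Rightarrow> complex" where "wp \<equiv> lattice_wp L"

text \<open>
  The derivative of \<open>wp\<close> off the lattice. In contrast to the series of \<open>wp\<close> itself it sums over
  the whole lattice, so that a translation by a period only permutes its terms.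
\<close>
definition wp' :: "complex \<Rightarrow> complex" where
  "wp' z = - 2 * (\<Sum>\<^sub>\<infinity>\<omega>\<in>L. 1 / (z - \<omega>) ^ 3)"

lemma wp_split:
  assumes "0 < R" "z \<in> ball 0 R"
  shows "wp z = 1 / z ^ 2 + (\<Sum>\<omega>\<in>near R. 1 / (z - \<omega>) ^ 2 - 1 / \<omega> ^ 2)
           + (\<Sum>\<^sub>\<infinity>\<omega>\<in>far R. 1 / (z - \<omega>) ^ 2 - 1 / \<omega> ^ 2)"
  unfolding lattice_wp_def near_far(1)[OF assms(1)]
  using summable_far_wp[OF assms] finite_near[of R] near_far(2)[of R]
  by (subst infsum_Un_disjoint) auto

lemma wp'_split:
  assumes "0 < R" "z \<in> ball 0 R"
  shows "wp' z = - 2 * (1 / z ^ 3) + (\<Sum>\<omega>\<in>near R. - 2 * (1 / (z - \<omega>) ^ 3)) - 2 * far_sum R 3 z"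
proof -
  have L: "L = insert 0 (near R) \<union> far R" "insert 0 (near R) \<inter> far R = {}" "0 \<notin> near R"
    using near_far[of R] assms(1) by (auto simp: near_def far_def)
  have "(\<Sum>\<^sub>\<infinity>\<omega>\<in>L. 1 / (z - \<omega>) ^ 3)
      = (\<Sum>\<omega>\<in>insert 0 (near R). 1 / (z - \<omega>) ^ 3) + far_sum R 3 z"
    unfolding far_sum_def using finite_near[of R] summable_far_power[OF assms, of 3] L(2)
    by (subst L(1), subst infsum_Un_disjoint) auto
  then show ?thesis
    unfolding wp'_def using finite_near[of R] L(3) by (simp add: sum_distrib_left algebra_simps)
qed

lemma wp_has_field_derivative:
  assumes "z \<notin> L"
  shows "(wp has_field_derivative wp' z) (at z)"
proof -
  define R where "R = norm z + 1"
  have R: "0 < R" "z \<in> ball 0 R" unfolding R_def by (auto intro: add_nonneg_pos)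
  have nz: "z \<noteq> 0" and nn: "\<And>\<omega>. \<omega> \<in> near R \<Longrightarrow> z \<noteq> \<omega>"
    using assms by (auto simp: near_def)
  have "((\<lambda>z. (\<Sum>\<omega>\<in>near R. 1 / (z - \<omega>) ^ 2 - 1 / \<omega> ^ 2)) has_field_derivative
      (\<Sum>\<omega>\<in>near R. - 2 * (1 / (z - \<omega>) ^ 3))) (at z)"
  proof (rule DERIV_sum)
    show "((\<lambda>z. 1 / (z - \<omega>) ^ 2 - 1 / \<omega> ^ 2) has_field_derivative - 2 * (1 / (z - \<omega>) ^ 3)) (at z)"
      if "\<omega> \<in> near R" for \<omega>
      using DERIV_diff[OF inverse_power_has_field_derivative[of z \<omega> 2] DERIV_const[of "1 / \<omega> ^ 2"]]
        nn[OF that] by (simp add: eval_nat_numeral)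
  qed
  moreover have "((\<lambda>z. 1 / z ^ 2) has_field_derivative - 2 * (1 / z ^ 3)) (at z)"
    using inverse_power_has_field_derivative[of z 0 2] nz by (simp add: eval_nat_numeral)
  ultimately have "((\<lambda>z. 1 / z ^ 2 + (\<Sum>\<omega>\<in>near R. 1 / (z - \<omega>) ^ 2 - 1 / \<omega> ^ 2)
      + (\<Sum>\<^sub>\<infinity>\<omega>\<in>far R. 1 / (z - \<omega>) ^ 2 - 1 / \<omega> ^ 2)) has_field_derivative
      - 2 * (1 / z ^ 3) + (\<Sum>\<omega>\<in>near R. - 2 * (1 / (z - \<omega>) ^ 3)) + - 2 * far_sum R 3 z) (at z)"
    by (intro DERIV_add far_wp_has_field_derivative R)
  then have "((\<lambda>z. 1 / z ^ 2 + (\<Sum>\<omega>\<in>near R. 1 / (z - \<omega>) ^ 2 - 1 / \<omega> ^ 2)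
      + (\<Sum>\<^sub>\<infinity>\<omega>\<in>far R. 1 / (z - \<omega>) ^ 2 - 1 / \<omega> ^ 2)) has_field_derivative wp' z) (at z)"
    using wp'_split[OF R] by simp
  then show ?thesis
    by (rule has_field_derivative_transform_within_open[OF _ open_ball R(2)])
       (use wp_split[OF R(1)] in simp)
qed

lemma wp_holomorphic: "wp holomorphic_on - L"
  using wp_has_field_derivative
  by (auto simp: holomorphic_on_open[OF open_complement])

lemma deriv_wp: "z \<notin> L \<Longrightarrow> deriv wp z = wp' z"
  by (rule DERIV_imp_deriv[OF wp_has_field_derivative])

lemma wp'_holomorphic: "wp' holomorphic_on - L"
proof -
  have "deriv wp holomorphic_on - L" by (rule holomorphic_deriv[OF wp_holomorphic]) auto
  then show ?thesis by (rule holomorphic_transform) (use deriv_wp in auto)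
qed

lemma wp_even: "wp (- z) = wp z"
proof -
  have "bij_betw uminus (L - {0}) (L - {0})"
    by (rule bij_betw_byWitness[where f' = uminus]) auto
  then have "(\<Sum>\<^sub>\<infinity>\<omega>\<in>L - {0}. 1 / (- z - \<omega>) ^ 2 - 1 / \<omega> ^ 2)
      = (\<Sum>\<^sub>\<infinity>\<omega>\<in>L - {0}. 1 / (- z - (- \<omega>)) ^ 2 - 1 / (- \<omega>) ^ 2)"
    using infsum_reindex_bij_betw[of uminus "L - {0}" "L - {0}" "\<lambda>\<omega>. 1 / (- z - \<omega>) ^ 2 - 1 / \<omega> ^ 2"]
    by simp
  also have "\<dots> = (\<Sum>\<^sub>\<infinity>\<omega>\<in>L - {0}. 1 / (z - \<omega>) ^ 2 - 1 / \<omega> ^ 2)"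
    by (simp add: power2_commute)
  finally show ?thesis unfolding lattice_wp_def by simp
qed

lemma wp'_odd: "wp' (- z) = - wp' z"
proof -
  have "bij_betw uminus L L"
    by (rule bij_betw_byWitness[where f' = uminus]) auto
  then have "(\<Sum>\<^sub>\<infinity>\<omega>\<in>L. 1 / (- z - \<omega>) ^ 3) = (\<Sum>\<^sub>\<infinity>\<omega>\<in>L. 1 / (- z - (- \<omega>)) ^ 3)"
    using infsum_reindex_bij_betw[of uminus L L "\<lambda>\<omega>. 1 / (- z - \<omega>) ^ 3"] by simp
  also have "\<dots> = (\<Sum>\<^sub>\<infinity>\<omega>\<in>L. - 1 * (1 / (z - \<omega>) ^ 3))"
  proof (rule infsum_cong)
    fix \<omega>
    have "(- z - (- \<omega>)) ^ 3 = - ((z - \<omega>) ^ 3)" by (simp add: power3_eq_cube algebra_simps)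
    then show "1 / (- z - (- \<omega>)) ^ 3 = - 1 * (1 / (z - \<omega>) ^ 3)" by simp
  qed
  also have "\<dots> = - 1 * (\<Sum>\<^sub>\<infinity>\<omega>\<in>L. 1 / (z - \<omega>) ^ 3)" by (rule infsum_cmult_right')
  finally show ?thesis unfolding wp'_def by simp
qed

lemma wp'_periodic:
  assumes "\<mu> \<in> L"
  shows "wp' (z + \<mu>) = wp' z"
proof -
  have "bij_betw (\<lambda>\<omega>. \<omega> + \<mu>) L L"
    by (rule bij_betw_byWitness[where f' = "\<lambda>\<omega>. \<omega> - \<mu>"])
       (use assms in \<open>auto simp: add_in_iff diff_in_iff\<close>)
  then have "(\<Sum>\<^sub>\<infinity>\<omega>\<in>L. 1 / (z + \<mu> - \<omega>) ^ 3) = (\<Sum>\<^sub>\<infinity>\<omega>\<in>L. 1 / (z + \<mu> - (\<omega> + \<mu>)) ^ 3)"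
    using infsum_reindex_bij_betw[of "\<lambda>\<omega>. \<omega> + \<mu>" L L "\<lambda>\<omega>. 1 / (z + \<mu> - \<omega>) ^ 3"] by simp
  then show ?thesis unfolding wp'_def by simp
qed

text \<open>
  Since \<open>wp'\<close> has the period \<open>\<mu>\<close>, the difference \<open>wp (z + \<mu>) - wp z\<close> is constant; evenness makes it
  vanish at \<open>- \<mu> / 2\<close>, which must therefore not be a pole.
\<close>
lemma wp_periodic_if_half_notin:
  assumes \<mu>: "\<mu> \<in> L" "\<mu> / 2 \<notin> L" and z: "z \<notin> L"
  shows "wp (z + \<mu>) = wp z"
proof -
  let ?d = "\<lambda>z. wp (z + \<mu>) - wp z"
  have d: "(?d has_field_derivative 0) (at z)" if "z \<in> - L" for z
  proof -
    have "((\<lambda>z. wp (z + \<mu>)) has_field_derivative wp' (z + \<mu>)) (at z)"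
      using wp_has_field_derivative[of "z + \<mu>"] that \<mu>(1)
      by (subst DERIV_shift[symmetric]) (simp add: add_in_iff)
    from DERIV_diff[OF this wp_has_field_derivative[of z]] show ?thesis
      using that wp'_periodic[OF \<mu>(1)] by simp
  qed
  obtain c where "\<And>z. z \<in> - L \<Longrightarrow> ?d z = c"
    by (rule DERIV_zero_connected_constant[OF connected_complement open_complement finite.emptyI])
       (use d in \<open>auto intro!: continuous_at_imp_continuous_on DERIV_isCont\<close>)
  then have "?d z = ?d (- (\<mu> / 2))"
    using z \<mu>(2) uminus_in_iff by (metis ComplI)
  also have "\<dots> = wp (\<mu> / 2) - wp (- (\<mu> / 2))" by simp
  also have "\<dots> = 0" by (simp only: wp_even) simp
  finally show ?thesis by simp
qed

text \<open>
  Half of \<open>p * \<omega>1 + q * \<omega>2\<close> is not a lattice point if \<open>p\<close> or \<open>q\<close> is odd. So the previous lemma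
  applies to the two basis vectors, which generate all periods.
\<close>
lemma wp_periodic:
  assumes "\<mu> \<in> L" "z \<notin> L"
  shows "wp (z + \<mu>) = wp z"
proof -
  obtain \<omega>1 \<omega>2 where B: "\<omega>2 / \<omega>1 \<notin> \<real>"
    and L: "L = {of_int m * \<omega>1 + of_int n * \<omega>2 | m n. True}" using basis .
  obtain \<delta> where \<delta>: "\<delta> > 0"
    "\<And>x y :: real. \<delta> * (\<bar>x\<bar> + \<bar>y\<bar>) \<le> norm (of_real x * \<omega>1 + of_real y * \<omega>2)"
    by (rule basis_norm_bound[OF B]) blast
  have half: "(of_int p * \<omega>1 + of_int q * \<omega>2) / 2 \<notin> L" if pq: "odd p \<or> odd q" for p q
  proof
    assume "(of_int p * \<omega>1 + of_int q * \<omega>2) / 2 \<in> L"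
    then obtain m n where "(of_int p * \<omega>1 + of_int q * \<omega>2) / 2 = of_int m * \<omega>1 + of_int n * \<omega>2"
      unfolding L by blast
    then have "of_real (of_int (p - 2 * m)) * \<omega>1 + of_real (of_int (q - 2 * n)) * \<omega>2 = 0"
      by (simp add: field_simps)
    then have "\<delta> * (\<bar>real_of_int (p - 2 * m)\<bar> + \<bar>real_of_int (q - 2 * n)\<bar>) \<le> 0"
      using \<delta>(2)[of "of_int (p - 2 * m)" "of_int (q - 2 * n)"] by simp
    then have "\<bar>real_of_int (p - 2 * m)\<bar> + \<bar>real_of_int (q - 2 * n)\<bar> \<le> 0"
      using \<delta>(1) by (simp add: mult_le_0_iff)
    then have "p = 2 * m" "q = 2 * n" by linarith+
    then show False using pq by simp
  qed
  have in1: "of_int p * \<omega>1 + of_int q * \<omega>2 \<in> L" for p q unfolding L by blast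
  define Per where "Per = {x\<in>L. \<forall>z. z \<notin> L \<longrightarrow> wp (z + x) = wp z}"
  have gen: "\<omega>1 \<in> Per" "\<omega>2 \<in> Per"
    using wp_periodic_if_half_notin half[of 1 0] half[of 0 1] in1[of 1 0] in1[of 0 1]
    unfolding Per_def by auto
  have add: "x + y \<in> Per" if "x \<in> Per" "y \<in> Per" for x y
    using that unfolding Per_def by (auto simp: add_in add_in_iff simp flip: add.assoc)
  have neg: "- x \<in> Per" if "x \<in> Per" for x
  proof -
    have "wp (z + - x) = wp z" if "z \<notin> L" for z
    proof -
      have "z - x \<notin> L" using that \<open>x \<in> Per\<close> by (simp add: Per_def diff_in_iff)
      then have "wp (z - x + x) = wp (z - x)" using \<open>x \<in> Per\<close> unfolding Per_def by blast
      then show ?thesis by simp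
    qed
    then show ?thesis using that unfolding Per_def by simp
  qed
  have zero: "0 \<in> Per" unfolding Per_def by simp
  have natm: "of_nat k * x \<in> Per" if "x \<in> Per" for x k
    by (induction k) (use that add zero in \<open>auto simp: algebra_simps\<close>)
  have intm: "of_int k * x \<in> Per" if "x \<in> Per" for x k
    using natm[OF that] neg[OF natm[OF that]] by (cases k rule: int_cases2) auto
  obtain m n where "\<mu> = of_int m * \<omega>1 + of_int n * \<omega>2" using assms(1) unfolding L by blast
  then have "\<mu> \<in> Per" using add intm gen by simp
  then show ?thesis using assms(2) unfolding Per_def by blast
qed

end

section \<open>The differential equation of the Weierstrass function\<close>

context period_lattice
begin

lemma obtain_far_everything:
  obtains r where "0 < r" "far r = L - {0}" "near r = {}"
proof -
  obtain d where d: "d > 0" "\<And>x. x \<noteq> 0 \<Longrightarrow> dist x 0 < d \<Longrightarrow> x \<notin> L"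
    using eventually_not_in_L[of 0] unfolding eventually_at by blast
  show ?thesis
  proof (rule that[of "d / 3"])
    have "d / 3 * 2 < norm \<omega>" if "\<omega> \<in> L" "\<omega> \<noteq> 0" for \<omega>
      using d(2)[of \<omega>] d(1) that by (force simp: not_less)
    then show "far (d / 3) = L - {0}" "near (d / 3) = {}"
      unfolding far_def near_def using d(1) by (force simp: mult.commute)+
  qed (use d in auto)
qed

text \<open>
  The Taylor coefficients of \<open>wp z - 1 / z ^ 2\<close> at the origin are multiples of the sums of
  \<open>1 / \<omega> ^ k\<close>, which vanish for odd \<open>k\<close>.
\<close>
lemma wp_expansion:
  obtains p q where "(p \<longlongrightarrow> 0) (at 0)" "(q \<longlongrightarrow> 0) (at 0)"
    "\<forall>\<^sub>F z in at 0. wp z = 1 / z ^ 2 + lattice_g2 L / 20 * z ^ 2 + z ^ 4 * (lattice_g3 L / 28 + p z)"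
    "\<forall>\<^sub>F z in at 0. wp' z = - 2 / z ^ 3 + lattice_g2 L / 10 * z + z ^ 3 * (lattice_g3 L / 7 + q z)"
proof -
  obtain r where r: "0 < r" "far r = L - {0}" "near r = {}" by (rule obtain_far_everything)
  let ?g2 = "lattice_g2 L" and ?g3 = "lattice_g3 L"
  define F :: "nat \<Rightarrow> complex \<Rightarrow> complex" where
    "F i = (if i = 0 then (\<lambda>z. \<Sum>\<^sub>\<infinity>\<omega>\<in>far r. 1 / (z - \<omega>) ^ 2 - 1 / \<omega> ^ 2)
            else (\<lambda>z. (-1) ^ i * fact (i + 1) * far_sum r (i + 2) z))" for i
  have dF: "(F i has_field_derivative F (Suc i) z) (at z)" if "z \<in> ball 0 r" for i z
  proof (cases i)
    case 0
    then show ?thesis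
      using far_wp_has_field_derivative[OF r(1) that] by (simp add: F_def numeral_3_eq_3)
  next
    case (Suc j)
    from DERIV_cmult[OF far_sum_has_field_derivative[OF r(1) that, of "i + 2"], of "(-1) ^ i * fact (i + 1)"]
    show ?thesis using Suc by (simp add: F_def algebra_simps)
  qed
  have odd0: "far_sum r k 0 = 0" if "odd k" for k
  proof -
    have "bij_betw uminus (far r) (far r)"
      by (rule bij_betw_byWitness[where f' = uminus]) (auto simp: far_def)
    then have "far_sum r k 0 = (\<Sum>\<^sub>\<infinity>\<omega>\<in>far r. 1 / (0 - (- \<omega>)) ^ k)"
      unfolding far_sum_def
      using infsum_reindex_bij_betw[of uminus "far r" "far r" "\<lambda>\<omega>. 1 / (0 - \<omega>) ^ k"] by simp
    also have "\<dots> = (\<Sum>\<^sub>\<infinity>\<omega>\<in>far r. - 1 * (1 / (0 - \<omega>) ^ k))"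
      using that by (intro infsum_cong) (simp add: power_minus_odd)
    also have "\<dots> = - far_sum r k 0"
      unfolding far_sum_def by (subst infsum_cmult_right') simp
    finally show ?thesis by simp
  qed
  have F0: "F 0 0 = 0" "F 1 0 = 0" "F 2 0 = ?g2 / 10" "F 3 0 = 0" "F 4 0 = 6 / 7 * ?g3"
  proof -
    have "far_sum r 4 0 = (\<Sum>\<^sub>\<infinity>\<omega>\<in>L - {0}. 1 / \<omega> ^ 4)"
      "far_sum r 6 0 = (\<Sum>\<^sub>\<infinity>\<omega>\<in>L - {0}. 1 / \<omega> ^ 6)"
      unfolding far_sum_def r(2) by simp_all
    then show "F 2 0 = ?g2 / 10" "F 4 0 = 6 / 7 * ?g3"
      by (simp_all add: F_def lattice_g2_def lattice_g3_def fact_numeral)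
    show "F 0 0 = 0" "F 1 0 = 0" "F 3 0 = 0" by (simp_all add: F_def odd0)
  qed
  define S where "S = cball (0::complex) (r / 2)"
  have S: "convex S" "S \<subseteq> ball 0 r" "0 \<in> S" unfolding S_def using r(1) by auto
  have dFS: "(F i has_field_derivative F (Suc i) z) (at z within S)" if "z \<in> S" for i z
    by (rule has_field_derivative_at_within[OF dF]) (use S(2) that in blast)
  have "\<exists>B. \<forall>z\<in>S. norm (F i z) \<le> B" for i
  proof -
    have "compact (F i ` S)" unfolding S_def
      by (intro compact_continuous_image continuous_at_imp_continuous_on ballI DERIV_isCont[OF dF])
         (use S in \<open>auto simp: S_def\<close>)
    then show ?thesis by (auto dest!: compact_imp_bounded simp: bounded_iff)
  qed
  then obtain B where B: "\<And>z. z \<in> S \<Longrightarrow> norm (F 5 z) \<le> B" by blast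
  have taylor: "norm (F 0 z - ?g2 / 20 * z ^ 2 - ?g3 / 28 * z ^ 4) \<le> B * norm z ^ 5 / 24"
    "norm (F 1 z - ?g2 / 10 * z - ?g3 / 7 * z ^ 3) \<le> B * norm z ^ 4 / 6" if "z \<in> S" for z
  proof -
    have "norm (F 0 z - (\<Sum>i\<le>4. F i 0 * (z - 0) ^ i / fact i)) \<le> B * norm (z - 0) ^ (Suc 4) / fact 4"
      by (rule complex_Taylor[OF S(1)])
         (use dFS S B that in auto)
    moreover have "{..4::nat} = {0, 1, 2, 3, 4}" by auto
    ultimately show "norm (F 0 z - ?g2 / 20 * z ^ 2 - ?g3 / 28 * z ^ 4) \<le> B * norm z ^ 5 / 24"
      using F0 by (simp add: fact_numeral diff_diff_eq)
    have "norm (F 1 z - (\<Sum>i\<le>3. F (Suc i) 0 * (z - 0) ^ i / fact i)) \<le> B * norm (z - 0) ^ (Suc 3) / fact 3"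
      by (rule complex_Taylor[OF S(1), where f = "\<lambda>i. F (Suc i)", unfolded One_nat_def[symmetric]])
         (use dFS S B that in auto)
    moreover have "{..3::nat} = {0, 1, 2, 3}" by auto
    ultimately show "norm (F 1 z - ?g2 / 10 * z - ?g3 / 7 * z ^ 3) \<le> B * norm z ^ 4 / 6"
      using F0 F0[unfolded numeral_2_eq_2] by (simp add: fact_numeral diff_diff_eq)
  qed
  define p where "p z = (F 0 z - ?g2 / 20 * z ^ 2 - ?g3 / 28 * z ^ 4) / z ^ 4" for z
  define q where "q z = (F 1 z - ?g2 / 10 * z - ?g3 / 7 * z ^ 3) / z ^ 3" for z
  have ev: "\<forall>\<^sub>F z in at 0. z \<in> S \<and> z \<noteq> 0"
    unfolding eventually_at S_def using r(1) by (intro exI[of _ "r / 2"]) auto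
  have lim: "((\<lambda>z::complex. B * norm z / C) \<longlongrightarrow> 0) (at 0)" if "C \<noteq> 0" for C
    using that by (auto intro!: tendsto_eq_intros)
  show ?thesis
  proof (rule that[of p q])
    show "(p \<longlongrightarrow> 0) (at 0)"
    proof (rule Lim_null_comparison[OF _ lim[of 24]])
      show "\<forall>\<^sub>F z in at 0. norm (p z) \<le> B * norm z / 24"
        using ev
      proof eventually_elim
        case (elim z)
        have "norm (p z) \<le> (B * norm z ^ 5 / 24) / norm z ^ 4"
          unfolding p_def norm_divide norm_power
          using taylor(1)[of z] elim by (intro divide_right_mono) auto
        also have "\<dots> = B * norm z / 24" using elim by (simp add: eval_nat_numeral)
        finally show ?case .
      qed
    qed auto
    show "(q \<longlongrightarrow> 0) (at 0)"
    proof (rule Lim_null_comparison[OF _ lim[of 6]])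
      show "\<forall>\<^sub>F z in at 0. norm (q z) \<le> B * norm z / 6"
        using ev
      proof eventually_elim
        case (elim z)
        have "norm (q z) \<le> (B * norm z ^ 4 / 6) / norm z ^ 3"
          unfolding q_def norm_divide norm_power
          using taylor(2)[of z] elim by (intro divide_right_mono) auto
        also have "\<dots> = B * norm z / 6" using elim by (simp add: eval_nat_numeral)
        finally show ?case .
      qed
    qed auto
    show "\<forall>\<^sub>F z in at 0. wp z = 1 / z ^ 2 + ?g2 / 20 * z ^ 2 + z ^ 4 * (?g3 / 28 + p z)"
      using ev
    proof eventually_elim
      case (elim z)
      then have "wp z = 1 / z ^ 2 + F 0 z"
        using wp_split[OF r(1), of z] S(2) unfolding r(3) F_def by auto
      moreover have "z ^ 4 * p z = F 0 z - ?g2 / 20 * z ^ 2 - ?g3 / 28 * z ^ 4"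
        using elim unfolding p_def by simp
      ultimately show ?case by (simp add: algebra_simps)
    qed
    show "\<forall>\<^sub>F z in at 0. wp' z = - 2 / z ^ 3 + ?g2 / 10 * z + z ^ 3 * (?g3 / 7 + q z)"
      using ev
    proof eventually_elim
      case (elim z)
      then have "wp' z = - 2 / z ^ 3 + F 1 z"
        using wp'_split[OF r(1), of z] S(2) unfolding r(3) F_def by (auto simp: numeral_3_eq_3)
      moreover have "z ^ 3 * q z = F 1 z - ?g2 / 10 * z - ?g3 / 7 * z ^ 3"
        using elim unfolding q_def by simp
      ultimately show ?case by (simp add: algebra_simps)
    qed
  qed
qed

lemma wp_times_square_tendsto: "((\<lambda>z. z ^ 2 * wp z) \<longlongrightarrow> 1) (at 0)"
proof -
  obtain p q where pq: "(p \<longlongrightarrow> 0) (at 0)"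
    "\<forall>\<^sub>F z in at 0. wp z = 1 / z ^ 2 + lattice_g2 L / 20 * z ^ 2 + z ^ 4 * (lattice_g3 L / 28 + p z)"
    by (rule wp_expansion) blast
  have "((\<lambda>z. 1 + lattice_g2 L / 20 * z ^ 4 + z ^ 6 * (lattice_g3 L / 28 + p z)) \<longlongrightarrow>
      1 + lattice_g2 L / 20 * 0 ^ 4 + 0 ^ 6 * (lattice_g3 L / 28 + 0)) (at 0)"
    by (intro tendsto_intros pq(1))
  then have "((\<lambda>z. 1 + lattice_g2 L / 20 * z ^ 4 + z ^ 6 * (lattice_g3 L / 28 + p z)) \<longlongrightarrow> 1) (at 0)"
    by simp
  moreover have "\<forall>\<^sub>F z in at 0. 1 + lattice_g2 L / 20 * z ^ 4 + z ^ 6 * (lattice_g3 L / 28 + p z)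
      = z ^ 2 * wp z"
    using pq(2) eventually_neq_at_within[of 0 0 UNIV]
  proof eventually_elim
    case (elim z)
    define w where "w = 1 / z"
    have w: "z * w = 1" unfolding w_def using elim by simp
    have wp: "wp z = w ^ 2 + lattice_g2 L / 20 * z ^ 2 + z ^ 4 * (lattice_g3 L / 28 + p z)"
      using elim unfolding w_def by (simp add: power_divide)
    show ?case unfolding wp using w by algebra
  qed
  ultimately show ?thesis by (rule Lim_transform_eventually)
qed

lemma wp_at_infinity_0: "filterlim wp at_infinity (at 0)"
proof -
  have "filterlim (\<lambda>z::complex. z ^ 2) (at 0) (at 0)"
    unfolding filterlim_at by (auto intro!: tendsto_eq_intros simp: eventually_at_filter)
  then have "filterlim (\<lambda>z. (z ^ 2 * wp z) / z ^ 2) at_infinity (at 0)"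
    by (rule filterlim_divide_at_infinity[OF wp_times_square_tendsto]) simp
  moreover have "\<forall>\<^sub>F z in at 0. (z ^ 2 * wp z) / z ^ 2 = wp z"
    using eventually_neq_at_within[of 0 0 UNIV] by eventually_elim simp
  ultimately show ?thesis
    by (rule filterlim_mono_eventually[OF _ order_refl order_refl])
qed

lemma is_pole_wp: "\<mu> \<in> L \<Longrightarrow> is_pole wp \<mu>"
proof -
  assume \<mu>: "\<mu> \<in> L"
  have "filterlim (\<lambda>z. wp (\<mu> + z)) at_infinity (at 0)"
  proof (rule filterlim_mono_eventually[OF wp_at_infinity_0 order_refl order_refl])
    show "\<forall>\<^sub>F z in at 0. wp z = wp (\<mu> + z)"
      using eventually_not_in_L[of 0]
      by eventually_elim (use wp_periodic[OF \<mu>] in \<open>simp add: add.commute\<close>)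
  qed
  then show ?thesis unfolding is_pole_def by (subst at_to_0) (simp add: filterlim_filtermap add.commute)
qed

lemma wp_meromorphic: "wp meromorphic_on UNIV"
proof (rule meromorphic_onI_open[where pts = L])
  show "wp analytic_on UNIV - L"
    using wp_holomorphic by (simp add: analytic_on_open Compl_eq_Diff_UNIV[symmetric])
  show "not_essential wp z" if "z \<in> L" for z
    using is_pole_wp[OF that] unfolding not_essential_def by blast
qed (use not_islimpt in auto)

text \<open>
  The common value at the lattice points extends \<open>g\<close> to an entire function, bounded because every
  orbit meets a fixed disc.
\<close>
lemma periodic_liouville:
  assumes hol: "g holomorphic_on - L" and per: "\<And>\<mu> z. \<mu> \<in> L \<Longrightarrow> z \<notin> L \<Longrightarrow> g (z + \<mu>) = g z"
    and lim: "(g \<longlongrightarrow> l) (at 0)" and z: "z \<notin> L"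
  shows "g z = l"
proof -
  define G where "G z = (if z \<in> L then l else g z)" for z
  have lim': "(g \<longlongrightarrow> l) (at \<mu>)" if "\<mu> \<in> L" for \<mu>
  proof -
    have "((\<lambda>z. g (\<mu> + z)) \<longlongrightarrow> l) (at 0)"
    proof (rule Lim_transform_eventually[OF lim])
      show "\<forall>\<^sub>F z in at 0. g z = g (\<mu> + z)"
        using eventually_not_in_L[of 0]
        by eventually_elim (use per[OF that] in \<open>simp add: add.commute\<close>)
    qed
    then show ?thesis by (subst at_to_0) (simp add: filterlim_filtermap add.commute)
  qed
  have "G analytic_on {w}" for w
  proof (cases "w \<in> L")
    case True
    obtain d where d: "d > 0" "\<And>x. x \<noteq> w \<Longrightarrow> dist x w < d \<Longrightarrow> x \<notin> L"
      using eventually_not_in_L[of w] unfolding eventually_at by blast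
    have "isolated_singularity_at g w"
    proof (rule isolated_singularity_at_holomorphic)
      show "g holomorphic_on ball w d - {w}"
        by (rule holomorphic_on_subset[OF hol]) (use d(2) in \<open>auto simp: dist_commute\<close>)
    qed (use d in auto)
    then have "(\<lambda>y. if y = w then l else g y) analytic_on {w}"
      by (rule removable_singularity'[OF _ lim'[OF True]])
    moreover have "\<forall>\<^sub>F y in nhds w. (if y = w then l else g y) = G y"
    proof -
      have "\<forall>\<^sub>F y in at w. (if y = w then l else g y) = G y"
        using eventually_not_in_L[of w] by eventually_elim (auto simp: G_def True)
      then show ?thesis by (auto simp: eventually_at_filter G_def True elim!: eventually_mono)
    qed
    ultimately show ?thesis by (subst (asm) analytic_at_cong) auto
  next
    case False
    have "g analytic_on {w}"
      using hol False by (auto simp: analytic_at intro!: exI[of _ "- L"])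
    moreover have "\<forall>\<^sub>F y in nhds w. g y = G y"
      using False by (auto simp: eventually_nhds G_def intro!: exI[of _ "- L"])
    ultimately show ?thesis by (subst (asm) analytic_at_cong) auto
  qed
  then have G: "G holomorphic_on UNIV"
    using analytic_imp_holomorphic analytic_on_analytic_at by blast
  obtain B where B: "\<And>z. \<exists>\<omega>\<in>L. norm (z - \<omega>) \<le> B" using lattice_covering by metis
  have "range G \<subseteq> G ` cball 0 B"
  proof clarify
    fix z
    obtain \<omega> where \<omega>: "\<omega> \<in> L" "norm (z - \<omega>) \<le> B" using B by blast
    have "G z = G (z - \<omega>)"
      using per[OF \<omega>(1), of "z - \<omega>"] \<omega>(1) by (auto simp: G_def diff_in_iff)
    then show "G z \<in> G ` cball 0 B"
      using \<omega>(2) by (intro image_eqI[of _ G "z - \<omega>"]) auto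
  qed
  moreover have "compact (G ` cball 0 B)"
    by (intro compact_continuous_image continuous_on_subset[OF holomorphic_on_imp_continuous_on[OF G]]) auto
  ultimately have "bounded (range G)" using bounded_subset compact_imp_bounded by blast
  then obtain c where "\<And>z. G z = c" using Liouville_theorem[OF G] by (auto simp: constant_on_def)
  then have "G z = G 0" by metis
  then show ?thesis using z by (simp add: G_def)
qed

text \<open>
  The Laurent coefficients are such that the difference of both sides has no pole at the origin and
  tends to 0 there; being elliptic, it vanishes identically.
\<close>
theorem wp_differential_equation:
  assumes "z \<notin> L"
  shows "wp' z ^ 2 = 4 * wp z ^ 3 - lattice_g2 L * wp z - lattice_g3 L"
proof -
  let ?g2 = "lattice_g2 L" and ?g3 = "lattice_g3 L"
  define D where "D z = wp' z ^ 2 - 4 * wp z ^ 3 + ?g2 * wp z + ?g3" for z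
  obtain p q where pq: "(p \<longlongrightarrow> 0) (at 0)" "(q \<longlongrightarrow> 0) (at 0)"
    "\<forall>\<^sub>F z in at 0. wp z = 1 / z ^ 2 + ?g2 / 20 * z ^ 2 + z ^ 4 * (?g3 / 28 + p z)"
    "\<forall>\<^sub>F z in at 0. wp' z = - 2 / z ^ 3 + ?g2 / 10 * z + z ^ 3 * (?g3 / 7 + q z)"
    by (rule wp_expansion)
  have "D z = 0"
  proof (rule periodic_liouville[OF _ _ _ assms])
    show "D holomorphic_on - L"
      unfolding D_def by (intro holomorphic_intros wp_holomorphic wp'_holomorphic)
    show "D (z + \<mu>) = D z" if "\<mu> \<in> L" "z \<notin> L" for \<mu> z
      unfolding D_def using wp'_periodic wp_periodic that by simp
    define E where "E z = (?g2 / 10 * z + z ^ 3 * (?g3 / 7 + q z)) ^ 2 - 4 * q z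
      - 12 * (?g2 / 20 * z + z ^ 3 * (?g3 / 28 + p z)) ^ 2 - 12 * p z
      - 4 * (?g2 / 20 * z ^ 2 + z ^ 4 * (?g3 / 28 + p z)) ^ 3
      + ?g2 * (?g2 / 20 * z ^ 2 + z ^ 4 * (?g3 / 28 + p z))" for z
    have "(E \<longlongrightarrow> (?g2 / 10 * 0 + 0 ^ 3 * (?g3 / 7 + 0)) ^ 2 - 4 * 0
      - 12 * (?g2 / 20 * 0 + 0 ^ 3 * (?g3 / 28 + 0)) ^ 2 - 12 * 0
      - 4 * (?g2 / 20 * 0 ^ 2 + 0 ^ 4 * (?g3 / 28 + 0)) ^ 3
      + ?g2 * (?g2 / 20 * 0 ^ 2 + 0 ^ 4 * (?g3 / 28 + 0))) (at 0)"
      unfolding E_def by (intro tendsto_intros pq)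
    then have E: "(E \<longlongrightarrow> 0) (at 0)" by simp
    show "(D \<longlongrightarrow> 0) (at 0)"
    proof (rule Lim_transform_eventually[OF E])
      show "\<forall>\<^sub>F z in at 0. E z = D z"
        using pq(3,4) eventually_neq_at_within[of 0 0 UNIV]
      proof eventually_elim
        case (elim z)
        define a b where "a = ?g2 / 20" and "b = ?g3 / 28"
        have g: "?g2 = 20 * a" "?g3 = 28 * b" unfolding a_def b_def by simp_all
        define w where "w = 1 / z"
        have w: "z * w = 1" unfolding w_def using elim by simp
        define e f where "e = 2 * a * z + z ^ 3 * (4 * b + q z)"
          and "f = a * z ^ 2 + z ^ 4 * (b + p z)"
        have wp: "wp z = w ^ 2 + f"
          using elim unfolding w_def f_def a_def b_def by (simp add: power_divide)
        have wp': "wp' z = - 2 * w ^ 3 + e"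
          using elim unfolding w_def e_def a_def b_def by (simp add: power_divide)
        have red: "w ^ 3 * e = 2 * a * w ^ 2 + 4 * b + q z" "w ^ 4 * f = a * w ^ 2 + b + p z"
          "w * f = a * z + z ^ 3 * (b + p z)"
          unfolding e_def f_def using w by algebra+
        have "D z = e ^ 2 - 4 * (w ^ 3 * e) - 12 * (w ^ 4 * f) - 12 * (w * f) ^ 2 - 4 * f ^ 3
            + ?g2 * (w ^ 2 + f) + ?g3"
          unfolding D_def wp wp' by (simp add: eval_nat_numeral algebra_simps)
        also have "\<dots> = e ^ 2 - 4 * q z - 12 * (w * f) ^ 2 - 12 * p z - 4 * f ^ 3 + ?g2 * f"
          unfolding red(1,2) g by (simp add: algebra_simps)
        also have "\<dots> = E z"
          unfolding red(3) unfolding E_def e_def f_def a_def b_def by simp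
        finally show ?case by simp
      qed
    qed
  qed
  then show ?thesis unfolding D_def by (simp add: algebra_simps)
qed

text \<open>If \<open>wp\<close> omitted \<open>a\<close>, then \<open>1 / (wp z - a)\<close> would be elliptic without poles.\<close>
lemma wp_surjective:
  obtains w where "w \<notin> L" "wp w = a"
proof (rule ccontr)
  assume no: "\<not> thesis"
  have "\<And>w. w \<notin> L \<Longrightarrow> wp w \<noteq> a" using no that by blast
  then have av: "\<And>w. w \<notin> L \<Longrightarrow> wp w - a \<noteq> 0" by simp
  have "\<not> UNIV \<subseteq> L" using countable_L uncountable_UNIV_complex countable_subset by blast
  then obtain w where w: "w \<notin> L" by blast
  have "1 / (wp w - a) = 0"
  proof (rule periodic_liouville[OF _ _ _ w])
    show "(\<lambda>w. 1 / (wp w - a)) holomorphic_on - L"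
      by (intro holomorphic_intros wp_holomorphic) (use av in auto)
    show "1 / (wp (z + \<mu>) - a) = 1 / (wp z - a)" if "\<mu> \<in> L" "z \<notin> L" for \<mu> z
      using wp_periodic that by simp
    have "filterlim (\<lambda>w. wp w + (- a)) at_infinity (at 0)"
      by (rule tendsto_add_filterlim_at_infinity'[OF wp_at_infinity_0 tendsto_const])
    then show "((\<lambda>w. 1 / (wp w - a)) \<longlongrightarrow> 0) (at 0)"
      by (intro tendsto_divide_0[OF tendsto_const]) simp
  qed
  then show False using av[OF w] by simp
qed

text \<open>Points over the curve: the sign of \<open>wp'\<close> is changed by \<open>z \<mapsto> - z\<close>.\<close>
lemma wp_curve_surjective:
  assumes "y ^ 2 = 4 * x ^ 3 - lattice_g2 L * x - lattice_g3 L"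
  obtains w where "w \<notin> L" "wp w = x" "wp' w = y"
proof -
  obtain w where w: "w \<notin> L" "wp w = x" by (rule wp_surjective)
  then have "wp' w ^ 2 = y ^ 2" using wp_differential_equation[OF w(1)] assms by simp
  then consider "wp' w = y" | "wp' w = - y" by (auto simp: power2_eq_iff)
  then show ?thesis
  proof cases
    case 1
    then show ?thesis using that w by blast
  next
    case 2
    then show ?thesis using that[of "- w"] w wp_even wp'_odd by simp
  qed
qed

text \<open>
  For \<open>g2 = g3 = 0\<close> the equation reads \<open>(wp' / wp) ^ 2 = 4 * wp\<close>; at a zero \<open>w\<close> of \<open>wp\<close> of order
  \<open>n\<close> the left side has a pole and the right side vanishes.
\<close>
lemma g2_g3_not_both_zero: "lattice_g2 L \<noteq> 0 \<or> lattice_g3 L \<noteq> 0"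
proof (rule ccontr)
  assume "\<not> ?thesis"
  then have ode: "wp' z ^ 2 = 4 * wp z ^ 3" if "z \<notin> L" for z
    using wp_differential_equation[OF that] by simp
  obtain w where w: "w \<notin> L" "wp w = 0" by (rule wp_surjective)
  obtain z1 where z1: "z1 \<notin> L" "wp z1 = 1" by (rule wp_surjective)
  let ?n = "zorder wp w" and ?g = "zor_poly wp w"
  have "\<exists>w\<in>- L. wp w \<noteq> 0" using z1 by (intro bexI[of _ z1]) auto
  then obtain r where n: "?n > 0" and r: "r > 0" "cball w r \<subseteq> - L" "?g holomorphic_on cball w r"
    "\<And>z. z \<in> cball w r \<Longrightarrow> wp z = ?g z * (z - w) ^ nat ?n \<and> ?g z \<noteq> 0"
    using zorder_exist_zero[OF wp_holomorphic open_complement connected_complement, of w] w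
    by auto
  define m where "m = nat ?n - 1"
  have m: "nat ?n = Suc m" using n unfolding m_def by simp
  have g: "?g holomorphic_on ball w r" using r(3) by (rule holomorphic_on_subset) auto
  have wp'_eq: "wp' z = (z - w) ^ m * (deriv ?g z * (z - w) + of_nat (Suc m) * ?g z)"
    if "z \<in> ball w r" for z
  proof -
    have "(?g has_field_derivative deriv ?g z) (at z)"
      by (rule holomorphic_derivI[OF g open_ball that])
    moreover have "((\<lambda>z. z - w) has_field_derivative 1) (at z)"
      by (auto intro!: derivative_eq_intros)
    from DERIV_power_Suc[OF this, of m]
    have "((\<lambda>z. (z - w) ^ Suc m) has_field_derivative of_nat (Suc m) * (z - w) ^ m) (at z)" by simp
    ultimately have "((\<lambda>z. ?g z * (z - w) ^ Suc m) has_field_derivative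
        deriv ?g z * (z - w) ^ Suc m + of_nat (Suc m) * (z - w) ^ m * ?g z) (at z)"
      by (rule DERIV_mult)
    then have "(wp has_field_derivative
        deriv ?g z * (z - w) ^ Suc m + of_nat (Suc m) * (z - w) ^ m * ?g z) (at z)"
      by (rule has_field_derivative_transform_within_open[OF _ open_ball that])
         (use r(4) m in auto)
    moreover have "z \<notin> L" using that r(2) by (meson ComplD ball_subset_cball subsetD)
    ultimately show ?thesis
      using DERIV_unique[OF wp_has_field_derivative] by (fastforce simp: algebra_simps)
  qed
  have cont: "(?g \<longlongrightarrow> ?g w) (at w)" "(deriv ?g \<longlongrightarrow> deriv ?g w) (at w)"
    using holomorphic_on_imp_continuous_on[OF g] holomorphic_on_imp_continuous_on[OF holomorphic_deriv[OF g]]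
      r(1) by (auto simp: continuous_on_eq_continuous_at isCont_def)
  have ev: "\<forall>\<^sub>F z in at w. (deriv ?g z * (z - w) + of_nat (Suc m) * ?g z) ^ 2
      = 4 * (z - w) ^ (m + 3) * ?g z ^ 3"
  proof -
    have "\<forall>\<^sub>F z in at w. z \<in> ball w r - {w}" using r(1) by (intro eventually_at_in_open) auto
    then show ?thesis
    proof eventually_elim
      case (elim z)
      then have z: "z \<in> ball w r" "z \<in> cball w r" "z - w \<noteq> 0" by auto
      then have "z \<notin> L" using r(2) by blast
      with z have "((z - w) ^ m) ^ 2 * (deriv ?g z * (z - w) + of_nat (Suc m) * ?g z) ^ 2
          = 4 * (?g z * (z - w) ^ Suc m) ^ 3"
        using ode[of z] wp'_eq[of z] r(4)[of z] m by (simp add: power_mult_distrib)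
      also have "\<dots> = ((z - w) ^ m) ^ 2 * (4 * (z - w) ^ (m + 3) * ?g z ^ 3)"
        by (simp add: power_add power_mult_distrib eval_nat_numeral)
      finally show ?case using \<open>z - w \<noteq> 0\<close> by simp
    qed
  qed
  have l1: "((\<lambda>z. (deriv ?g z * (z - w) + of_nat (Suc m) * ?g z) ^ 2) \<longlongrightarrow>
      (deriv ?g w * (w - w) + of_nat (Suc m) * ?g w) ^ 2) (at w)"
    by (intro tendsto_intros cont)
  have l2: "((\<lambda>z. 4 * (z - w) ^ (m + 3) * ?g z ^ 3) \<longlongrightarrow>
      4 * (w - w) ^ (m + 3) * ?g w ^ 3) (at w)"
    by (intro tendsto_intros cont)
  have "(deriv ?g w * (w - w) + of_nat (Suc m) * ?g w) ^ 2 = 4 * (w - w) ^ (m + 3) * ?g w ^ 3"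
    by (rule tendsto_unique[OF trivial_limit_at Lim_transform_eventually[OF l1 ev] l2])
  then have "of_nat (Suc m) * ?g w = 0" by (simp add: power_0_left del: of_nat_Suc)
  then show False using r(4)[of w] r(1) by (simp del: of_nat_Suc)
qed

end

section \<open>Lattices with vanishing second invariant\<close>

text \<open>
  The hexagonal lattice is mapped to itself by the cube root of unity \<open>\<rho>\<close>, whence
  \<open>g2 = \<rho> ^ 2 * g2\<close>.
\<close>
lemma exists_lattice_g2_zero: "\<exists>L. is_lattice L \<and> lattice_g2 L = 0"
proof -
  define \<rho> :: complex where "\<rho> = Complex (- 1 / 2) (sqrt 3 / 2)"
  define L where "L = {of_int m * 1 + of_int n * \<rho> | m n. True}"
  have \<rho>2: "\<rho> ^ 2 = - 1 - \<rho>"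
    unfolding \<rho>_def by (simp add: complex_eq_iff power2_eq_square field_simps)
  have \<rho>3: "\<rho> ^ 3 = 1" using \<rho>2 by algebra
  have \<rho>1: "\<rho> \<noteq> 1" "\<rho> \<noteq> 0" unfolding \<rho>_def by (simp_all add: complex_eq_iff)
  have "\<rho> \<notin> \<real>" unfolding \<rho>_def by (simp add: complex_is_Real_iff)
  then have "is_lattice L" unfolding is_lattice_def L_def by (intro exI[of _ 1] exI[of _ \<rho>]) auto
  moreover have "lattice_g2 L = 0"
  proof -
    have mult: "\<rho> * x \<in> L" if x: "x \<in> L" for x
    proof -
      obtain m n :: int where "x = of_int m * 1 + of_int n * \<rho>" using x unfolding L_def by blast
      then have "\<rho> * x = of_int m * \<rho> + of_int n * \<rho> ^ 2" by (simp add: algebra_simps power2_eq_square)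
      also have "\<dots> = of_int (- n) * 1 + of_int (m - n) * \<rho>" unfolding \<rho>2 by (simp add: algebra_simps)
      finally show ?thesis unfolding L_def by blast
    qed
    have inv: "\<rho> * (\<rho> ^ 2 * x) = x" "\<rho> ^ 2 * (\<rho> * x) = x" for x
      using \<rho>3 by (simp_all add: eval_nat_numeral flip: mult.assoc)
    have "bij_betw ((*) \<rho>) (L - {0}) (L - {0})"
    proof (rule bij_betw_byWitness[where f' = "\<lambda>x. \<rho> ^ 2 * x"])
      show "(\<lambda>x. \<rho> ^ 2 * x) ` (L - {0}) \<subseteq> L - {0}"
        using mult[OF mult] \<rho>1 by (auto simp: power2_eq_square mult.assoc)
    qed (use mult \<rho>1 inv in auto)
    then have "(\<Sum>\<^sub>\<infinity>\<omega>\<in>L - {0}. 1 / \<omega> ^ 4) = (\<Sum>\<^sub>\<infinity>\<omega>\<in>L - {0}. 1 / (\<rho> * \<omega>) ^ 4)"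
      using infsum_reindex_bij_betw[of "(*) \<rho>" "L - {0}" "L - {0}" "\<lambda>\<omega>. 1 / \<omega> ^ 4"] by simp
    also have "\<dots> = (\<Sum>\<^sub>\<infinity>\<omega>\<in>L - {0}. 1 / \<rho> ^ 4 * (1 / \<omega> ^ 4))"
      by (simp add: power_mult_distrib)
    also have "\<dots> = 1 / \<rho> ^ 4 * (\<Sum>\<^sub>\<infinity>\<omega>\<in>L - {0}. 1 / \<omega> ^ 4)" by (rule infsum_cmult_right')
    finally have "(1 - 1 / \<rho> ^ 4) * (\<Sum>\<^sub>\<infinity>\<omega>\<in>L - {0}. 1 / \<omega> ^ 4) = 0" by (simp add: algebra_simps)
    moreover have "\<rho> ^ 4 = \<rho>" using \<rho>3 by (simp add: eval_nat_numeral)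
    ultimately show ?thesis using \<rho>1 by (simp add: lattice_g2_def)
  qed
  ultimately show ?thesis by blast
qed

lemma lattice_scale:
  assumes "is_lattice L" "s \<noteq> 0"
  shows "is_lattice ((*) s ` L)" "lattice_g2 ((*) s ` L) = lattice_g2 L / s ^ 4"
    "lattice_g3 ((*) s ` L) = lattice_g3 L / s ^ 6"
proof -
  obtain \<omega>1 \<omega>2 where B: "\<omega>2 / \<omega>1 \<notin> \<real>"
    and L: "L = {of_int m * \<omega>1 + of_int n * \<omega>2 | m n. True}"
    using assms(1) unfolding is_lattice_def by blast
  have "(*) s ` L = {of_int m * (s * \<omega>1) + of_int n * (s * \<omega>2) | m n. True}"
    unfolding L by (force simp: algebra_simps)
  moreover have "s * \<omega>2 / (s * \<omega>1) \<notin> \<real>" using B assms(2) by simp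
  ultimately show "is_lattice ((*) s ` L)" unfolding is_lattice_def by blast
  have inj: "inj_on ((*) s) A" for A using assms(2) by (auto simp: inj_on_def)
  have img: "(*) s ` L - {0} = (*) s ` (L - {0})" using assms(2) by auto
  have sum: "(\<Sum>\<^sub>\<infinity>\<omega>\<in>(*) s ` L - {0}. 1 / \<omega> ^ k) = (\<Sum>\<^sub>\<infinity>\<omega>\<in>L - {0}. 1 / \<omega> ^ k) / s ^ k" for k
  proof -
    have "(\<Sum>\<^sub>\<infinity>\<omega>\<in>(*) s ` L - {0}. 1 / \<omega> ^ k) = (\<Sum>\<^sub>\<infinity>\<omega>\<in>L - {0}. (1 / s ^ k) * (1 / \<omega> ^ k))"
      unfolding img by (subst infsum_reindex[OF inj]) (simp add: o_def power_mult_distrib)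
    then show ?thesis by (simp only: infsum_cmult_right') simp
  qed
  show "lattice_g2 ((*) s ` L) = lattice_g2 L / s ^ 4" "lattice_g3 ((*) s ` L) = lattice_g3 L / s ^ 6"
    unfolding lattice_g2_def lattice_g3_def sum by simp_all
qed

text \<open>
  Stretching a lattice by \<open>s\<close> divides \<open>g3\<close> by \<open>s ^ 6\<close>, so one lattice with \<open>g2 = 0\<close> yields all values.
\<close>
theorem exists_lattice_equianharmonic:
  assumes "g3 \<noteq> 0"
  shows "\<exists>L. is_lattice L \<and> lattice_g2 L = 0 \<and> lattice_g3 L = g3"
proof -
  obtain L where L: "is_lattice L" "lattice_g2 L = 0" using exists_lattice_g2_zero by blast
  then interpret period_lattice L by unfold_locales
  have nz: "lattice_g3 L \<noteq> 0" using g2_g3_not_both_zero L(2) by simp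
  obtain s where s: "lattice_g3 L / g3 = s ^ 6"
    using exists_complex_root[of 6 "lattice_g3 L / g3"] by auto
  then have "s \<noteq> 0" using nz assms by auto
  then show ?thesis
    using lattice_scale[OF L(1), of s] L(2) s nz assms
    by (intro exI[of _ "(*) s ` L"]) (auto simp: field_simps)
qed

section \<open>The Schwarzian derivative near a point\<close>

text \<open>
  At a point that is not a pole, the value \<open>a\<close> is subtracted first, so that the exponent is the
  multiplicity with which \<open>u\<close> takes the value \<open>a\<close>.
\<close>
lemma meromorphic_local_form:
  assumes mero: "u meromorphic_on {z0}" and nonconst: "\<And>a. \<forall>\<^sub>F z in at z0. u z \<noteq> a"
  obtains
    (regular) a f m where "1 \<le> m" "f analytic_on {z0}" "f z0 \<noteq> 0"
      "\<forall>\<^sub>F z in at z0. u z = a + f z * (z - z0) powi int m"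
  | (pole) f m where "1 \<le> m" "f analytic_on {z0}" "f z0 \<noteq> 0" "is_pole u z0"
      "\<forall>\<^sub>F z in at z0. u z = 0 + f z * (z - z0) powi (- int m)"
proof -
  have iso: "isolated_singularity_at u z0" and ness: "not_essential u z0"
    using mero meromorphic_at_iff by blast+
  have form: "\<exists>f. f analytic_on {z0} \<and> f z0 \<noteq> 0 \<and>
      (\<forall>\<^sub>F z in at z0. u z = a + f z * (z - z0) powi zorder (\<lambda>z. u z - a) z0)" for a
  proof -
    let ?v = "\<lambda>z. u z - a"
    have "?v meromorphic_on {z0}" by (intro meromorphic_intros mero)
    then have "isolated_singularity_at ?v z0" "not_essential ?v z0"
      using meromorphic_at_iff by blast+
    moreover have "\<exists>\<^sub>F z in at z0. ?v z \<noteq> 0"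
      using nonconst[of a] by (intro eventually_frequently) auto
    ultimately obtain r where r: "zor_poly ?v z0 z0 \<noteq> 0" "r > 0" "zor_poly ?v z0 holomorphic_on cball z0 r"
      "\<And>w. w \<in> cball z0 r - {z0} \<Longrightarrow> ?v w = zor_poly ?v z0 w * (w - z0) powi zorder ?v z0"
      using zorder_exist[of ?v z0] by blast
    have "zor_poly ?v z0 analytic_on {z0}"
      using r(2,3) by (intro holomorphic_on_imp_analytic_at[of _ "ball z0 r"])
        (auto intro: holomorphic_on_subset)
    moreover have "\<forall>\<^sub>F w in at z0. w \<in> ball z0 r - {z0}"
      using r(2) by (intro eventually_at_in_open) auto
    then have "\<forall>\<^sub>F w in at z0. u w = a + zor_poly ?v z0 w * (w - z0) powi zorder ?v z0"
    proof eventually_elim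
      case (elim w)
      then have "w \<in> cball z0 r - {z0}" by auto
      from r(4)[OF this] show ?case by (simp add: algebra_simps)
    qed
    ultimately show ?thesis using r(1) by blast
  qed
  show ?thesis
  proof (cases "is_pole u z0")
    case True
    then have "zorder u z0 < 0" using isolated_pole_imp_neg_zorder[OF iso] by blast
    moreover obtain f where "f analytic_on {z0}" "f z0 \<noteq> 0"
      "\<forall>\<^sub>F z in at z0. u z = 0 + f z * (z - z0) powi zorder (\<lambda>z. u z - 0) z0"
      using form[of 0] by blast
    ultimately show ?thesis
      using pole[of "nat (- zorder u z0)" f] True by simp
  next
    case False
    then obtain a where a: "(u \<longlongrightarrow> a) (at z0)" using ness unfolding not_essential_def by blast
    let ?n = "zorder (\<lambda>z. u z - a) z0"
    obtain f where f: "f analytic_on {z0}" "f z0 \<noteq> 0"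
      "\<forall>\<^sub>F z in at z0. u z = a + f z * (z - z0) powi ?n"
      using form[of a] by blast
    have "?n > 0"
    proof (rule ccontr)
      assume n: "\<not> ?n > 0"
      define k where "k = nat (- ?n)"
      have "((\<lambda>z. (u z - a) * (z - z0) ^ k) \<longlongrightarrow> (a - a) * (z0 - z0) ^ k) (at z0)"
        by (intro tendsto_intros a)
      moreover have "\<forall>\<^sub>F z in at z0. (u z - a) * (z - z0) ^ k = f z"
        using f(3) eventually_neq_at_within[of z0 z0 UNIV]
      proof eventually_elim
        case (elim z)
        have "?n = - int k" using n unfolding k_def by simp
        then show ?case using elim by (simp add: power_int_minus)
      qed
      ultimately have "(f \<longlongrightarrow> 0) (at z0)" using Lim_transform_eventually by force
      moreover have "(f \<longlongrightarrow> f z0) (at z0)"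
        using analytic_at_imp_isCont[OF f(1)] by (simp add: isCont_def)
      ultimately show False using f(2) tendsto_unique trivial_limit_at by metis
    qed
    then show ?thesis using regular[of "nat ?n" f a] f by simp
  qed
qed

text \<open>
  For \<open>u = a + f * (z - z0) ^ n\<close> one has \<open>u''/u' = (n - 1) / (z - z0) + q\<close>, where \<open>q\<close> is the
  logarithmic derivative of the cofactor of \<open>(z - z0) ^ (n - 1)\<close> in \<open>u'\<close>.
\<close>
lemma schwarzian_local_form:
  assumes f: "f analytic_on {z0}" "f z0 \<noteq> 0" and n: "n \<noteq> 0"
    and u: "\<forall>\<^sub>F z in at z0. u z = a + f z * (z - z0) powi n"
  obtains f1 q where "f1 analytic_on {z0}" "f1 z0 = of_int n * f z0" "q analytic_on {z0}"
    "\<forall>\<^sub>F z in at z0. deriv u z = f1 z * (z - z0) powi (n - 1)"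
    "\<forall>\<^sub>F z in at z0. schwarzian u z =
       (1 - of_int n ^ 2) / 2 / (z - z0) ^ 2 - of_int (n - 1) * q z / (z - z0) + deriv q z - q z ^ 2 / 2"
proof -
  obtain r1 where r1: "r1 > 0" "f holomorphic_on ball z0 r1"
    using f(1) unfolding analytic_on_def by blast
  obtain r2 where r2: "r2 > 0" "\<And>z. z \<noteq> z0 \<Longrightarrow> dist z z0 < r2 \<Longrightarrow> u z = a + f z * (z - z0) powi n"
    using u unfolding eventually_at by auto
  define f1 where "f1 z = of_int n * f z + (z - z0) * deriv f z" for z
  have f1_hol: "f1 holomorphic_on ball z0 r1"
    unfolding f1_def by (intro holomorphic_intros holomorphic_deriv r1) auto
  have f1z0: "f1 z0 = of_int n * f z0" unfolding f1_def by simp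
  then have "f1 z0 \<noteq> 0" using n f(2) by simp
  moreover have "isCont f1 z0"
    using holomorphic_on_imp_continuous_on[OF f1_hol] r1(1) by (simp add: continuous_on_eq_continuous_at)
  ultimately obtain r3 where r3: "r3 > 0" "\<And>z. dist z0 z < r3 \<Longrightarrow> f1 z \<noteq> 0"
    using continuous_at_avoid[of z0 f1 0] by blast
  define r where "r = Min {r1, r2, r3}"
  have r: "r > 0" "r \<le> r1" "r \<le> r2" "r \<le> r3" unfolding r_def using r1(1) r2(1) r3(1) by auto
  define A where "A = ball z0 r - {z0}"
  have A: "open A" unfolding A_def by auto
  have Ad: "z \<noteq> z0" "dist z z0 < r2" "z \<in> ball z0 r1" "f1 z \<noteq> 0" "z - z0 \<noteq> 0" if "z \<in> A" for z
    using that r r3(2) unfolding A_def by (auto simp: dist_commute)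
  define q where "q z = deriv f1 z / f1 z" for z
  have q_hol: "q holomorphic_on ball z0 r"
    unfolding q_def
    by (intro holomorphic_intros holomorphic_deriv holomorphic_on_subset[OF f1_hol])
       (use r r3(2) in auto)
  have du: "deriv u z = f1 z * (z - z0) powi (n - 1)" if z: "z \<in> A" for z
  proof (rule DERIV_imp_deriv)
    have "(f has_field_derivative deriv f z) (at z)"
      by (rule holomorphic_derivI[OF r1(2) open_ball Ad(3)[OF z]])
    moreover have "((\<lambda>z. (z - z0) powi n) has_field_derivative
        of_int n * (z - z0) powi (n - 1)) (at z)"
      using Ad(5)[OF z] by (auto intro!: derivative_eq_intros)
    ultimately have "((\<lambda>z. a + f z * (z - z0) powi n) has_field_derivative
        0 + (deriv f z * (z - z0) powi n + of_int n * (z - z0) powi (n - 1) * f z)) (at z)"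
      by (intro DERIV_add DERIV_const DERIV_mult)
    also have "(z - z0) powi n = (z - z0) * (z - z0) powi (n - 1)"
      using Ad(5)[OF z] by (simp add: power_int_diff)
    finally have "((\<lambda>z. a + f z * (z - z0) powi n) has_field_derivative
        f1 z * (z - z0) powi (n - 1)) (at z)"
      unfolding f1_def by (simp add: algebra_simps)
    then show "(u has_field_derivative f1 z * (z - z0) powi (n - 1)) (at z)"
      by (rule has_field_derivative_transform_within_open[OF _ A z]) (use r2(2) Ad in auto)
  qed
  have ddu: "deriv (deriv u) z / deriv u z = of_int (n - 1) / (z - z0) + q z" if z: "z \<in> A" for z
  proof -
    have "(f1 has_field_derivative deriv f1 z) (at z)"
      by (rule holomorphic_derivI[OF f1_hol open_ball Ad(3)[OF z]])
    moreover have "((\<lambda>z. (z - z0) powi (n - 1)) has_field_derivative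
        of_int (n - 1) * (z - z0) powi (n - 1 - 1)) (at z)"
      using Ad(5)[OF z] by (auto intro!: derivative_eq_intros)
    ultimately have "((\<lambda>z. f1 z * (z - z0) powi (n - 1)) has_field_derivative
        deriv f1 z * (z - z0) powi (n - 1) + of_int (n - 1) * (z - z0) powi (n - 1 - 1) * f1 z) (at z)"
      by (intro DERIV_mult)
    then have "(deriv u has_field_derivative
        deriv f1 z * (z - z0) powi (n - 1) + of_int (n - 1) * (z - z0) powi (n - 1 - 1) * f1 z) (at z)"
      by (rule has_field_derivative_transform_within_open[OF _ A z]) (use du in auto)
    then have "deriv (deriv u) z = deriv f1 z * (z - z0) powi (n - 1)
        + of_int (n - 1) * (z - z0) powi (n - 1 - 1) * f1 z"
      by (rule DERIV_imp_deriv)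
    moreover have "(z - z0) powi (n - 1 - 1) = (z - z0) powi (n - 1) / (z - z0)"
      using Ad(5)[OF z] by (subst power_int_diff) auto
    moreover have "(d * P + k * (P / t) * g) / (g * P) = k / t + d / g"
      if "P \<noteq> 0" "t \<noteq> 0" "g \<noteq> 0" for d P k t g :: complex
      using that by (simp add: field_simps)
    ultimately show ?thesis
      unfolding du[OF z] q_def using Ad(4,5)[OF z] by simp
  qed
  have S: "schwarzian u z = (1 - of_int n ^ 2) / 2 / (z - z0) ^ 2 - of_int (n - 1) * q z / (z - z0)
      + deriv q z - q z ^ 2 / 2" if z: "z \<in> A" for z
  proof -
    have "(q has_field_derivative deriv q z) (at z)"
      by (rule holomorphic_derivI[OF q_hol open_ball]) (use z A_def in auto)
    moreover have "((\<lambda>z. of_int (n - 1) / (z - z0)) has_field_derivative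
        - of_int (n - 1) / (z - z0) ^ 2) (at z)"
      using Ad(5)[OF z] by (auto intro!: derivative_eq_intros simp: power2_eq_square)
    ultimately have "((\<lambda>z. of_int (n - 1) / (z - z0) + q z) has_field_derivative
        - of_int (n - 1) / (z - z0) ^ 2 + deriv q z) (at z)"
      by (intro DERIV_add)
    then have "((\<lambda>z. deriv (deriv u) z / deriv u z) has_field_derivative
        - of_int (n - 1) / (z - z0) ^ 2 + deriv q z) (at z)"
      by (rule has_field_derivative_transform_within_open[OF _ A z]) (use ddu in auto)
    then have "deriv (\<lambda>z. deriv (deriv u) z / deriv u z) z
        = - of_int (n - 1) / (z - z0) ^ 2 + deriv q z"
      by (rule DERIV_imp_deriv)
    moreover have "- k / t ^ 2 + d - 1 / 2 * (k / t + p) ^ 2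
        = (1 - (k + 1) ^ 2) / 2 / t ^ 2 - k * p / t + d - p ^ 2 / 2"
      if "t \<noteq> 0" for k t d p :: complex
      using that by (simp add: power2_eq_square field_simps)
    from this[OF Ad(5)[OF z], of "of_int (n - 1)" "deriv q z" "q z"]
    have "- of_int (n - 1) / (z - z0) ^ 2 + deriv q z - 1 / 2 * (of_int (n - 1) / (z - z0) + q z) ^ 2
        = (1 - of_int n ^ 2) / 2 / (z - z0) ^ 2 - of_int (n - 1) * q z / (z - z0)
          + deriv q z - q z ^ 2 / 2" by simp
    ultimately show ?thesis unfolding schwarzian_def ddu[OF z] by simp
  qed
  have ev: "\<forall>\<^sub>F z in at z0. z \<in> A"
    unfolding A_def using r(1) by (intro eventually_at_in_open) auto
  show ?thesis
  proof (rule that[of f1 q])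
    show "f1 analytic_on {z0}" using f1_hol r1(1) unfolding analytic_on_def by blast
    show "q analytic_on {z0}" using q_hol r(1) unfolding analytic_on_def by blast
  qed (use f1z0 ev du S in \<open>auto elim: eventually_mono\<close>)
qed

lemma schwarzian_limits:
  assumes f: "f analytic_on {z0}" "f z0 \<noteq> 0" and n: "n \<noteq> 0"
    and u: "\<forall>\<^sub>F z in at z0. u z = a + f z * (z - z0) powi n"
  shows "((\<lambda>z. (z - z0) ^ 2 * schwarzian u z) \<longlongrightarrow> (1 - of_int n ^ 2) / 2) (at z0)"
    and "((\<lambda>z. deriv u z * (z - z0) powi (1 - n)) \<longlongrightarrow> of_int n * f z0) (at z0)"
    and "n = 1 \<Longrightarrow> \<exists>l. (schwarzian u \<longlongrightarrow> l) (at z0)"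
proof -
  obtain f1 q where f1: "f1 analytic_on {z0}" "f1 z0 = of_int n * f z0" and q: "q analytic_on {z0}"
    and du: "\<forall>\<^sub>F z in at z0. deriv u z = f1 z * (z - z0) powi (n - 1)"
    and S: "\<forall>\<^sub>F z in at z0. schwarzian u z = (1 - of_int n ^ 2) / 2 / (z - z0) ^ 2
      - of_int (n - 1) * q z / (z - z0) + deriv q z - q z ^ 2 / 2"
    by (rule schwarzian_local_form[OF assms])
  have lim: "(f1 \<longlongrightarrow> f1 z0) (at z0)" "(q \<longlongrightarrow> q z0) (at z0)" "(deriv q \<longlongrightarrow> deriv q z0) (at z0)"
    using analytic_at_imp_isCont[OF f1(1)] analytic_at_imp_isCont[OF q]
      analytic_at_imp_isCont[OF analytic_deriv[OF q]] by (auto simp: isCont_def)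
  have ne: "\<forall>\<^sub>F z in at z0. z - z0 \<noteq> 0"
    using eventually_neq_at_within[of z0 z0 UNIV] by eventually_elim simp
  have "((\<lambda>z. (1 - of_int n ^ 2) / 2 - of_int (n - 1) * q z * (z - z0)
      + (deriv q z - q z ^ 2 / 2) * (z - z0) ^ 2) \<longlongrightarrow>
      (1 - of_int n ^ 2) / 2 - of_int (n - 1) * q z0 * (z0 - z0)
      + (deriv q z0 - q z0 ^ 2 / 2) * (z0 - z0) ^ 2) (at z0)"
    by (intro tendsto_intros lim) auto
  then have "((\<lambda>z. (1 - of_int n ^ 2) / 2 - of_int (n - 1) * q z * (z - z0)
      + (deriv q z - q z ^ 2 / 2) * (z - z0) ^ 2) \<longlongrightarrow> (1 - of_int n ^ 2) / 2) (at z0)"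
    by simp
  moreover have "\<forall>\<^sub>F z in at z0. (1 - of_int n ^ 2) / 2 - of_int (n - 1) * q z * (z - z0)
      + (deriv q z - q z ^ 2 / 2) * (z - z0) ^ 2 = (z - z0) ^ 2 * schwarzian u z"
    using S ne
  proof eventually_elim
    case (elim z)
    define t where "t = z - z0"
    have "t \<noteq> 0" using elim unfolding t_def by simp
    then show ?case
      unfolding elim(1) unfolding t_def[symmetric] by (simp add: field_simps power2_eq_square)
  qed
  ultimately show "((\<lambda>z. (z - z0) ^ 2 * schwarzian u z) \<longlongrightarrow> (1 - of_int n ^ 2) / 2) (at z0)"
    by (rule Lim_transform_eventually)
  have "\<forall>\<^sub>F z in at z0. f1 z = deriv u z * (z - z0) powi (1 - n)"
    using du ne
  proof eventually_elim
    case (elim z)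
    have "(z - z0) powi (n - 1) * (z - z0) powi (1 - n) = 1"
      using elim(2) by (simp flip: power_int_add)
    then show ?case unfolding elim(1) by (simp add: mult.assoc)
  qed
  then show "((\<lambda>z. deriv u z * (z - z0) powi (1 - n)) \<longlongrightarrow> of_int n * f z0) (at z0)"
    using Lim_transform_eventually[OF lim(1)] f1(2) by simp
  show "\<exists>l. (schwarzian u \<longlongrightarrow> l) (at z0)" if "n = 1"
  proof -
    have "\<forall>\<^sub>F z in at z0. deriv q z - q z ^ 2 / 2 = schwarzian u z"
      using S by eventually_elim (simp add: that)
    moreover have "((\<lambda>z. deriv q z - q z ^ 2 / 2) \<longlongrightarrow> deriv q z0 - q z0 ^ 2 / 2) (at z0)"
      by (intro tendsto_intros lim) auto
    ultimately show ?thesis using Lim_transform_eventually by blast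
  qed
qed

lemma local_form_tendsto:
  assumes f: "f analytic_on {z0}" and m: "1 \<le> m"
    and u: "\<forall>\<^sub>F z in at z0. u z = a + f z * (z - z0) powi int m"
  shows "(u \<longlongrightarrow> a) (at z0)"
proof -
  have "(f \<longlongrightarrow> f z0) (at z0)"
    using analytic_at_imp_isCont[OF f] by (simp add: isCont_def)
  then have "((\<lambda>z. a + f z * (z - z0) ^ m) \<longlongrightarrow> a + f z0 * (z0 - z0) ^ m) (at z0)"
    by (intro tendsto_intros)
  then have "((\<lambda>z. a + f z * (z - z0) ^ m) \<longlongrightarrow> a) (at z0)"
    using m by (simp add: power_0_left)
  moreover have "\<forall>\<^sub>F z in at z0. a + f z * (z - z0) ^ m = u z" using u by eventually_elim simp
  ultimately show ?thesis by (rule Lim_transform_eventually)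
qed

text \<open>
  Comparison of orders in \<open>S ^ 3 * (u - a) ^ e * h u = g u\<close>: at a point where \<open>u\<close> takes the value
  \<open>a\<close> with multiplicity \<open>m \<ge> 2\<close> the left side has order \<open>m * e - 6\<close>.
\<close>
lemma multiplicity_at_value:
  assumes f: "f analytic_on {z0}" "f z0 \<noteq> 0" and m: "1 \<le> m"
    and u: "\<forall>\<^sub>F z in at z0. u z = a + f z * (z - z0) powi int m"
    and eq: "\<forall>\<^sub>F z in at z0. schwarzian u z ^ 3 * (u z - a) ^ e * h (u z) = g (u z)"
    and h: "isCont h a" "h a \<noteq> 0" and g: "isCont g a" "0 < e \<Longrightarrow> g a \<noteq> 0"
  shows "e = 0 \<Longrightarrow> m = 1"
    and "0 < e \<Longrightarrow> m * e = 6 \<and> ((1 - of_nat m ^ 2) / 2) ^ 3 * f z0 ^ e * h a = g a"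
proof -
  define s :: complex where "s = (1 - of_nat m ^ 2) / 2"
  have s: "s = 0 \<longleftrightarrow> m = 1"
  proof -
    have "s = 0 \<longleftrightarrow> (of_nat m :: complex) ^ 2 = of_nat 1" unfolding s_def by auto
    also have "\<dots> \<longleftrightarrow> m ^ 2 = 1" by (metis of_nat_power of_nat_eq_iff)
    finally show ?thesis by simp
  qed
  have n: "int m \<noteq> 0" using m by simp
  have ftend: "(f \<longlongrightarrow> f z0) (at z0)"
    using analytic_at_imp_isCont[OF f(1)] by (simp add: isCont_def)
  have S: "((\<lambda>z. (z - z0) ^ 2 * schwarzian u z) \<longlongrightarrow> s) (at z0)"
    using schwarzian_limits(1)[OF f n u] unfolding s_def by simp
  have ua: "\<forall>\<^sub>F z in at z0. u z - a = f z * (z - z0) ^ m"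
    using u by eventually_elim simp
  have utend: "(u \<longlongrightarrow> a) (at z0)" by (rule local_form_tendsto[OF f(1) m u])
  have hu: "((\<lambda>z. h (u z)) \<longlongrightarrow> h a) (at z0)" and gu: "((\<lambda>z. g (u z)) \<longlongrightarrow> g a) (at z0)"
    using isCont_tendsto_compose[OF h(1) utend] isCont_tendsto_compose[OF g(1) utend] by auto
  have limL: "((\<lambda>z. ((z - z0) ^ 2 * schwarzian u z) ^ 3 * (z - z0) ^ k * f z ^ e * h (u z)) \<longlongrightarrow>
      s ^ 3 * (z0 - z0) ^ k * f z0 ^ e * h a) (at z0)" for k
    by (intro tendsto_intros S ftend hu)
  have limR: "((\<lambda>z. g (u z) * (z - z0) ^ k) \<longlongrightarrow> g a * (z0 - z0) ^ k) (at z0)" for k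
    by (intro tendsto_intros gu)
  have comp: "s ^ 3 * 0 ^ (m * e - 6) * f z0 ^ e * h a = g a * 0 ^ (6 - m * e)"
  proof -
    have "\<forall>\<^sub>F z in at z0. ((z - z0) ^ 2 * schwarzian u z) ^ 3 * (z - z0) ^ (m * e - 6) * f z ^ e * h (u z)
        = g (u z) * (z - z0) ^ (6 - m * e)"
      using eq ua
    proof eventually_elim
      case (elim z)
      have pw: "6 + (m * e - 6) = m * e + (6 - m * e)" by simp
      have "((z - z0) ^ 2 * schwarzian u z) ^ 3 * (z - z0) ^ (m * e - 6) * f z ^ e * h (u z)
          = schwarzian u z ^ 3 * ((z - z0) ^ (6 + (m * e - 6)) * f z ^ e) * h (u z)"
        by (simp add: power_mult_distrib power_add flip: power_mult)
      also have "\<dots> = schwarzian u z ^ 3 * (u z - a) ^ e * h (u z) * (z - z0) ^ (6 - m * e)"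
        unfolding pw elim(2) by (simp add: power_mult_distrib power_add flip: power_mult)
      finally show ?case unfolding elim(1) .
    qed
    from tendsto_unique[OF trivial_limit_at Lim_transform_eventually[OF limL this] limR]
    show ?thesis by simp
  qed
  show "m = 1" if "e = 0"
    using comp that h(2) s by simp
  show "m * e = 6 \<and> ((1 - of_nat m ^ 2) / 2) ^ 3 * f z0 ^ e * h a = g a" if e: "0 < e"
  proof -
    have "m \<noteq> 1"
    proof
      assume "m = 1"
      then obtain l where l: "(schwarzian u \<longlongrightarrow> l) (at z0)"
        using schwarzian_limits(3)[OF f n u] by auto
      have "((\<lambda>z. schwarzian u z ^ 3 * (u z - a) ^ e * h (u z)) \<longlongrightarrow> l ^ 3 * (a - a) ^ e * h a) (at z0)"
        by (intro tendsto_intros l utend hu)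
      from tendsto_unique[OF trivial_limit_at Lim_transform_eventually[OF this eq] gu]
      show False using g(2) e by (simp add: power_0_left)
    qed
    then have "s \<noteq> 0" using s by simp
    then have "m * e = 6"
      using comp f(2) h(2) g(2)[OF e] by (cases "m * e < 6"; cases "m * e > 6") (auto simp: power_0_left)
    then show ?thesis using comp unfolding s_def by simp
  qed
qed

text \<open>
  Written in terms of \<open>1 / u\<close>, the equation shows that \<open>S\<close> stays bounded at a pole of \<open>u\<close>; but \<open>S\<close> has a
  double pole there unless the pole of \<open>u\<close> is simple.
\<close>
lemma pole_simple:
  assumes f: "f analytic_on {z0}" "f z0 \<noteq> 0" and m: "1 \<le> m" and pole: "is_pole u z0"
    and u: "\<forall>\<^sub>F z in at z0. u z = 0 + f z * (z - z0) powi (- int m)"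
    and eq: "\<forall>\<^sub>F z in at z0. schwarzian u z ^ 3 * h (1 / u z) = g (1 / u z)"
    and h: "isCont h 0" "h 0 \<noteq> 0" and g: "isCont g 0"
  shows "m = 1"
proof -
  define s :: complex where "s = (1 - of_nat m ^ 2) / 2"
  have n: "- int m \<noteq> 0" using m by simp
  have S: "((\<lambda>z. (z - z0) ^ 2 * schwarzian u z) \<longlongrightarrow> s) (at z0)"
    using schwarzian_limits(1)[OF f n u] unfolding s_def by simp
  have v: "((\<lambda>z. 1 / u z) \<longlongrightarrow> 0) (at z0)"
    using pole unfolding is_pole_def by (intro tendsto_divide_0[OF tendsto_const])
  have "((\<lambda>z. ((z - z0) ^ 2 * schwarzian u z) ^ 3 * h (1 / u z)) \<longlongrightarrow> s ^ 3 * h 0) (at z0)"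
    by (intro tendsto_intros S isCont_tendsto_compose[OF h(1) v])
  moreover have "\<forall>\<^sub>F z in at z0. ((z - z0) ^ 2 * schwarzian u z) ^ 3 * h (1 / u z)
      = g (1 / u z) * (z - z0) ^ 6"
    using eq
  proof eventually_elim
    case (elim z)
    show ?case by (simp add: power_mult_distrib flip: elim power_mult)
  qed
  ultimately have "((\<lambda>z. g (1 / u z) * (z - z0) ^ 6) \<longlongrightarrow> s ^ 3 * h 0) (at z0)"
    by (rule Lim_transform_eventually)
  moreover have "((\<lambda>z. g (1 / u z) * (z - z0) ^ 6) \<longlongrightarrow> g 0 * (z0 - z0) ^ 6) (at z0)"
    by (intro tendsto_intros isCont_tendsto_compose[OF g v])
  ultimately have "s ^ 3 * h 0 = g 0 * (z0 - z0) ^ 6"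
    using tendsto_unique trivial_limit_at by blast
  then have "s = 0" using h(2) by simp
  then have "(of_nat m :: complex) ^ 2 = of_nat 1" unfolding s_def by simp
  then have "m ^ 2 = 1" by (metis of_nat_power of_nat_eq_iff)
  then show ?thesis by simp
qed

section \<open>A first integral without zeros and poles\<close>

text \<open>
  A value taken with multiplicity \<open>m\<close> throughout makes \<open>u' ^ 6\<close> vanish to the order
  \<open>6 * (m - 1) = m * (6 - 6 / m)\<close>, whence the exponent \<open>6 - 6 / m\<close> for the values 4, -3, 0 with
  multiplicities 2, 3, 6.
\<close>
definition branch_poly :: "complex \<Rightarrow> complex" where
  "branch_poly x = (x - 4) ^ 3 * (x + 3) ^ 4 * x ^ 5"

definition schwarzian_den :: "complex \<Rightarrow> complex" where
  "schwarzian_den x = (x - 4) ^ 3 * (x + 3) ^ 2 * x"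

text \<open>
  Uniform bookkeeping for the four kinds of values \<open>a\<close>: \<open>e\<close> and \<open>d\<close> are the orders of vanishing at
  \<open>a\<close> of the denominator of the Schwarzian equation and of \<open>branch_poly\<close>. The constants at 0 serve to
  compute the value of the first integral at the zeros of \<open>u\<close>.
\<close>
lemma branch_factors:
  obtains e d h H where "isCont h a" "h a \<noteq> 0" "isCont H a" "H a \<noteq> (0::complex)"
    "\<And>x. schwarzian_den x = (x - a) ^ e * h x" "\<And>x. branch_poly x = (x - a) ^ d * H x"
    "if a \<in> {4, -3, 0} then 0 < e \<and> d + e = 6 else e = 0 \<and> d = 0"
    "a = 0 \<Longrightarrow> e = 1 \<and> h 0 = -576 \<and> H 0 = -5184"
proof -
  consider "a = 4" | "a = -3" | "a = 0" | "a \<notin> {4, -3, 0}" by blast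
  then show ?thesis
  proof cases
    case 1
    show ?thesis
      by (rule that[of "\<lambda>x. (x + 3) ^ 2 * x" "\<lambda>x. (x + 3) ^ 4 * x ^ 5" 3 3])
         (simp_all add: 1 schwarzian_den_def branch_poly_def)
  next
    case 2
    show ?thesis
      by (rule that[of "\<lambda>x. (x - 4) ^ 3 * x" "\<lambda>x. (x - 4) ^ 3 * x ^ 5" 2 4])
         (simp_all add: 2 schwarzian_den_def branch_poly_def)
  next
    case 3
    show ?thesis
      by (rule that[of "\<lambda>x. (x - 4) ^ 3 * (x + 3) ^ 2" "\<lambda>x. (x - 4) ^ 3 * (x + 3) ^ 4" 1 5])
         (simp_all add: 3 schwarzian_den_def branch_poly_def)
  next
    case 4
    then have "a - 4 \<noteq> 0" "a + 3 \<noteq> 0" "a \<noteq> 0" by (auto simp: add_eq_0_iff2)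
    with 4 show ?thesis
      by (intro that[of schwarzian_den branch_poly 0 0])
         (simp_all add: schwarzian_den_def[abs_def] branch_poly_def[abs_def])
  qed
qed

text \<open>
  The condition \<open>m * d = 6 * (m - 1)\<close> means that \<open>u' ^ 6\<close> and \<open>branch_poly u\<close> vanish to the same order.
\<close>
lemma first_integral_limit_regular:
  assumes f: "f analytic_on {z0}" "f z0 \<noteq> 0" and m: "1 \<le> m"
    and u: "\<forall>\<^sub>F z in at z0. u z = a + f z * (z - z0) powi int m"
    and H: "isCont H a" "H a \<noteq> 0" "\<And>x. branch_poly x = (x - a) ^ d * H x"
    and md: "m * d = 6 * (m - 1)"
  shows "((\<lambda>z. deriv u z ^ 6 / branch_poly (u z)) \<longlongrightarrow> (of_nat m * f z0) ^ 6 / (f z0 ^ d * H a)) (at z0)"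
proof -
  have ftend: "(f \<longlongrightarrow> f z0) (at z0)"
    using analytic_at_imp_isCont[OF f(1)] by (simp add: isCont_def)
  have n: "int m \<noteq> 0" using m by simp
  have du: "((\<lambda>z. deriv u z * (z - z0) powi (1 - int m)) \<longlongrightarrow> of_nat m * f z0) (at z0)"
    using schwarzian_limits(2)[OF f n u] by simp
  have utend: "(u \<longlongrightarrow> a) (at z0)" by (rule local_form_tendsto[OF f(1) m u])
  have "((\<lambda>z. (deriv u z * (z - z0) powi (1 - int m)) ^ 6 / (f z ^ d * H (u z))) \<longlongrightarrow>
      (of_nat m * f z0) ^ 6 / (f z0 ^ d * H a)) (at z0)"
    by (intro tendsto_intros du ftend isCont_tendsto_compose[OF H(1) utend]) (use f H in auto)
  moreover have "\<forall>\<^sub>F z in at z0. (deriv u z * (z - z0) powi (1 - int m)) ^ 6 / (f z ^ d * H (u z))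
      = deriv u z ^ 6 / branch_poly (u z)"
    using u eventually_neq_at_within[of z0 z0 UNIV]
  proof eventually_elim
    case (elim z)
    define t where "t = z - z0"
    have t: "t \<noteq> 0" using elim unfolding t_def by simp
    obtain k where k: "m = Suc k" using m by (cases m) auto
    have "t powi (1 - int m) = t powi (- int k)" unfolding k by simp
    then have "(t powi (1 - int m)) ^ 6 = inverse ((t ^ k) ^ 6)"
      by (simp only: power_int_minus power_int_of_nat power_inverse)
    also have "m * d = k * 6" using md unfolding k by simp
    then have "(t ^ k) ^ 6 = t ^ (m * d)" by (simp only: power_mult)
    finally have T: "(t powi (1 - int m)) ^ 6 = inverse (t ^ (m * d))" .
    moreover have "branch_poly (u z) = t ^ (m * d) * (f z ^ d * H (u z))"
      unfolding H(3) using elim(1) by (simp add: t_def power_mult_distrib power_mult)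
    ultimately show ?case
      unfolding t_def[symmetric] power_mult_distrib T by (simp add: divide_inverse mult_ac)
  qed
  ultimately show ?thesis by (rule Lim_transform_eventually)
qed

text \<open>
  The degree 12 of \<open>branch_poly\<close> matches the pole of order 12 of \<open>u' ^ 6\<close> at a simple pole of \<open>u\<close>.
\<close>
lemma first_integral_limit_pole:
  assumes f: "f analytic_on {z0}" "f z0 \<noteq> 0"
    and u: "\<forall>\<^sub>F z in at z0. u z = 0 + f z * (z - z0) powi (- 1)"
  shows "((\<lambda>z. deriv u z ^ 6 / branch_poly (u z)) \<longlongrightarrow> f z0 ^ 6 / f z0 ^ 12) (at z0)"
proof -
  have ftend: "(f \<longlongrightarrow> f z0) (at z0)"
    using analytic_at_imp_isCont[OF f(1)] by (simp add: isCont_def)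
  have du: "((\<lambda>z. deriv u z * (z - z0) ^ 2) \<longlongrightarrow> - f z0) (at z0)"
    using schwarzian_limits(2)[OF f _ u] by simp
  have "((\<lambda>z. (deriv u z * (z - z0) ^ 2) ^ 6 /
        ((f z - 4 * (z - z0)) ^ 3 * (f z + 3 * (z - z0)) ^ 4 * f z ^ 5)) \<longlongrightarrow>
      (- f z0) ^ 6 / ((f z0 - 4 * (z0 - z0)) ^ 3 * (f z0 + 3 * (z0 - z0)) ^ 4 * f z0 ^ 5)) (at z0)"
    by (intro tendsto_intros du ftend) (use f in auto)
  also have "(- f z0) ^ 6 / ((f z0 - 4 * (z0 - z0)) ^ 3 * (f z0 + 3 * (z0 - z0)) ^ 4 * f z0 ^ 5)
      = f z0 ^ 6 / f z0 ^ 12"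
    by (simp flip: power_add)
  finally have "((\<lambda>z. (deriv u z * (z - z0) ^ 2) ^ 6 /
        ((f z - 4 * (z - z0)) ^ 3 * (f z + 3 * (z - z0)) ^ 4 * f z ^ 5)) \<longlongrightarrow> f z0 ^ 6 / f z0 ^ 12) (at z0)" .
  moreover have "\<forall>\<^sub>F z in at z0. (deriv u z * (z - z0) ^ 2) ^ 6 /
        ((f z - 4 * (z - z0)) ^ 3 * (f z + 3 * (z - z0)) ^ 4 * f z ^ 5)
      = deriv u z ^ 6 / branch_poly (u z)"
    using u eventually_neq_at_within[of z0 z0 UNIV]
  proof eventually_elim
    case (elim z)
    define t where "t = z - z0"
    have t: "t \<noteq> 0" using elim unfolding t_def by simp
    have ut: "f z = u z * t" using elim t unfolding t_def by simp
    have "(f z - 4 * t) ^ 3 * (f z + 3 * t) ^ 4 * f z ^ 5 = branch_poly (u z) * t ^ 12"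
    proof -
      have e: "f z - 4 * t = (u z - 4) * t" "f z + 3 * t = (u z + 3) * t"
        unfolding ut by (simp_all add: algebra_simps)
      show ?thesis
        unfolding e branch_poly_def unfolding ut by algebra
    qed
    moreover have "(deriv u z * t ^ 2) ^ 6 = deriv u z ^ 6 * t ^ 12"
      by (simp add: power_mult_distrib flip: power_mult)
    ultimately show ?case unfolding t_def[symmetric] using t by simp
  qed
  ultimately show ?thesis by (rule Lim_transform_eventually)
qed

lemma schwarzian_solution_clear_den:
  assumes sol: "schwarzian_solution c \<sigma>1 \<sigma>2 u" and nonconst: "\<And>a. \<forall>\<^sub>F z in at z0. u z \<noteq> a"
  shows "\<forall>\<^sub>F z in at z0. schwarzian u z ^ 3 * schwarzian_den (u z) = c * ((u z - \<sigma>1) ^ 3 * (u z - \<sigma>2) ^ 3)"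
proof -
  have "\<forall>\<^sub>F z in at z0. schwarzian u z ^ 3 =
        c * ((u z - \<sigma>1) ^ 3 * (u z - \<sigma>2) ^ 3) /
            ((u z - 4) ^ 3 * (u z - (-3)) ^ 2 * (u z - 0))"
    using sol unfolding schwarzian_solution_def by (auto simp: eventually_cosparse_open_eq)
  then show ?thesis
    using nonconst[of 4] nonconst[of "-3"] nonconst[of 0]
  proof eventually_elim
    case (elim z)
    have "schwarzian_den (u z) = (u z - 4) ^ 3 * (u z - (-3)) ^ 2 * (u z - 0)"
      unfolding schwarzian_den_def by simp
    moreover have "u z - 4 \<noteq> 0" "u z - (-3) \<noteq> 0" "u z - 0 \<noteq> 0" using elim(2-4) by (auto simp: add_eq_0_iff2)
    ultimately show ?case unfolding elim(1) by simp
  qed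
qed

lemma nonconstant_avoids:
  assumes "u meromorphic_on UNIV" "\<not> (\<exists>k. \<forall>\<^sub>\<approx>z. u z = k)"
  shows "\<forall>\<^sub>F z in at z0. u z \<noteq> (a::complex)"
proof -
  have "\<forall>\<^sub>\<approx>z. u z \<noteq> a"
    using meromorphic_imp_constant_or_avoid[OF assms(1) open_UNIV connected_UNIV, of a] assms(2) by blast
  then show ?thesis by (simp add: eventually_cosparse_open_eq)
qed

text \<open>
  The local limits show that \<open>u' ^ 6 / branch_poly u\<close> extends to an entire function \<open>F\<close> without zeros.
  At a zero \<open>z0\<close> of \<open>u\<close> one has \<open>u = a * (z - z0) ^ 6 + \<dots>\<close>, and the equation determines \<open>a\<close> by comparing
  the leading coefficients; therefore \<open>F z0\<close> does not depend on the zero.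
\<close>
theorem first_integral:
  assumes c: "c \<noteq> 0" and \<sigma>: "\<sigma>1 \<notin> {4, -3, 0}" "\<sigma>2 \<notin> {4, -3, 0}"
    and mero: "u meromorphic_on UNIV" and nonconst: "\<not> (\<exists>k. \<forall>\<^sub>\<approx>z. u z = k)"
    and sol: "schwarzian_solution c \<sigma>1 \<sigma>2 u"
  obtains F k where "F holomorphic_on UNIV" "\<And>z. F z \<noteq> 0"
    "\<forall>\<^sub>\<approx>z. deriv u z ^ 6 = F z * branch_poly (u z)"
    "\<And>z0. (u \<longlongrightarrow> 0) (at z0) \<Longrightarrow> F z0 = k"
proof -
  note avoid = nonconstant_avoids[OF mero nonconst]
  define Q where "Q z = deriv u z ^ 6 / branch_poly (u z)" for z
  define F where "F = remove_sings Q"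
  \<comment> \<open>The leading coefficient of \<open>u\<close> at a zero, which is of order 6, and the resulting value of \<open>F\<close>.\<close>
  define a0 where "a0 = c * ((- \<sigma>1) ^ 3 * (- \<sigma>2) ^ 3) / (((1 - 6 ^ 2) / 2) ^ 3 * (-576))"
  define k where "k = (6 * a0) ^ 6 / (a0 ^ 5 * (- 5184))"
  let ?g = "\<lambda>x. c * ((x - \<sigma>1) ^ 3 * (x - \<sigma>2) ^ 3)"
  have lim: "\<exists>l. l \<noteq> 0 \<and> (Q \<longlongrightarrow> l) (at z0) \<and> ((u \<longlongrightarrow> 0) (at z0) \<longrightarrow> l = k)" for z0
  proof -
    have mero0: "u meromorphic_on {z0}" using mero by (rule meromorphic_on_subset) simp
    note eq = schwarzian_solution_clear_den[OF sol avoid, of z0]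
    show ?thesis
    proof (cases rule: meromorphic_local_form[OF mero0 avoid])
      case (1 a f m)
      obtain e d h H where h: "isCont h a" "h a \<noteq> 0" and H: "isCont H a" "H a \<noteq> 0"
        and fac: "\<And>x. schwarzian_den x = (x - a) ^ e * h x" "\<And>x. branch_poly x = (x - a) ^ d * H x"
        and ed: "if a \<in> {4, -3, 0} then 0 < e \<and> d + e = 6 else e = 0 \<and> d = 0"
        and zero: "a = 0 \<Longrightarrow> e = 1 \<and> h 0 = -576 \<and> H 0 = -5184"
        by (rule branch_factors) blast
      have g: "isCont ?g a" "0 < e \<Longrightarrow> ?g a \<noteq> 0"
        using c \<sigma> ed by (auto split: if_splits)
      have eq': "\<forall>\<^sub>F z in at z0. schwarzian u z ^ 3 * (u z - a) ^ e * h (u z) = ?g (u z)"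
        using eq unfolding fac(1) by (simp add: mult.assoc)
      note mult = multiplicity_at_value[OF 1(2,3,1,4) eq' h g]
      have md: "m * d = 6 * (m - 1)"
      proof (cases "a \<in> {4, -3, 0}")
        case True
        then have me: "m * e = 6" and de: "d + e = 6" using ed mult(2) by auto
        have "m * d + m * e = m * 6" using de by (metis distrib_left)
        then show ?thesis using me by simp
      next
        case False
        then show ?thesis using ed mult(1) by auto
      qed
      have Q: "(Q \<longlongrightarrow> (of_nat m * f z0) ^ 6 / (f z0 ^ d * H a)) (at z0)"
        unfolding Q_def using first_integral_limit_regular[OF 1(2,3,1,4) H fac(2) md] .
      have "(of_nat m * f z0) ^ 6 / (f z0 ^ d * H a) = k" if u0: "(u \<longlongrightarrow> 0) (at z0)"
      proof -
        have a: "a = 0"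
          using tendsto_unique[OF trivial_limit_at u0 local_form_tendsto[OF 1(2,1,4)]] by simp
        with zero have e: "e = 1" and h0: "h 0 = -576" "H 0 = -5184" by auto
        with mult(2) ed a have m6: "m = 6" and d5: "d = 5" by auto
        have "((1 - 6 ^ 2) / 2) ^ 3 * f z0 * (-576) = c * ((- \<sigma>1) ^ 3 * (- \<sigma>2) ^ 3)"
          using mult(2) e h0 m6 a by simp
        then have "f z0 = a0" unfolding a0_def by (simp add: field_simps)
        then show ?thesis unfolding k_def m6 d5 a h0 by simp
      qed
      moreover have "(of_nat m * f z0) ^ 6 / (f z0 ^ d * H a) \<noteq> 0" using 1(1,3) H(2) by simp
      ultimately show ?thesis using Q by blast
    next
      case (2 f m)
      let ?h = "\<lambda>v. (1 - 4 * v) ^ 3 * (1 + 3 * v) ^ 2 :: complex"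
      let ?gg = "\<lambda>v. c * ((1 - \<sigma>1 * v) ^ 3 * (1 - \<sigma>2 * v) ^ 3)"
      have eqv: "\<forall>\<^sub>F z in at z0. schwarzian u z ^ 3 * ?h (1 / u z) = ?gg (1 / u z)"
        using eq avoid[of 0 z0]
      proof eventually_elim
        case (elim z)
        define v where "v = 1 / u z"
        have v: "u z = 1 / v" "v \<noteq> 0" using elim(2) unfolding v_def by auto
        have den: "schwarzian_den (u z) * v ^ 6 = ?h v"
        proof -
          have "schwarzian_den (u z) * v ^ 6 = ((u z - 4) * v) ^ 3 * ((u z + 3) * v) ^ 2 * (u z * v)"
            unfolding schwarzian_den_def by algebra
          moreover have "(u z - 4) * v = 1 - 4 * v" "(u z + 3) * v = 1 + 3 * v" "u z * v = 1"
            using v by (simp_all add: algebra_simps)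
          ultimately show ?thesis by simp
        qed
        have num: "?g (u z) * v ^ 6 = ?gg v"
        proof -
          have "?g (u z) * v ^ 6 = c * (((u z - \<sigma>1) * v) ^ 3 * ((u z - \<sigma>2) * v) ^ 3)"
            by algebra
          moreover have "(u z - \<sigma>1) * v = 1 - \<sigma>1 * v" "(u z - \<sigma>2) * v = 1 - \<sigma>2 * v"
            using v by (simp_all add: algebra_simps)
          ultimately show ?thesis by simp
        qed
        have "schwarzian u z ^ 3 * ?h v = schwarzian u z ^ 3 * schwarzian_den (u z) * v ^ 6"
          by (simp only: den mult.assoc)
        then show ?case unfolding elim(1) num unfolding v_def .
      qed
      have m: "m = 1"
        by (rule pole_simple[OF 2(2,3,1,4,5) eqv]) auto
      have "(Q \<longlongrightarrow> f z0 ^ 6 / f z0 ^ 12) (at z0)"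
        unfolding Q_def using first_integral_limit_pole[OF 2(2,3)] 2(5) m by simp
      moreover have "\<not> (u \<longlongrightarrow> 0) (at z0)"
        using 2(4) unfolding is_pole_def
        by (meson not_tendsto_and_filterlim_at_infinity trivial_limit_at)
      ultimately show ?thesis using 2(3) by (intro exI[of _ "f z0 ^ 6 / f z0 ^ 12"]) auto
    qed
  qed
  have Q_mero: "Q meromorphic_on UNIV"
    unfolding Q_def branch_poly_def by (intro meromorphic_intros mero)
  have F_val: "F z0 = l" if "(Q \<longlongrightarrow> l) (at z0)" for z0 l
    unfolding F_def using that by (rule remove_sings_eqI)
  have "F analytic_on {z0}" for z0
  proof -
    obtain l where "(Q \<longlongrightarrow> l) (at z0)" using lim by blast
    moreover have "isolated_singularity_at Q z0"
      using Q_mero meromorphic_on_isolated_singularity meromorphic_on_subset by blast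
    ultimately show ?thesis
      unfolding F_def by (simp add: remove_sings_analytic_at)
  qed
  then have "F holomorphic_on UNIV"
    using analytic_imp_holomorphic analytic_on_analytic_at by blast
  moreover have "F z \<noteq> 0" for z using lim[of z] F_val by blast
  moreover have "\<forall>\<^sub>\<approx>z. deriv u z ^ 6 = F z * branch_poly (u z)"
  proof -
    have "\<forall>\<^sub>\<approx>z. u z \<noteq> 4" "\<forall>\<^sub>\<approx>z. u z \<noteq> -3" "\<forall>\<^sub>\<approx>z. u z \<noteq> 0"
      using avoid by (auto simp: eventually_cosparse_open_eq)
    with eventually_remove_sings_eq[OF Q_mero] show ?thesis
    proof eventually_elim
      case (elim z)
      then have "branch_poly (u z) \<noteq> 0" unfolding branch_poly_def by (auto simp: add_eq_0_iff2)
      with elim(1) show ?case unfolding F_def Q_def by simp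
    qed
  qed
  moreover have "F z0 = k" if "(u \<longlongrightarrow> 0) (at z0)" for z0
    using lim[of z0] F_val that by blast
  ultimately show ?thesis using that by blast
qed

section \<open>Entire functions that are slow over a lattice\<close>

text \<open>
  A rescaling argument in the manner of Brody and Zalcman. If \<open>h'\<close> were unbounded, there would be discs
  of radius \<open>r / 2\<close> with centre \<open>z1\<close> on which \<open>norm h'\<close> is at most \<open>2 * M\<close> for \<open>M = norm (h' z1)\<close>, with \<open>M * r\<close> as large as
  one likes. On a much smaller disc \<open>h\<close> is nearly affine, so \<open>norm h'\<close> is at least \<open>M / 2\<close> there, and yet its
  image is so large that it contains a lattice point, where \<open>norm h'\<close> is at most \<open>\<kappa>\<close>.
\<close>
lemma (in period_lattice) lattice_preimage_derivative_bounded: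
  assumes h: "h holomorphic_on UNIV" and bnd: "\<And>z. h z \<in> L \<Longrightarrow> norm (deriv h z) \<le> \<kappa>"
  shows "bounded (range (deriv h))"
proof (rule ccontr)
  assume unb: "\<not> bounded (range (deriv h))"
  have dh: "deriv h holomorphic_on UNIV" using h by (intro holomorphic_deriv) auto
  then have cont: "continuous_on A (deriv h)" for A
    using holomorphic_on_imp_continuous_on continuous_on_subset by blast
  obtain B where B: "B > 0" "\<And>z. \<exists>\<omega>\<in>L. norm (z - \<omega>) \<le> B" using lattice_covering by metis
  define C where "C = 96 * B + 2 * \<bar>\<kappa>\<bar>"
  have C: "C > 0" "96 * B \<le> C" "2 * \<kappa> \<le> C" unfolding C_def using B(1) by auto
  obtain a where a: "norm (deriv h a) > C" using unb unfolding bounded_iff by (auto simp: not_le)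
  \<comment> \<open>Maximising the derivative weighted by the distance to the boundary yields a centre around which
     the derivative at most doubles on half of the remaining radius.\<close>
  define \<mu> where "\<mu> z = norm (deriv h z) * (1 - norm (z - a))" for z
  have "continuous_on (cball a 1) \<mu>" unfolding \<mu>_def by (intro continuous_intros cont)
  then obtain z1 where z1: "z1 \<in> cball a 1" "\<And>z. z \<in> cball a 1 \<Longrightarrow> \<mu> z \<le> \<mu> z1"
    using continuous_attains_sup[of "cball a 1" \<mu>] by auto
  define r M where "r = 1 - norm (z1 - a)" and "M = norm (deriv h z1)"
  have Mr: "M * r > C"
    using z1(2)[of a] a unfolding \<mu>_def r_def M_def by simp
  have "M \<ge> 0" unfolding M_def by simp
  moreover have "0 < M * r" using Mr C(1) by linarith
  ultimately have M: "M > 0" and r: "r > 0" unfolding zero_less_mult_iff by auto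
  have r1: "r \<le> 1" unfolding r_def by simp
  have le2M: "norm (deriv h z) \<le> 2 * M" if "z \<in> cball z1 (r / 2)" for z
  proof -
    have "norm (z - a) \<le> norm (z - z1) + norm (z1 - a)"
      using norm_triangle_ineq[of "z - z1" "z1 - a"] by simp
    then have *: "r / 2 \<le> 1 - norm (z - a)"
      using that unfolding r_def by (simp add: dist_norm norm_minus_commute)
    then have "z \<in> cball a 1" using r by (simp add: dist_norm norm_minus_commute)
    then have "norm (deriv h z) * (1 - norm (z - a)) \<le> M * r"
      using z1(2) unfolding \<mu>_def M_def r_def by blast
    moreover have "norm (deriv h z) * (r / 2) \<le> norm (deriv h z) * (1 - norm (z - a))"
      using * by (intro mult_left_mono) auto
    ultimately have "norm (deriv h z) * (r / 2) \<le> 2 * M * (r / 2)" by simp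
    then show ?thesis using r by (simp add: mult_le_cancel_right)
  qed
  \<comment> \<open>The factor 6 exceeds the inverse of the constant \<open>3 - 2 * sqrt 2\<close> in the covering theorem of Bloch
     used below, so the image of the disc of radius \<open>t\<close> contains a disc of radius more than \<open>B\<close>.\<close>
  define t where "t = 6 * B / M"
  have t: "t > 0" "t * M = 6 * B" unfolding t_def using B(1) M by auto
  have "t * M * 16 < r * M" using t(2) C(2) Mr by (simp add: mult.commute)
  then have tr: "16 * t < r" using M by simp
  have "ball (h z1) ((3 - 2 * sqrt 2) * t * norm (deriv h z1)) \<subseteq> h ` ball z1 t"
  proof (rule Bloch_lemma[OF _ t(1)])
    show "h holomorphic_on cball z1 t" using h by (rule holomorphic_on_subset) auto
    show "norm (deriv h z) \<le> 2 * norm (deriv h z1)" if "z \<in> ball z1 t" for z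
      using le2M[of z] that tr t(1) unfolding M_def[symmetric] by auto
  qed
  moreover obtain \<omega> where \<omega>: "\<omega> \<in> L" "norm (h z1 - \<omega>) \<le> B" using B(2) by blast
  have "B < (3 - 2 * sqrt 2) * (t * M)"
  proof -
    have "sqrt 2 < 17 / 12" by (rule real_less_lsqrt) (auto simp: power2_eq_square)
    then have "1 / 6 < 3 - 2 * sqrt (2::real)" by simp
    from mult_strict_right_mono[OF this, of "6 * B"] show ?thesis unfolding t(2) using B(1) by simp
  qed
  then have "\<omega> \<in> ball (h z1) ((3 - 2 * sqrt 2) * t * norm (deriv h z1))"
    using \<omega>(2) unfolding M_def[symmetric] by (simp add: dist_norm mult.assoc)
  ultimately obtain z2 where z2: "z2 \<in> ball z1 t" "h z2 = \<omega>" by blast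
  have d2: "norm (deriv (deriv h) z) \<le> 8 * M / r" if "z \<in> ball z1 (r / 4)" for z
  proof -
    have "norm ((deriv ^^ 1) (deriv h) z) \<le> fact 1 * (2 * M) / (r / 4) ^ 1"
    proof (rule Cauchy_inequality)
      show "deriv h holomorphic_on ball z (r / 4)" using dh by (rule holomorphic_on_subset) auto
      show "norm (deriv h x) \<le> 2 * M" if x: "norm (z - x) = r / 4" for x
      proof (rule le2M)
        have "norm (z1 - x) \<le> norm (z1 - z) + norm (z - x)"
          using norm_triangle_ineq[of "z1 - z" "z - x"] by simp
        then show "x \<in> cball z1 (r / 2)"
          using x \<open>z \<in> ball z1 (r / 4)\<close> by (simp add: dist_norm)
      qed
    qed (use r cont in auto)
    then show ?thesis by simp
  qed
  have "norm (deriv h z2 - deriv h z1) \<le> 8 * M / r * norm (z2 - z1)"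
  proof (rule field_differentiable_bound[where S = "ball z1 (r / 4)"])
    show "(deriv h has_field_derivative deriv (deriv h) z) (at z within ball z1 (r / 4))" for z
      by (rule has_field_derivative_at_within[OF holomorphic_derivI[OF dh open_UNIV]]) simp
  qed (use d2 z2 tr t(1) r in auto)
  also have "\<dots> \<le> 8 * M / r * t"
    using z2(1) M r by (intro mult_left_mono) (auto simp: dist_norm norm_minus_commute)
  also have "\<dots> \<le> M / 2"
  proof -
    have "8 * t \<le> r / 2" using tr by simp
    then have "M / r * (8 * t) \<le> M / r * (r / 2)" using M r by (intro mult_left_mono) auto
    then show ?thesis using r by simp
  qed
  finally have "M / 2 \<le> norm (deriv h z2)"
    using norm_triangle_ineq3[of "deriv h z2" "deriv h z1"] unfolding M_def by linarith
  moreover have "norm (deriv h z2) \<le> \<kappa>" using bnd z2(2) \<omega>(1) by blast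
  moreover have "M * r \<le> M" using r1 M by simp
  ultimately show False using Mr C(3) by linarith
qed

section \<open>The covering with branching orders 2, 3 and 6\<close>

locale equianharmonic_lattice = period_lattice +
  fixes g3 :: complex
  assumes g2_zero: "lattice_g2 L = 0" and g3: "lattice_g3 L = g3" and g3_nonzero: "g3 \<noteq> 0"
begin

text \<open>
  As \<open>wp\<close> runs through its values, \<open>\<phi>\<close> takes 0 with multiplicity 6 (at the poles of \<open>wp\<close>), -3 with
  multiplicity 3 (at its zeros), 4 with multiplicity 2 (where \<open>wp' = 0\<close>) and all other values, infinity
  included, simply. Since \<open>1/2 + 1/3 + 1/6 = 1\<close>, it is the universal covering of the sphere with these
  branching orders.
\<close>
definition \<phi> :: "complex \<Rightarrow> complex" where
  "\<phi> z = 3 * g3 / (7 * wp z ^ 3 - g3)"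

definition K :: complex where
  "K = - 27 * g3 / 7"

lemma K_nonzero: "K \<noteq> 0"
  unfolding K_def using g3_nonzero by simp

lemma \<phi>_meromorphic: "\<phi> meromorphic_on UNIV"
  unfolding \<phi>_def by (intro meromorphic_intros wp_meromorphic)

lemma \<phi>_has_field_derivative:
  assumes "z \<notin> L" "7 * wp z ^ 3 \<noteq> g3"
  shows "(\<phi> has_field_derivative - 7 * (wp z ^ 2 * wp' z) * \<phi> z ^ 2 / g3) (at z)"
proof -
  have nz: "7 * wp z ^ 3 - g3 \<noteq> 0" using assms(2) by simp
  have "((\<lambda>z. 7 * wp z ^ 3 - g3) has_field_derivative 21 * wp z ^ 2 * wp' z) (at z)"
    by (auto intro!: derivative_eq_intros wp_has_field_derivative[OF assms(1)])
  from DERIV_cmult[OF DERIV_inverse'[OF this nz], of "3 * g3"]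
  have "(\<phi> has_field_derivative 3 * g3 * - (inverse (7 * wp z ^ 3 - g3) * (21 * wp z ^ 2 * wp' z)
      * inverse (7 * wp z ^ 3 - g3))) (at z)"
    unfolding \<phi>_def[abs_def] by (simp add: divide_inverse)
  moreover have "3 * g3 * - (inverse d * (21 * wp z ^ 2 * wp' z) * inverse d)
      = - 7 * (wp z ^ 2 * wp' z) * (3 * g3 / d) ^ 2 / g3" for d
    using g3_nonzero by (simp add: divide_inverse power2_eq_square)
  ultimately show ?thesis unfolding \<phi>_def by simp
qed

text \<open>
  Here \<open>x\<close> and \<open>y\<close> stand for the values of \<open>\<phi>\<close> and \<open>wp ^ 3\<close>, which determine each other, and
  \<open>4 * y - g3\<close> for the value of \<open>wp' ^ 2\<close>.
\<close>
lemma curve_relations: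
  assumes "x \<noteq> 0"
  defines "y \<equiv> g3 * (x + 3) / (7 * x)"
  shows "7 * y - g3 = 3 * g3 / x" "4 * y - g3 = - 3 * g3 * (x - 4) / (7 * x)"
    "7 ^ 6 * (y ^ 4 * (4 * y - g3) ^ 3) * x ^ 12 / g3 ^ 6 = K * branch_poly x"
proof -
  show "7 * y - g3 = 3 * g3 / x" unfolding y_def using assms(1) by (simp add: field_simps)
  show *: "4 * y - g3 = - 3 * g3 * (x - 4) / (7 * x)"
    unfolding y_def using assms(1) by (simp add: field_simps)
  have "7 ^ 6 * (y ^ 4 * (4 * y - g3) ^ 3) * x ^ 12 / g3 ^ 6
      = 7 ^ 6 * ((g3 * (x + 3)) ^ 4 / (7 * x) ^ 4 * ((- 3 * g3 * (x - 4)) ^ 3 / (7 * x) ^ 3)) * x ^ 12 / g3 ^ 6"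
    unfolding * by (simp only: y_def power_divide)
  also have "\<dots> = K * branch_poly x"
  proof -
    have f1: "(g3 * (x + 3)) ^ 4 * (- 3 * g3 * (x - 4)) ^ 3 = g3 ^ 6 * (- 27 * g3 * ((x - 4) ^ 3 * (x + 3) ^ 4))"
      by algebra
    have f2: "(7 * x) ^ 4 * (7 * x) ^ 3 * x ^ 5 = 7 ^ 7 * x ^ 12" by algebra
    have gen: "7 ^ 6 * (A / P * (A' / P')) * X / G = K * (B * b)"
      if "A * A' = G * (- 27 * g3 * B)" "P * P' * b = 7 ^ 7 * X" "P \<noteq> 0" "P' \<noteq> 0" "G \<noteq> 0"
      for A A' P P' X G B b
    proof -
      have "7 * (7 ^ 6 * (A / P * (A' / P')) * X / G) = (A * A') * (7 ^ 7 * X) / (P * P' * G)"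
        by simp
      also have "\<dots> = - 27 * g3 * B * b"
        unfolding that(1) that(2)[symmetric] using that(3-5) by simp
      finally show ?thesis unfolding K_def by (simp add: field_simps)
    qed
    show ?thesis
      unfolding branch_poly_def by (rule gen[OF f1 f2]) (use assms(1) g3_nonzero in simp_all)
  qed
  finally show "7 ^ 6 * (y ^ 4 * (4 * y - g3) ^ 3) * x ^ 12 / g3 ^ 6 = K * branch_poly x" .
qed

lemma \<phi>_ode:
  assumes "z \<notin> L" "7 * wp z ^ 3 \<noteq> g3"
  shows "deriv \<phi> z ^ 6 = K * branch_poly (\<phi> z)"
proof -
  define x where "x = \<phi> z"
  have nz: "7 * wp z ^ 3 - g3 \<noteq> 0" using assms(2) by simp
  have x: "x \<noteq> 0" unfolding x_def \<phi>_def using nz g3_nonzero by simp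
  have xd: "x * (7 * wp z ^ 3 - g3) = 3 * g3" unfolding x_def \<phi>_def using nz by simp
  have y: "wp z ^ 3 = g3 * (x + 3) / (7 * x)"
    using xd x by (simp add: field_simps)
  have q: "wp' z ^ 2 = 4 * wp z ^ 3 - g3"
    using wp_differential_equation[OF assms(1)] g2_zero g3 by simp
  have "deriv \<phi> z = - 7 * (wp z ^ 2 * wp' z) * x ^ 2 / g3"
    unfolding x_def by (rule DERIV_imp_deriv[OF \<phi>_has_field_derivative[OF assms]])
  then have "deriv \<phi> z ^ 6 = (7 * (wp z ^ 2 * wp' z) * x ^ 2) ^ 6 / g3 ^ 6"
    by (simp add: power_divide)
  also have "(7 * (wp z ^ 2 * wp' z) * x ^ 2) ^ 6 = 7 ^ 6 * ((wp z ^ 3) ^ 4 * (wp' z ^ 2) ^ 3) * x ^ 12"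
    by algebra
  also have "\<dots> / g3 ^ 6 = K * branch_poly x"
    unfolding q unfolding y by (rule curve_relations(3)[OF x])
  finally show ?thesis unfolding x_def .
qed

text \<open>
  Prescribing \<open>\<phi> w = x\<close> and \<open>\<phi>' w = t\<close> prescribes \<open>y = wp w ^ 3\<close> and \<open>r = wp w ^ 2 * wp' w\<close>, whose
  monomials express \<open>wp w\<close> and \<open>wp' w\<close>.
\<close>
lemma \<phi>_jet_surjective:
  assumes x: "x \<notin> {4, -3, 0}" and t: "t ^ 6 = K * branch_poly x"
  obtains w where "w \<notin> L" "7 * wp w ^ 3 \<noteq> g3" "\<phi> w = x" "deriv \<phi> w = t"
proof -
  have nz: "x \<noteq> 0" "x - 4 \<noteq> 0" "x + 3 \<noteq> 0" using x by (auto simp: add_eq_0_iff2)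
  define y where "y = g3 * (x + 3) / (7 * x)"
  note rel = curve_relations[OF nz(1), folded y_def]
  define s where "s = 4 * y - g3"
  define r where "r = - g3 * t / (7 * x ^ 2)"
  have y: "y \<noteq> 0" unfolding y_def using nz g3_nonzero by simp
  have s: "s \<noteq> 0" unfolding s_def rel(2) using nz g3_nonzero by simp
  have t_eq: "t = - 7 * r * x ^ 2 / g3" unfolding r_def using nz(1) g3_nonzero by simp
  have r6: "r ^ 6 = y ^ 4 * s ^ 3"
  proof -
    have "7 ^ 6 * (y ^ 4 * s ^ 3) * x ^ 12 / g3 ^ 6 = (- 7 * r * x ^ 2) ^ 6 / g3 ^ 6"
      using rel(3) t unfolding s_def[symmetric] t_eq power_divide by simp
    also have "(- 7 * r * x ^ 2) ^ 6 = 7 ^ 6 * r ^ 6 * x ^ 12" by algebra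
    finally show ?thesis using nz(1) g3_nonzero by simp
  qed
  have r: "r \<noteq> 0" using r6 y s by auto
  define q p where "q = r ^ 3 / (y ^ 2 * s)" and "p = y * q / r"
  have q: "q * (y ^ 2 * s) = r ^ 3" unfolding q_def using y s by simp
  have p: "p * r = y * q" unfolding p_def using r by simp
  have q2: "q ^ 2 = s"
  proof -
    have "q ^ 2 * (y ^ 4 * s ^ 2) = r ^ 6" using q by algebra
    also have "\<dots> = s * (y ^ 4 * s ^ 2)" unfolding r6 by algebra
    finally show ?thesis using y s by simp
  qed
  have p3: "p ^ 3 = y"
  proof -
    have "p ^ 3 * (r ^ 3 * (y ^ 2 * s)) = y * (r ^ 3 * (y ^ 2 * s))"
      using q p q2 by algebra
    then show ?thesis using r y s by simp
  qed
  have p2q: "p ^ 2 * q = r"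
  proof -
    have "p ^ 2 * q * (r ^ 2 * y) = r * (r ^ 2 * y)"
      using q p q2 by algebra
    then show ?thesis using r y by simp
  qed
  have "q ^ 2 = 4 * p ^ 3 - lattice_g2 L * p - lattice_g3 L"
    unfolding q2 p3 g2_zero g3 s_def by simp
  then obtain w where w: "w \<notin> L" "wp w = p" "wp' w = q" by (rule wp_curve_surjective)
  have "7 * wp w ^ 3 - g3 = 3 * g3 / x" unfolding w(2) p3 rel(1) ..
  then have ne: "7 * wp w ^ 3 \<noteq> g3" and \<phi>: "\<phi> w = x"
    unfolding \<phi>_def using nz(1) g3_nonzero by auto
  have "deriv \<phi> w = - 7 * (wp w ^ 2 * wp' w) * \<phi> w ^ 2 / g3"
    by (rule DERIV_imp_deriv[OF \<phi>_has_field_derivative[OF w(1) ne]])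
  also have "\<dots> = t" unfolding w(2,3) p2q \<phi> t_eq ..
  finally show ?thesis using that w(1) ne \<phi> by blast
qed

lemma \<phi>_tendsto_0:
  assumes "\<mu> \<in> L"
  shows "(\<phi> \<longlongrightarrow> 0) (at \<mu>)" "\<forall>\<^sub>F z in at \<mu>. \<phi> z \<noteq> 0"
proof -
  have "filterlim (\<lambda>z. wp z ^ 3) at_infinity (at \<mu>)"
    using is_pole_wp[OF assms] unfolding is_pole_def
    by (rule Limits.filterlim_power_at_infinity) simp
  then have "filterlim (\<lambda>z. 7 * wp z ^ 3) at_infinity (at \<mu>)"
    by (intro tendsto_mult_filterlim_at_infinity[OF tendsto_const]) auto
  from tendsto_add_filterlim_at_infinity'[OF this tendsto_const, of "- g3"]
  have inf: "filterlim (\<lambda>z. 7 * wp z ^ 3 - g3) at_infinity (at \<mu>)" by simp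
  then show "(\<phi> \<longlongrightarrow> 0) (at \<mu>)"
    unfolding \<phi>_def by (intro tendsto_divide_0[OF tendsto_const])
  have "\<forall>\<^sub>F z in at \<mu>. 7 * wp z ^ 3 - g3 \<noteq> 0"
    using filterlim_at_infinity_imp_eventually_ne[OF inf] .
  then show "\<forall>\<^sub>F z in at \<mu>. \<phi> z \<noteq> 0"
    by eventually_elim (use g3_nonzero in \<open>simp add: \<phi>_def\<close>)
qed

lemma \<phi>_nonconstant: "\<not> (\<exists>k. \<forall>\<^sub>\<approx>z. \<phi> z = k)"
proof
  assume "\<exists>k. \<forall>\<^sub>\<approx>z. \<phi> z = k"
  then obtain k where k: "\<forall>\<^sub>F z in at 0. \<phi> z = k" by (auto simp: eventually_cosparse_open_eq)
  have "((\<lambda>z. k) \<longlongrightarrow> 0) (at (0::complex))"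
    by (rule Lim_transform_eventually[OF \<phi>_tendsto_0(1)[OF zero_in] k])
  then have "k = 0" by (simp add: tendsto_const_iff)
  with k have "\<forall>\<^sub>F z in at 0. \<phi> z = 0" by simp
  with \<phi>_tendsto_0(2)[OF zero_in] have "\<forall>\<^sub>F z in at (0::complex). False"
    by eventually_elim simp
  then show False by simp
qed

lemma generic_points: "\<forall>\<^sub>\<approx>z. z \<notin> L \<and> 7 * wp z ^ 3 \<noteq> g3"
proof -
  have "\<forall>\<^sub>\<approx>z. 7 * wp z ^ 3 \<noteq> g3"
  proof -
    have "\<forall>\<^sub>F z in at z0. \<phi> z \<noteq> 0" for z0
      by (rule nonconstant_avoids[OF \<phi>_meromorphic \<phi>_nonconstant])
    then have "\<forall>\<^sub>\<approx>z. \<phi> z \<noteq> 0" by (simp add: eventually_cosparse_open_eq)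
    then show ?thesis by eventually_elim (auto simp: \<phi>_def)
  qed
  with cosparse_not_in_L show ?thesis by eventually_elim simp
qed

lemma \<phi>_periodic: "\<mu> \<in> L \<Longrightarrow> z \<notin> L \<Longrightarrow> \<phi> (z + \<mu>) = \<phi> z"
  unfolding \<phi>_def using wp_periodic by simp

end

section \<open>Lifting solutions through the covering\<close>

context equianharmonic_lattice
begin

text \<open>
  Start at a generic point \<open>z1\<close> with a point \<open>w1\<close> over \<open>u z1\<close>, chosen such that the derivative of the local
  lift \<open>\<phi>\<inverse> \<circ> u\<close> at \<open>z1\<close> is \<open>G z1\<close> and not merely another sixth root of \<open>G z1 ^ 6\<close>. Both \<open>u\<close> and \<open>\<phi>\<close> satisfy
  first order equations with the same right side up to the factor \<open>G ^ 6\<close>, so the derivative of the local lift is a sixth root of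
  \<open>G ^ 6\<close> nearby, hence equal to \<open>G\<close> by continuity. Thus a primitive of \<open>G\<close> continues the local lift to
  the whole plane, and the identity theorem applies.
\<close>
lemma lift_through_\<phi>:
  assumes mero: "u meromorphic_on UNIV" and nonconst: "\<not> (\<exists>k. \<forall>\<^sub>\<approx>z. u z = k)"
    and G: "G holomorphic_on UNIV" "\<And>z. G z \<noteq> 0"
    and ode: "\<forall>\<^sub>\<approx>z. deriv u z ^ 6 = K * G z ^ 6 * branch_poly (u z)"
  obtains h where "\<And>z. (h has_field_derivative G z) (at z)" "\<forall>\<^sub>\<approx>z. u z = \<phi> (h z)"
proof -
  define P where "P z \<longleftrightarrow> u analytic_on {z} \<and> u z \<notin> {4, -3, 0} \<and>
    deriv u z ^ 6 = K * G z ^ 6 * branch_poly (u z)" for z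
  have "\<forall>\<^sub>\<approx>z. u z \<noteq> a" for a
    using nonconstant_avoids[OF mero nonconst] by (simp add: eventually_cosparse_open_eq)
  from meromorphic_on_imp_analytic_cosparse[OF mero] this[of 4] this[of "-3"] this[of 0] ode
  have P_ev: "\<forall>\<^sub>\<approx>z. P z" by eventually_elim (simp add: P_def)
  then obtain z1 where z1: "P z1" using eventually_happens'[of "cosparse UNIV" P] by auto
  have "\<forall>\<^sub>F z in at z1. P z" using P_ev by (simp add: eventually_cosparse_open_eq)
  then have "\<forall>\<^sub>F z in nhds z1. P z" using z1 by (auto simp: eventually_at_filter elim: eventually_mono)
  then obtain \<delta> where \<delta>: "\<delta> > 0" "\<And>z. z \<in> ball z1 \<delta> \<Longrightarrow> P z"
    unfolding eventually_nhds_metric by (auto simp: dist_commute)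
  have u_hol: "u holomorphic_on ball z1 \<delta>"
    using \<delta>(2) unfolding P_def by (intro analytic_imp_holomorphic) (subst analytic_on_analytic_at, blast)
  define x t where "x = u z1" and "t = deriv u z1 / G z1"
  have x: "x \<notin> {4, -3, 0}" using z1 unfolding P_def x_def by blast
  have branch_nz: "branch_poly y \<noteq> 0" if "y \<notin> {4, -3, 0}" for y
    using that unfolding branch_poly_def by (auto simp: add_eq_0_iff2)
  have t: "t ^ 6 = K * branch_poly x"
    using z1 G(2)[of z1] unfolding P_def t_def x_def by (simp add: power_divide)
  then have t_nz: "t \<noteq> 0" using K_nonzero branch_nz[OF x] by auto
  obtain w1 where w1: "w1 \<notin> L" "7 * wp w1 ^ 3 \<noteq> g3" "\<phi> w1 = x" "deriv \<phi> w1 = t"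
    by (rule \<phi>_jet_surjective[OF x t])
  define W where "W = - L \<inter> (\<lambda>z. 7 * wp z ^ 3) -` (- {g3})"
  have W: "open W" unfolding W_def
    by (intro continuous_open_preimage continuous_intros holomorphic_on_imp_continuous_on wp_holomorphic)
       (auto simp: closed_L)
  have \<phi>_hol: "\<phi> holomorphic_on W"
  proof (subst holomorphic_on_open[OF W])
    show "\<forall>z\<in>W. \<exists>f'. (\<phi> has_field_derivative f') (at z)"
      using \<phi>_has_field_derivative unfolding W_def by blast
  qed
  have "w1 \<in> W" "deriv \<phi> w1 \<noteq> 0" using w1 t_nz unfolding W_def by auto
  then obtain r where r: "r > 0" "ball w1 r \<subseteq> W" "open (\<phi> ` ball w1 r)" "inj_on \<phi> (ball w1 r)"
    using has_complex_derivative_locally_invertible[OF \<phi>_hol _ W] by metis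
  obtain g where g: "g holomorphic_on (\<phi> ` ball w1 r)"
    "\<And>z. z \<in> ball w1 r \<Longrightarrow> deriv \<phi> z * deriv g (\<phi> z) = 1" "\<And>z. z \<in> ball w1 r \<Longrightarrow> g (\<phi> z) = z"
    by (rule holomorphic_has_inverse[OF holomorphic_on_subset[OF \<phi>_hol r(2)] open_ball r(4)]) blast
  have "open (ball z1 \<delta> \<inter> u -` (\<phi> ` ball w1 r))"
    by (intro continuous_open_preimage holomorphic_on_imp_continuous_on u_hol r(3)) auto
  moreover have "z1 \<in> ball z1 \<delta> \<inter> u -` (\<phi> ` ball w1 r)"
    using \<delta>(1) r(1) w1(3) unfolding x_def by (auto intro!: image_eqI[of _ \<phi> w1])
  ultimately obtain \<epsilon> where \<epsilon>: "\<epsilon> > 0" "ball z1 \<epsilon> \<subseteq> ball z1 \<delta> \<inter> u -` (\<phi> ` ball w1 r)"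
    unfolding open_contains_ball by blast
  have in\<epsilon>: "P z" "g (u z) \<in> ball w1 r" "\<phi> (g (u z)) = u z" "u z \<in> \<phi> ` ball w1 r" "z \<in> ball z1 \<delta>"
    if "z \<in> ball z1 \<epsilon>" for z
    using that \<epsilon>(2) \<delta>(2) g(3) by force+
  define d where "d z = deriv g (u z) * deriv u z" for z
  have dh0: "((\<lambda>z. g (u z)) has_field_derivative d z) (at z)" if "z \<in> ball z1 \<epsilon>" for z
    unfolding d_def
    by (rule DERIV_chain2[OF holomorphic_derivI[OF g(1) r(3)] holomorphic_derivI[OF u_hol open_ball]])
       (use in\<epsilon>[OF that] in auto)
  have chain: "deriv \<phi> (g (u z)) * d z = deriv u z" if "z \<in> ball z1 \<epsilon>" for z
    using g(2)[OF in\<epsilon>(2)[OF that]] unfolding in\<epsilon>(3)[OF that] d_def by (simp flip: mult.assoc)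
  have root: "(d z / G z) ^ 6 = 1" if z: "z \<in> ball z1 \<epsilon>" for z
  proof -
    have "g (u z) \<in> W" using in\<epsilon>(2)[OF z] r(2) by blast
    then have "deriv \<phi> (g (u z)) ^ 6 = K * branch_poly (u z)"
      using \<phi>_ode[of "g (u z)"] in\<epsilon>(3)[OF z] unfolding W_def by auto
    then have "K * branch_poly (u z) * d z ^ 6 = K * G z ^ 6 * branch_poly (u z)"
      using in\<epsilon>(1)[OF z] unfolding P_def chain[OF z, symmetric] by (simp add: power_mult_distrib)
    moreover have "branch_poly (u z) \<noteq> 0" using in\<epsilon>(1)[OF z] branch_nz unfolding P_def by blast
    ultimately have "d z ^ 6 = G z ^ 6" using K_nonzero by simp
    then show ?thesis using G(2)[of z] by (simp add: power_divide)
  qed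
  have "(\<lambda>z. d z / G z) constant_on ball z1 \<epsilon>"
  proof (rule continuous_finite_range_constant)
    have "(deriv g \<circ> u) holomorphic_on ball z1 \<epsilon>"
      by (rule holomorphic_on_compose_gen[OF holomorphic_on_subset[OF u_hol] holomorphic_deriv[OF g(1) r(3)]])
         (use in\<epsilon> in auto)
    moreover have "deriv u holomorphic_on ball z1 \<epsilon>"
      by (rule holomorphic_on_subset[OF holomorphic_deriv[OF u_hol]]) (use in\<epsilon> in auto)
    ultimately have "d holomorphic_on ball z1 \<epsilon>"
      unfolding d_def[abs_def] o_def by (rule holomorphic_on_mult)
    then show "continuous_on (ball z1 \<epsilon>) (\<lambda>z. d z / G z)"
      by (intro holomorphic_on_imp_continuous_on holomorphic_intros holomorphic_on_subset[OF G(1)])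
         (use G(2) in auto)
    define p :: "complex poly" where "p = monom 1 6 - 1"
    have p: "poly p y = y ^ 6 - 1" for y unfolding p_def by (simp add: poly_monom)
    have "p \<noteq> 0"
    proof
      assume "p = 0"
      with p[of 0] show False by simp
    qed
    then have "finite {y. poly p y = 0}" by (rule poly_roots_finite)
    moreover have "(\<lambda>z. d z / G z) ` ball z1 \<epsilon> \<subseteq> {y. poly p y = 0}"
    proof clarify
      fix z assume "z \<in> ball z1 \<epsilon>"
      from root[OF this] show "poly p (d z / G z) = 0" unfolding p by simp
    qed
    ultimately show "finite ((\<lambda>z. d z / G z) ` ball z1 \<epsilon>)" using finite_subset by blast
  qed auto
  then obtain k where k: "\<And>z. z \<in> ball z1 \<epsilon> \<Longrightarrow> d z / G z = k" unfolding constant_on_def by blast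
  have z1\<epsilon>: "z1 \<in> ball z1 \<epsilon>" using \<epsilon>(1) by simp
  have g1: "g (u z1) = w1" using g(3)[of w1] r(1) w1(3) unfolding x_def by simp
  have "t * d z1 = t * G z1"
    using chain[OF z1\<epsilon>] G(2)[of z1] unfolding g1 w1(4) t_def by simp
  then have "k = 1" using k[OF z1\<epsilon>] t_nz G(2)[of z1] by simp
  then have dG: "d z = G z" if "z \<in> ball z1 \<epsilon>" for z
    using k[OF that] G(2)[of z] by simp
  obtain H where "\<And>z. z \<in> UNIV \<Longrightarrow> (H has_field_derivative G z) (at z within UNIV)"
    by (rule holomorphic_convex_primitive'[OF convex_UNIV open_UNIV G(1)]) blast
  then have H: "(H has_field_derivative G z) (at z)" for z by simp
  define h where "h z = H z + (w1 - H z1)" for z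
  have h: "(h has_field_derivative G z) (at z)" for z
    unfolding h_def[abs_def] by (auto intro!: derivative_eq_intros H)
  have h_eq: "g (u z) = h z" if z: "z \<in> ball z1 \<epsilon>" for z
  proof -
    have "((\<lambda>z. g (u z) - h z) has_field_derivative 0) (at z within ball z1 \<epsilon>)" if "z \<in> ball z1 \<epsilon>" for z
      using has_field_derivative_at_within[OF DERIV_diff[OF dh0[OF that] h[of z]]] dG[OF that] by simp
    then have "\<exists>c. \<forall>z\<in>ball z1 \<epsilon>. g (u z) - h z = c"
      by (rule has_field_derivative_zero_constant[OF convex_ball])
    then obtain c where "\<And>z. z \<in> ball z1 \<epsilon> \<Longrightarrow> g (u z) - h z = c" by blast
    from this[OF z1\<epsilon>] this[OF z] show ?thesis unfolding g1 h_def by simp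
  qed
  have "(\<lambda>z. \<phi> (h z)) meromorphic_on UNIV"
  proof (rule meromorphic_on_compose[OF \<phi>_meromorphic])
    show "h analytic_on UNIV"
      using h by (subst analytic_on_open) (auto simp: holomorphic_on_open)
  qed auto
  then have "(\<lambda>z. u z - \<phi> (h z)) meromorphic_on UNIV" by (intro meromorphic_intros mero)
  from meromorphic_imp_constant_or_avoid[OF this open_UNIV connected_UNIV, of 0]
  have "\<forall>\<^sub>\<approx>z. u z - \<phi> (h z) = 0"
  proof
    assume "\<forall>\<^sub>\<approx>z. u z - \<phi> (h z) \<noteq> 0"
    then have "\<forall>\<^sub>F z in at z1. u z - \<phi> (h z) \<noteq> 0" by (simp add: eventually_cosparse_open_eq)
    moreover have "\<forall>\<^sub>F z in at z1. z \<in> ball z1 \<epsilon>"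
      using \<epsilon>(1) by (intro eventually_at_in_open') auto
    ultimately have "\<forall>\<^sub>F z in at z1. False"
    proof eventually_elim
      case (elim z)
      then show ?case using h_eq[OF elim(2)] in\<epsilon>(3)[OF elim(2)] by simp
    qed
    then show ?thesis by simp
  qed
  then have "\<forall>\<^sub>\<approx>z. u z = \<phi> (h z)" by eventually_elim simp
  with h show ?thesis using that by blast
qed

end

section \<open>Schwarzian derivatives of solutions of the first order equation\<close>

text \<open>
  The left side is \<open>\<Lambda>' + \<Lambda> ^ 2 / 2\<close> for the logarithmic derivative \<open>6 * \<Lambda>\<close> of \<open>branch_poly\<close>; its numerator
  is the source of the values \<open>\<plusminus> sqrt 5 * \<i>\<close>.
\<close>
lemma branch_log_derivative_identity:
  fixes x :: complex
  assumes "x - 4 \<noteq> 0" "x + 3 \<noteq> 0" "x \<noteq> 0"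
  shows "- (3 / (x - 4) ^ 2 + 4 / (x + 3) ^ 2 + 5 / x ^ 2) / 6 + ((3 / (x - 4) + 4 / (x + 3) + 5 / x) / 6) ^ 2 / 2
    = - 14 * (x ^ 2 + 5) / ((x - 4) * (x + 3) * x) ^ 2" (is "?l = _")
proof -
  define X where "X = (x - 4) * (x + 3) * x"
  have X: "X \<noteq> 0" unfolding X_def using assms by simp
  define \<alpha> \<beta> \<gamma> where "\<alpha> = 1 / (x - 4)" and "\<beta> = 1 / (x + 3)" and "\<gamma> = 1 / x"
  have s: "\<alpha> * X = (x + 3) * x" "\<beta> * X = (x - 4) * x" "\<gamma> * X = (x - 4) * (x + 3)"
    unfolding \<alpha>_def \<beta>_def \<gamma>_def X_def using assms by simp_all
  have "?l = - (3 * \<alpha> ^ 2 + 4 * \<beta> ^ 2 + 5 * \<gamma> ^ 2) / 6 + (3 * \<alpha> + 4 * \<beta> + 5 * \<gamma>) ^ 2 / 72"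
    unfolding \<alpha>_def \<beta>_def \<gamma>_def by (simp add: power_divide)
  then have "72 * ?l * X ^ 2 = - 12 * (3 * (\<alpha> * X) ^ 2 + 4 * (\<beta> * X) ^ 2 + 5 * (\<gamma> * X) ^ 2)
      + (3 * (\<alpha> * X) + 4 * (\<beta> * X) + 5 * (\<gamma> * X)) ^ 2"
    by (simp only:) (simp add: field_simps power2_eq_square)
  also have "\<dots> = 72 * (- 14 * (x ^ 2 + 5))" unfolding s by algebra
  finally have eq: "72 * ?l * X ^ 2 = 72 * (- 14 * (x ^ 2 + 5))" .
  have "l = N / Y" if "72 * l * Y = 72 * N" "Y \<noteq> 0" for l N Y :: complex
    using that by (simp add: field_simps)
  from this[OF eq] X show ?thesis unfolding X_def by simp
qed

lemma branch_poly_has_field_derivative: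
  assumes "x \<notin> {4, -3, 0}"
  shows "(branch_poly has_field_derivative (3 / (x - 4) + 4 / (x + 3) + 5 / x) * branch_poly x) (at x)"
proof -
  have nz: "x - 4 \<noteq> 0" "x + 3 \<noteq> 0" "x \<noteq> 0" using assms by (auto simp: add_eq_0_iff2)
  have "(branch_poly has_field_derivative 3 * (x - 4) ^ 2 * ((x + 3) ^ 4 * x ^ 5)
      + 4 * (x + 3) ^ 3 * ((x - 4) ^ 3 * x ^ 5) + 5 * x ^ 4 * ((x - 4) ^ 3 * (x + 3) ^ 4)) (at x)"
    unfolding branch_poly_def[abs_def]
    by (rule derivative_eq_intros refl | simp add: algebra_simps)+
  moreover have "3 * (x - 4) ^ 2 * ((x + 3) ^ 4 * x ^ 5)
      + 4 * (x + 3) ^ 3 * ((x - 4) ^ 3 * x ^ 5) + 5 * x ^ 4 * ((x - 4) ^ 3 * (x + 3) ^ 4)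
      = (3 / (x - 4) + 4 / (x + 3) + 5 / x) * branch_poly x"
  proof -
    have "3 / (x - 4) * branch_poly x = 3 * (x - 4) ^ 2 * ((x + 3) ^ 4 * x ^ 5)"
      unfolding branch_poly_def using nz(1) by (simp add: power3_eq_cube power2_eq_square)
    moreover have "4 / (x + 3) * branch_poly x = 4 * (x + 3) ^ 3 * ((x - 4) ^ 3 * x ^ 5)"
      unfolding branch_poly_def using nz(2) by (simp add: power3_eq_cube power4_eq_xxxx)
    moreover have "5 / x * branch_poly x = 5 * x ^ 4 * ((x - 4) ^ 3 * (x + 3) ^ 4)"
      unfolding branch_poly_def using nz(3) by (simp add: eval_nat_numeral)
    ultimately show ?thesis by (simp only: distrib_right)
  qed
  ultimately show ?thesis by simp
qed

text \<open>
  Differentiating \<open>v' ^ 6 = k * B v\<close> gives \<open>v''/v' = \<Lambda> v * v'\<close> with \<open>\<Lambda> = B' / (6 * B)\<close>, so that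
  \<open>S = (\<Lambda>' v + (\<Lambda> v) ^ 2 / 2) * v' ^ 2\<close>.
\<close>
lemma schwarzian_of_branch_ode:
  assumes A: "open A" "v holomorphic_on A" and avoid: "\<And>z. z \<in> A \<Longrightarrow> v z \<notin> {4, -3, 0}"
    and ode: "\<And>z. z \<in> A \<Longrightarrow> deriv v z ^ 6 = k * branch_poly (v z)" and k: "k \<noteq> 0" and z: "z \<in> A"
  shows "schwarzian v z ^ 3 * schwarzian_den (v z) = - 2744 * k * (v z ^ 2 + 5) ^ 3"
proof -
  define \<Lambda> where "\<Lambda> x = (3 / (x - 4) + 4 / (x + 3) + 5 / x) / 6" for x :: complex
  define \<Lambda>' where "\<Lambda>' x = - (3 / (x - 4) ^ 2 + 4 / (x + 3) ^ 2 + 5 / x ^ 2) / 6" for x :: complex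
  have nz: "v w - 4 \<noteq> 0" "v w + 3 \<noteq> 0" "v w \<noteq> 0" if "w \<in> A" for w
    using avoid[OF that] by (auto simp: add_eq_0_iff2)
  have dv: "(v has_field_derivative deriv v w) (at w)" if "w \<in> A" for w
    by (rule holomorphic_derivI[OF A(2,1) that])
  have ddv: "(deriv v has_field_derivative deriv (deriv v) w) (at w)" if "w \<in> A" for w
    by (rule holomorphic_derivI[OF holomorphic_deriv[OF A(2,1)] A(1) that])
  have dnz: "deriv v w \<noteq> 0" if "w \<in> A" for w
  proof
    assume "deriv v w = 0"
    then have "branch_poly (v w) = 0" using ode[OF that] k by simp
    then show False using nz[OF that] unfolding branch_poly_def by simp
  qed
  have second: "deriv (deriv v) w = \<Lambda> (v w) * deriv v w ^ 2" if w: "w \<in> A" for w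
  proof -
    have lhs: "((\<lambda>w. deriv v w ^ 6) has_field_derivative 6 * deriv v w ^ 5 * deriv (deriv v) w) (at w)"
      using DERIV_power[OF ddv[OF w], of 6] by (simp add: mult_ac)
    have \<Lambda>6: "6 * \<Lambda> (v w) = 3 / (v w - 4) + 4 / (v w + 3) + 5 / v w" unfolding \<Lambda>_def by simp
    have "((\<lambda>w. k * branch_poly (v w)) has_field_derivative
        k * (6 * \<Lambda> (v w) * branch_poly (v w) * deriv v w)) (at w)"
      using DERIV_cmult[OF DERIV_chain2[OF branch_poly_has_field_derivative[OF avoid[OF w]] dv[OF w]], of k]
      unfolding \<Lambda>6 .
    then have "((\<lambda>w. deriv v w ^ 6) has_field_derivative
        k * (6 * \<Lambda> (v w) * branch_poly (v w) * deriv v w)) (at w)"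
      by (rule has_field_derivative_transform_within_open[OF _ A(1) w]) (use ode in auto)
    from DERIV_unique[OF lhs this]
    have "6 * deriv v w ^ 5 * deriv (deriv v) w
        = k * (6 * \<Lambda> (v w) * branch_poly (v w) * deriv v w)" .
    also have "\<dots> = 6 * \<Lambda> (v w) * deriv v w * (k * branch_poly (v w))" by simp
    also have "\<dots> = 6 * deriv v w ^ 5 * (\<Lambda> (v w) * deriv v w ^ 2)"
      unfolding ode[OF w, symmetric] by algebra
    finally show ?thesis using dnz[OF w] by simp
  qed
  have recip: "((\<lambda>x. c / (x + a)) has_field_derivative - (c / (x + a) ^ 2)) (at x)"
    if "x + a \<noteq> 0" for x a c :: complex
    using that by (auto intro!: derivative_eq_intros simp: power2_eq_square)
  have d\<Lambda>: "(\<Lambda> has_field_derivative \<Lambda>' x) (at x)" if "x - 4 \<noteq> 0" "x + 3 \<noteq> 0" "x \<noteq> 0" for x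
  proof -
    have "((\<lambda>x. (3 / (x + - 4) + 4 / (x + 3) + 5 / (x + 0)) / 6) has_field_derivative
        (- (3 / (x + - 4) ^ 2) + - (4 / (x + 3) ^ 2) + - (5 / (x + 0) ^ 2)) / 6) (at x)"
      by (intro DERIV_cdivide DERIV_add recip) (use that in auto)
    moreover have "(- (3 / (x + - 4) ^ 2) + - (4 / (x + 3) ^ 2) + - (5 / (x + 0) ^ 2)) / 6 = \<Lambda>' x"
      unfolding \<Lambda>'_def by (simp add: diff_divide_distrib add_divide_distrib)
    ultimately show ?thesis unfolding \<Lambda>_def[abs_def] by simp
  qed
  have "((\<lambda>w. \<Lambda> (v w) * deriv v w) has_field_derivative
      \<Lambda>' (v z) * deriv v z * deriv v z + deriv (deriv v) z * \<Lambda> (v z)) (at z)"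
    by (rule DERIV_mult[OF DERIV_chain2[OF d\<Lambda>[OF nz[OF z]] dv[OF z]] ddv[OF z]])
  then have "((\<lambda>w. deriv (deriv v) w / deriv v w) has_field_derivative
      \<Lambda>' (v z) * deriv v z * deriv v z + deriv (deriv v) z * \<Lambda> (v z)) (at z)"
    by (rule has_field_derivative_transform_within_open[OF _ A(1) z])
       (use second dnz in \<open>auto simp: power2_eq_square\<close>)
  then have "deriv (\<lambda>w. deriv (deriv v) w / deriv v w) z
      = \<Lambda>' (v z) * deriv v z * deriv v z + deriv (deriv v) z * \<Lambda> (v z)"
    by (rule DERIV_imp_deriv)
  moreover have "deriv (deriv v) z / deriv v z = \<Lambda> (v z) * deriv v z"
    using second[OF z] dnz[OF z] by (simp add: power2_eq_square)
  ultimately have "schwarzian v z = (\<Lambda>' (v z) + \<Lambda> (v z) ^ 2 / 2) * deriv v z ^ 2"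
    unfolding schwarzian_def second[OF z] by (simp add: field_simps power2_eq_square)
  also have "\<Lambda>' (v z) + \<Lambda> (v z) ^ 2 / 2 = - 14 * (v z ^ 2 + 5) / ((v z - 4) * (v z + 3) * v z) ^ 2"
    unfolding \<Lambda>'_def \<Lambda>_def by (rule branch_log_derivative_identity[OF nz[OF z]])
  finally have "schwarzian v z ^ 3
      = (- 14 * (v z ^ 2 + 5)) ^ 3 / (((v z - 4) * (v z + 3) * v z) ^ 2) ^ 3 * (deriv v z ^ 2) ^ 3"
    by (simp only: power_mult_distrib power_divide)
  also have "(deriv v z ^ 2) ^ 3 = k * branch_poly (v z)" using ode[OF z] by (simp flip: power_mult)
  finally have S3: "schwarzian v z ^ 3 = (- 14 * (v z ^ 2 + 5)) ^ 3
      / (((v z - 4) * (v z + 3) * v z) ^ 2) ^ 3 * (k * branch_poly (v z))" .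
  have "schwarzian v z ^ 3 * schwarzian_den (v z) = (- 14 * (v z ^ 2 + 5)) ^ 3 * k *
      (branch_poly (v z) * schwarzian_den (v z) / (((v z - 4) * (v z + 3) * v z) ^ 2) ^ 3)"
    unfolding S3 by simp
  also have "branch_poly (v z) * schwarzian_den (v z) = (((v z - 4) * (v z + 3) * v z) ^ 2) ^ 3"
    unfolding branch_poly_def schwarzian_den_def by algebra
  also have "(- 14 * (v z ^ 2 + 5)) ^ 3 * k * (\<dots> / (((v z - 4) * (v z + 3) * v z) ^ 2) ^ 3)
      = - 2744 * k * (v z ^ 2 + 5) ^ 3"
  proof -
    have "(- 14 * y) ^ 3 = - 2744 * y ^ 3" for y :: complex by algebra
    then show ?thesis using nz[OF z] by (simp only: power_mult_distrib) simp
  qed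
  finally show ?thesis .
qed

section \<open>Solutions of the Schwarzian equation\<close>

lemma schwarzian_cong_ev:
  assumes "\<forall>\<^sub>F w in nhds z. u w = v w"
  shows "schwarzian u z = schwarzian v z"
proof -
  have deriv_ev: "\<forall>\<^sub>F w in nhds z. deriv f w = deriv g w"
    if "\<forall>\<^sub>F w in nhds z. f w = g w" for f g :: "complex \<Rightarrow> complex"
  proof -
    have "\<forall>\<^sub>F y in nhds z. \<forall>\<^sub>F w in nhds y. f w = g w"
      using that by (simp add: eventually_eventually)
    then show ?thesis by eventually_elim (rule deriv_cong_ev, auto)
  qed
  note d = deriv_ev[OF assms] and dd = deriv_ev[OF deriv_ev[OF assms]]
  have "\<forall>\<^sub>F w in nhds z. deriv (deriv u) w / deriv u w = deriv (deriv v) w / deriv v w"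
    using d dd by eventually_elim simp
  then have "deriv (\<lambda>w. deriv (deriv u) w / deriv u w) z = deriv (\<lambda>w. deriv (deriv v) w / deriv v w) z"
    by (rule deriv_cong_ev) simp
  then show ?thesis
    unfolding schwarzian_def using eventually_nhds_x_imp_x[OF d] eventually_nhds_x_imp_x[OF dd] by simp
qed

text \<open>
  The exceptional set of \<open>P\<close> is closed, so \<open>P\<close> holds near every point outside it. This allows identities
  that hold off a sparse set to be differentiated.
\<close>
lemma cosparse_imp_cosparse_nhds:
  assumes "\<forall>\<^sub>\<approx>z. P (z :: complex)"
  shows "\<forall>\<^sub>\<approx>z. \<forall>\<^sub>F w in nhds z. P w"
proof -
  have "\<forall>\<^sub>F y in at z. \<forall>\<^sub>F w in nhds y. P w" for z
  proof -
    have "\<forall>\<^sub>F w in nhds z. w \<noteq> z \<longrightarrow> P w"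
      using assms by (simp add: eventually_cosparse_open_eq eventually_at_filter)
    then have "\<forall>\<^sub>F y in nhds z. \<forall>\<^sub>F w in nhds y. w \<noteq> z \<longrightarrow> P w"
      by (simp add: eventually_eventually)
    then have "\<forall>\<^sub>F y in at z. \<forall>\<^sub>F w in nhds y. w \<noteq> z \<longrightarrow> P w"
      unfolding eventually_at_filter by (rule eventually_mono) simp
    then show ?thesis
      using eventually_neq_at_within[of z z UNIV]
    proof eventually_elim
      case (elim y)
      have "\<forall>\<^sub>F w in nhds y. w \<noteq> z" using elim(2) by (intro t1_space_nhds)
      with elim(1) show ?case by eventually_elim simp
    qed
  qed
  then show ?thesis by (simp add: eventually_cosparse_open_eq)
qed

lemma cosparse_shift:
  assumes "\<forall>\<^sub>\<approx>z. P (z :: complex)"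
  shows "\<forall>\<^sub>\<approx>z. P (z + a)"
proof -
  have "\<forall>\<^sub>F w in at z. P (w + a)" for z
  proof -
    have "\<forall>\<^sub>F w in at (z + a). P w" using assms by (simp add: eventually_cosparse_open_eq)
    moreover have "filterlim (\<lambda>w. w + a) (at (z + a)) (at z)"
      unfolding filterlim_at by (auto intro!: tendsto_intros simp: eventually_at_filter)
    ultimately show ?thesis by (simp add: filterlim_iff)
  qed
  then show ?thesis by (simp add: eventually_cosparse_open_eq)
qed

context equianharmonic_lattice
begin

lemma \<phi>_shift_solves:
  assumes u: "\<forall>\<^sub>\<approx>z. u z = \<phi> (z - z0)"
    and \<sigma>: "\<And>x. (x - \<sigma>1) * (x - \<sigma>2) = x ^ 2 + 5"
  shows "schwarzian_solution (10584 * g3) \<sigma>1 \<sigma>2 u"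
proof -
  let ?good = "\<lambda>z. z \<notin> L \<and> 7 * wp z ^ 3 \<noteq> g3 \<and> \<phi> z \<notin> {4, -3, 0}"
  have "\<forall>\<^sub>\<approx>z. \<phi> z \<noteq> a" for a
    using nonconstant_avoids[OF \<phi>_meromorphic \<phi>_nonconstant] by (simp add: eventually_cosparse_open_eq)
  from generic_points this[of 4] this[of "-3"] this[of 0]
  have "\<forall>\<^sub>\<approx>z. ?good z" by eventually_elim simp
  from cosparse_shift[OF this, of "- z0"] have "\<forall>\<^sub>\<approx>z. ?good (z - z0)" by simp
  from cosparse_imp_cosparse_nhds[OF this] cosparse_imp_cosparse_nhds[OF u]
  show ?thesis
    unfolding schwarzian_solution_def
  proof eventually_elim
    case (elim z)
    from elim(1) obtain A where A: "open A" "z \<in> A" "\<And>w. w \<in> A \<Longrightarrow> ?good (w - z0)"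
      unfolding eventually_nhds by blast
    let ?v = "\<lambda>z. \<phi> (z - z0)"
    have dv: "(?v has_field_derivative deriv \<phi> (w - z0)) (at w)" if "w \<in> A" for w
    proof -
      have "(\<phi> has_field_derivative deriv \<phi> (w - z0)) (at (w - z0))"
        using \<phi>_has_field_derivative A(3)[OF that] DERIV_deriv_iff_has_field_derivative by blast
      moreover have "((\<lambda>z. z - z0) has_field_derivative 1) (at w)" by (auto intro!: derivative_eq_intros)
      ultimately show ?thesis using DERIV_chain2 by fastforce
    qed
    have "schwarzian ?v z ^ 3 * schwarzian_den (?v z) = - 2744 * K * (?v z ^ 2 + 5) ^ 3"
    proof (rule schwarzian_of_branch_ode[OF A(1) _ _ _ K_nonzero A(2)])
      show "?v holomorphic_on A" using dv A(1) by (auto simp: holomorphic_on_open)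
      show "deriv ?v w ^ 6 = K * branch_poly (?v w)" if "w \<in> A" for w
        using DERIV_imp_deriv[OF dv[OF that]] \<phi>_ode A(3)[OF that] by simp
      show "?v w \<notin> {4, -3, 0}" if "w \<in> A" for w using A(3)[OF that] by blast
    qed
    moreover have "schwarzian u z = schwarzian ?v z" by (rule schwarzian_cong_ev) (rule elim(2))
    moreover have "u z = ?v z" using elim(2) by (rule eventually_nhds_x_imp_x)
    ultimately have "schwarzian u z ^ 3 * schwarzian_den (u z) = 10584 * g3 * ((u z - \<sigma>1) * (u z - \<sigma>2)) ^ 3"
      unfolding \<sigma> K_def by simp
    moreover have "u z \<notin> {4, -3, 0}" using A(2,3) \<open>u z = ?v z\<close> by auto
    then have "schwarzian_den (u z) \<noteq> 0" unfolding schwarzian_den_def by (auto simp: add_eq_0_iff2)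
    ultimately have "schwarzian u z ^ 3
        = 10584 * g3 * ((u z - \<sigma>1) ^ 3 * (u z - \<sigma>2) ^ 3) / schwarzian_den (u z)"
      by (simp add: eq_divide_eq power_mult_distrib)
    then show ?case unfolding schwarzian_den_def by simp
  qed
qed

lemma infinite_L: "infinite L"
proof
  assume fin: "finite L"
  obtain B where B: "\<And>z. \<exists>\<omega>\<in>L. norm (z - \<omega>) \<le> B" using lattice_covering by metis
  have "bounded L" using fin by (rule finite_imp_bounded)
  then obtain C where C: "\<And>\<omega>. \<omega> \<in> L \<Longrightarrow> norm \<omega> \<le> C" unfolding bounded_iff by blast
  define z :: complex where "z = of_real (\<bar>B\<bar> + \<bar>C\<bar> + 1)"
  obtain \<omega> where "\<omega> \<in> L" "norm (z - \<omega>) \<le> B" using B by blast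
  then have "norm z \<le> C + B" using C[of \<omega>] norm_triangle_ineq2[of z \<omega>] by linarith
  then show False unfolding z_def norm_of_real by linarith
qed

text \<open>
  A rational function with zeros at the infinitely many points of a lattice is zero.
\<close>
lemma \<phi>_shift_transcendental:
  assumes u: "\<forall>\<^sub>\<approx>z. u z = \<phi> (z - z0)"
  shows "transcendental_meromorphic u"
proof -
  have "(\<lambda>z. z - z0) analytic_on UNIV" by (intro analytic_intros)
  then have "(\<lambda>z. \<phi> (z - z0)) meromorphic_on UNIV"
    by (rule meromorphic_on_compose[OF \<phi>_meromorphic]) auto
  then have mero: "u meromorphic_on UNIV" using meromorphic_on_cong'[OF u refl] by simp
  moreover have "\<not> rational_fun u"
  proof
    assume "rational_fun u"
    then obtain p q where q: "q \<noteq> 0" and pq: "\<forall>\<^sub>\<approx>z. u z = poly p z / poly q z"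
      unfolding rational_fun_def by blast
    have "\<forall>\<^sub>\<approx>z. \<forall>a\<in>{x. poly q x = 0}. z \<noteq> a"
      by (intro eventually_ball_finite poly_roots_finite[OF q])
         (simp add: eventually_cosparse_open_eq eventually_neq_at_within)
    then have "\<forall>\<^sub>\<approx>z. poly q z \<noteq> 0" by eventually_elim blast
    with u pq have eq: "\<forall>\<^sub>\<approx>z. \<phi> (z - z0) * poly q z = poly p z"
    proof eventually_elim
      case (elim z)
      then have "\<phi> (z - z0) = poly p z / poly q z" by simp
      with elim(3) show ?case by simp
    qed
    have "poly p (z0 + \<mu>) = 0" if \<mu>: "\<mu> \<in> L" for \<mu>
    proof -
      have "filterlim (\<lambda>z. z - z0) (at \<mu>) (at (z0 + \<mu>))"
        unfolding filterlim_at
        by (auto intro!: tendsto_eq_intros always_eventually simp: eventually_at_filter)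
      then have "((\<lambda>z. \<phi> (z - z0)) \<longlongrightarrow> 0) (at (z0 + \<mu>))"
        by (rule filterlim_compose[OF \<phi>_tendsto_0(1)[OF \<mu>]])
      then have "((\<lambda>z. \<phi> (z - z0) * poly q z) \<longlongrightarrow> 0 * poly q (z0 + \<mu>)) (at (z0 + \<mu>))"
        by (intro tendsto_intros)
      moreover have "\<forall>\<^sub>F z in at (z0 + \<mu>). \<phi> (z - z0) * poly q z = poly p z"
        using eq by (simp add: eventually_cosparse_open_eq)
      ultimately have "(poly p \<longlongrightarrow> 0 * poly q (z0 + \<mu>)) (at (z0 + \<mu>))"
        by (rule Lim_transform_eventually)
      moreover have "(poly p \<longlongrightarrow> poly p (z0 + \<mu>)) (at (z0 + \<mu>))"
        by (intro tendsto_intros)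
      ultimately show ?thesis using tendsto_unique[OF trivial_limit_at] by fastforce
    qed
    then have "(\<lambda>\<mu>. z0 + \<mu>) ` L \<subseteq> {z. poly p z = 0}" by auto
    moreover have "infinite ((\<lambda>\<mu>. z0 + \<mu>) ` L)" using infinite_L by (simp add: finite_image_iff)
    ultimately have "infinite {z. poly p z = 0}" using finite_subset by blast
    then have "p = 0" using poly_roots_finite by blast
    from u pq have "\<forall>\<^sub>\<approx>z. \<phi> (z - z0) = 0"
      by eventually_elim (use \<open>p = 0\<close> in simp)
    from cosparse_shift[OF this, of z0] have "\<forall>\<^sub>\<approx>z. \<phi> z = 0" by simp
    with \<phi>_nonconstant show False by blast
  qed
  ultimately show ?thesis unfolding transcendental_meromorphic_def by blast
qed

lemma \<phi>_shift_elliptic: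
  assumes u: "\<forall>\<^sub>\<approx>z. u z = \<phi> (z - z0)"
  shows "elliptic_fun u"
proof -
  obtain \<omega>1 \<omega>2 where B: "\<omega>2 / \<omega>1 \<notin> \<real>"
    and L: "L = {of_int m * \<omega>1 + of_int n * \<omega>2 | m n. True}" using basis .
  have "of_int 1 * \<omega>1 + of_int 0 * \<omega>2 \<in> L" "of_int 0 * \<omega>1 + of_int 1 * \<omega>2 \<in> L"
    unfolding L by blast+
  then have \<omega>: "\<omega>1 \<in> L" "\<omega>2 \<in> L" by simp_all
  have per: "\<forall>\<^sub>\<approx>z. u (z + \<mu>) = u z" if "\<mu> \<in> L" for \<mu>
    using u cosparse_shift[OF u, of \<mu>] cosparse_shift[OF cosparse_not_in_L, of "- z0"]
  proof eventually_elim
    case (elim z)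
    then show ?case using \<phi>_periodic[OF that, of "z - z0"] by (simp add: algebra_simps)
  qed
  have "u meromorphic_on UNIV"
    using \<phi>_shift_transcendental[OF u] unfolding transcendental_meromorphic_def by blast
  then show ?thesis unfolding elliptic_fun_def using B per[OF \<omega>(1)] per[OF \<omega>(2)] by blast
qed

text \<open>
  Lifting through \<open>\<phi>\<close> gives \<open>u = \<phi> \<circ> h\<close> with \<open>h' ^ 6 = F / K\<close> for the first integral \<open>F\<close>. The zeros of \<open>u\<close>
  are the points with \<open>h z \<in> L\<close>, and \<open>F\<close> takes a single value at them, so \<open>h'\<close> is bounded, hence constant,
  and so is \<open>F\<close>. Two expressions for \<open>S ^ 3\<close> now agree as rational functions of \<open>u\<close>, which gives \<open>\<sigma>1\<close>, \<open>\<sigma>2\<close>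
  and \<open>F = K\<close>. A second lift, with the sixth root 1 of \<open>F / K\<close>, is a translation.
\<close>
theorem solution_classification:
  assumes \<sigma>: "\<sigma>1 \<notin> {4, -3, 0}" "\<sigma>2 \<notin> {4, -3, 0}"
    and mero: "u meromorphic_on UNIV" and nonconst: "\<not> (\<exists>k. \<forall>\<^sub>\<approx>z. u z = k)"
    and sol: "schwarzian_solution (10584 * g3) \<sigma>1 \<sigma>2 u"
  shows "{\<sigma>1, \<sigma>2} = {complex_of_real (sqrt 5) * \<i>, - (complex_of_real (sqrt 5) * \<i>)}"
    and "\<exists>z0. \<forall>\<^sub>\<approx>z. u z = \<phi> (z - z0)"
proof -
  note avoid = nonconstant_avoids[OF mero nonconst]
  have c: "10584 * g3 \<noteq> 0" using g3_nonzero by simp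
  obtain F k where F: "F holomorphic_on UNIV" "\<And>z. F z \<noteq> 0"
    and ode: "\<forall>\<^sub>\<approx>z. deriv u z ^ 6 = F z * branch_poly (u z)"
    and zeros: "\<And>z0. (u \<longlongrightarrow> 0) (at z0) \<Longrightarrow> F z0 = k"
    by (rule first_integral[OF c \<sigma> mero nonconst sol]) blast
  obtain l where l: "l holomorphic_on UNIV" "\<And>z. z \<in> UNIV \<Longrightarrow> F z / K = exp (l z)"
    by (rule contractible_imp_holomorphic_log[of "\<lambda>z. F z / K" UNIV])
       (use F K_nonzero in \<open>auto intro!: holomorphic_intros simp: convex_imp_contractible\<close>)
  define G where "G z = exp (l z / 6)" for z
  have G: "G holomorphic_on UNIV" "\<And>z. G z \<noteq> 0"
    unfolding G_def by (auto intro!: holomorphic_intros l)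
  have G6: "K * G z ^ 6 = F z" for z
  proof -
    have "G z ^ 6 = exp (of_nat 6 * (l z / 6))" unfolding G_def by (rule exp_of_nat_mult[symmetric])
    also have "\<dots> = F z / K" using l(2)[of z] by simp
    finally show ?thesis using K_nonzero by simp
  qed
  have ode': "\<forall>\<^sub>\<approx>z. deriv u z ^ 6 = K * G z ^ 6 * branch_poly (u z)"
    using ode by (simp only: G6)
  obtain h where h: "\<And>z. (h has_field_derivative G z) (at z)" and uh: "\<forall>\<^sub>\<approx>z. u z = \<phi> (h z)"
    by (rule lift_through_\<phi>[OF mero nonconst G ode']) blast
  have h_hol: "h holomorphic_on UNIV" using h by (auto simp: holomorphic_on_open)
  have dh: "deriv h z = G z" for z by (rule DERIV_imp_deriv[OF h])
  \<comment> \<open>A crude bound for the sixth root of \<open>norm (k / K)\<close>.\<close>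
  have "norm (deriv h z) \<le> norm (k / K) + 1" if "h z \<in> L" for z
  proof -
    have "h \<midarrow>z\<rightarrow> h z" using DERIV_isCont[OF h] by (simp add: isCont_def)
    moreover have "\<forall>\<^sub>F w in at z. h w \<noteq> h z"
    proof -
      have "((\<lambda>w. (h w - h z) / (w - z)) \<longlongrightarrow> G z) (at z)"
        using h[of z] by (simp add: has_field_derivative_iff)
      from tendsto_imp_eventually_ne[OF this G(2)] show ?thesis by eventually_elim auto
    qed
    ultimately have "filterlim h (at (h z)) (at z)" by (simp add: filterlim_at)
    then have "((\<lambda>w. \<phi> (h w)) \<longlongrightarrow> 0) (at z)"
      by (rule filterlim_compose[OF \<phi>_tendsto_0(1)[OF that]])
    moreover have "\<forall>\<^sub>F w in at z. \<phi> (h w) = u w"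
      using eventually_cosparse_imp_eventually_at[OF uh UNIV_I] by (rule eventually_mono) simp
    ultimately have "F z = k" using zeros Lim_transform_eventually by blast
    then have "G z ^ 6 = k / K" using G6[of z] K_nonzero by (simp add: field_simps)
    then have n6: "norm (G z) ^ 6 = norm (k / K)" by (simp flip: norm_power)
    have "norm (G z) \<le> norm (G z) ^ 6 + 1"
    proof (cases "norm (G z) \<le> 1")
      case False
      then have "norm (G z) ^ 1 \<le> norm (G z) ^ 6" by (intro power_increasing) auto
      then show ?thesis by simp
    qed (auto intro: add_increasing)
    then show ?thesis unfolding dh n6 .
  qed
  from lattice_preimage_derivative_bounded[OF h_hol this]
  have "bounded (range G)" unfolding dh[abs_def] .
  then obtain \<alpha> where "\<And>z. G z = \<alpha>" using Liouville_theorem[OF G(1)] by (auto simp: constant_on_def)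
  then have F_const: "F z = K * \<alpha> ^ 6" for z using G6[of z] by simp
  define F0 where "F0 = K * \<alpha> ^ 6"
  have F0: "F0 \<noteq> 0" "\<And>z. F z = F0" using F(2) F_const unfolding F0_def by metis+
  let ?good = "\<lambda>z. u analytic_on {z} \<and> u z \<notin> {4, -3, 0} \<and> deriv u z ^ 6 = F0 * branch_poly (u z)"
  have "\<forall>\<^sub>\<approx>z. u z \<noteq> a" for a
    using avoid by (simp add: eventually_cosparse_open_eq)
  note avoid' = this
  from meromorphic_on_imp_analytic_cosparse[OF mero] avoid'[of 4] avoid'[of "-3"] avoid'[of 0] ode
  have "\<forall>\<^sub>\<approx>z. ?good z" by eventually_elim (simp add: F0)
  from cosparse_imp_cosparse_nhds[OF this]
  have S1: "\<forall>\<^sub>\<approx>z. schwarzian u z ^ 3 * schwarzian_den (u z) = - 2744 * F0 * (u z ^ 2 + 5) ^ 3"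
  proof eventually_elim
    case (elim z)
    then obtain A where A: "open A" "z \<in> A" "\<And>w. w \<in> A \<Longrightarrow> ?good w"
      unfolding eventually_nhds by blast
    have "u analytic_on A" using A(3) analytic_on_analytic_at by blast
    then have "u holomorphic_on A" by (rule analytic_imp_holomorphic)
    then show ?case
      using A(3) by (intro schwarzian_of_branch_ode[OF A(1) _ _ _ F0(1) A(2)]) auto
  qed
  have S2: "\<forall>\<^sub>\<approx>z. schwarzian u z ^ 3 * schwarzian_den (u z)
      = 10584 * g3 * ((u z - \<sigma>1) ^ 3 * (u z - \<sigma>2) ^ 3)"
    using schwarzian_solution_clear_den[OF sol avoid] by (simp add: eventually_cosparse_open_eq)
  define p :: "complex poly" where
    "p = smult (10584 * g3) ([:- \<sigma>1, 1:] ^ 3 * [:- \<sigma>2, 1:] ^ 3) + smult (2744 * F0) ([:5, 0, 1:] ^ 3)"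
  have p: "poly p x = 10584 * g3 * ((x - \<sigma>1) ^ 3 * (x - \<sigma>2) ^ 3) + 2744 * F0 * (x ^ 2 + 5) ^ 3" for x
    unfolding p_def by (simp add: power2_eq_square add.commute)
  have "p = 0"
  proof (rule ccontr)
    assume "p \<noteq> 0"
    then have fin: "finite {x. poly p x = 0}" by (rule poly_roots_finite)
    have "\<forall>\<^sub>\<approx>z. \<forall>a\<in>{x. poly p x = 0}. u z \<noteq> a"
      using avoid' by (intro eventually_ball_finite fin) blast
    with S1 S2 have "\<forall>\<^sub>\<approx>z::complex. False"
    proof eventually_elim
      case (elim z)
      have "poly p (u z) = 0" unfolding p elim(2)[symmetric] elim(1) by simp
      with elim(3) show ?case by blast
    qed
    then show False by simp
  qed
  then have id: "10584 * g3 * ((x - \<sigma>1) ^ 3 * (x - \<sigma>2) ^ 3) = - 2744 * F0 * (x ^ 2 + 5) ^ 3" for x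
    using p[of x] by (simp add: add_eq_0_iff2)
  define s where "s = complex_of_real (sqrt 5) * \<i>"
  have s2: "s ^ 2 = - 5"
    unfolding s_def by (simp add: power_mult_distrib flip: of_real_power)
  have "s \<noteq> 0" using s2 by auto
  then have ss: "s \<noteq> - s" by simp
  have "s = \<sigma>1 \<or> s = \<sigma>2" using id[of s] g3_nonzero s2 by simp
  moreover have "- s = \<sigma>1 \<or> - s = \<sigma>2" using id[of "- s"] g3_nonzero s2 by simp
  ultimately have \<sigma>s: "\<sigma>1 = s \<and> \<sigma>2 = - s \<or> \<sigma>1 = - s \<and> \<sigma>2 = s" using ss by metis
  then show "{\<sigma>1, \<sigma>2} = {complex_of_real (sqrt 5) * \<i>, - (complex_of_real (sqrt 5) * \<i>)}"
    unfolding s_def[symmetric] by auto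
  have "\<sigma>1 * \<sigma>2 = 5" using \<sigma>s s2 by (auto simp: power2_eq_square)
  then have "10584 * g3 * 5 ^ 3 = - 2744 * F0 * 5 ^ 3"
    using id[of 0] by (simp flip: power_mult_distrib)
  then have "F0 = K" unfolding K_def by (simp add: field_simps)
  then have "\<forall>\<^sub>\<approx>z. deriv u z ^ 6 = K * 1 ^ 6 * branch_poly (u z)" using ode F0(2) by simp
  then obtain h1 where h1: "\<And>z. (h1 has_field_derivative 1) (at z)" "\<forall>\<^sub>\<approx>z. u z = \<phi> (h1 z)"
    using lift_through_\<phi>[OF mero nonconst, of "\<lambda>_. 1"] by auto
  have "((\<lambda>z. h1 z - z) has_field_derivative 0) (at z within UNIV)" for z
    using DERIV_diff[OF h1(1) DERIV_ident] by simp
  then have "\<exists>b. \<forall>z\<in>UNIV. h1 z - z = b"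
    by (rule has_field_derivative_zero_constant[OF convex_UNIV])
  then obtain b where "\<And>z. h1 z - z = b" by blast
  then have b: "h1 z = z - (- b)" for z by (simp add: algebra_simps)
  have "\<forall>\<^sub>\<approx>z. u z = \<phi> (z - (- b))" using h1(2) unfolding b .
  then show "\<exists>z0. \<forall>\<^sub>\<approx>z. u z = \<phi> (z - z0)" by blast
qed

end

theorem theorem4:
  fixes c \<sigma>1 \<sigma>2 :: complex
  assumes "c \<noteq> 0"
    and "\<sigma>1 \<notin> {4, -3, 0}" and "\<sigma>2 \<notin> {4, -3, 0}"
  shows "(\<forall>u. transcendental_meromorphic u \<and> schwarzian_solution c \<sigma>1 \<sigma>2 u \<longrightarrow> elliptic_fun u)
    \<and> ((\<exists>u. transcendental_meromorphic u \<and> schwarzian_solution c \<sigma>1 \<sigma>2 u) \<longleftrightarrow>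
         {\<sigma>1, \<sigma>2} = {complex_of_real (sqrt 5) * \<i>, - (complex_of_real (sqrt 5) * \<i>)})
    \<and> ({\<sigma>1, \<sigma>2} = {complex_of_real (sqrt 5) * \<i>, - (complex_of_real (sqrt 5) * \<i>)} \<longrightarrow>
         (\<forall>u. transcendental_meromorphic u \<and> schwarzian_solution c \<sigma>1 \<sigma>2 u \<longleftrightarrow>
            (\<exists>z0. \<forall>\<^sub>\<approx>z. u z =
               - (3 * c) / (c - 74088 * weierstrass_wp 0 (c / 10584) (z - z0) ^ 3))))"
proof -
  define g where "g = c / 10584"
  have g: "g \<noteq> 0" and c: "c = 10584 * g" using assms(1) unfolding g_def by simp_all
  define L where "L = (SOME L. is_lattice L \<and> lattice_g2 L = 0 \<and> lattice_g3 L = g)"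
  have "is_lattice L \<and> lattice_g2 L = 0 \<and> lattice_g3 L = g"
    unfolding L_def by (rule someI_ex[OF exists_lattice_equianharmonic[OF g]])
  then interpret equianharmonic_lattice L g by unfold_locales (use g in auto)
  have formula: "- (3 * c) / (c - 74088 * weierstrass_wp 0 (c / 10584) w ^ 3) = \<phi> w" for w
  proof -
    have "weierstrass_wp 0 (c / 10584) w = wp w"
      unfolding weierstrass_wp_def L_def g_def ..
    moreover have "c - 74088 * wp w ^ 3 = - 10584 * (7 * wp w ^ 3 - g)" unfolding c by simp
    moreover have "- (3 * c) = - 10584 * (3 * g)" unfolding c by simp
    ultimately have "- (3 * c) / (c - 74088 * weierstrass_wp 0 (c / 10584) w ^ 3)
        = (- 10584 * (3 * g)) / (- 10584 * (7 * wp w ^ 3 - g))" by (simp only:)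
    also have "\<dots> = \<phi> w" unfolding \<phi>_def by (rule mult_divide_mult_cancel_left) simp
    finally show ?thesis .
  qed
  let ?pair = "{\<sigma>1, \<sigma>2} = {complex_of_real (sqrt 5) * \<i>, - (complex_of_real (sqrt 5) * \<i>)}"
  have necessary: "?pair \<and> (\<exists>z0. \<forall>\<^sub>\<approx>z. u z = \<phi> (z - z0))"
    if u: "transcendental_meromorphic u" "schwarzian_solution c \<sigma>1 \<sigma>2 u" for u
  proof -
    have mero: "u meromorphic_on UNIV" and nr: "\<not> rational_fun u"
      using u(1) unfolding transcendental_meromorphic_def by auto
    have "\<not> (\<exists>k. \<forall>\<^sub>\<approx>z. u z = k)"
    proof
      assume "\<exists>k. \<forall>\<^sub>\<approx>z. u z = k"
      then obtain k where "\<forall>\<^sub>\<approx>z. u z = k" by blast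
      then have "\<forall>\<^sub>\<approx>z. u z = poly [:k:] z / poly 1 z" by simp
      then show False using nr unfolding rational_fun_def by (metis one_neq_zero)
    qed
    from solution_classification[OF assms(2,3) mero this] u(2) show ?thesis unfolding c by blast
  qed
  have sufficient: "transcendental_meromorphic u \<and> schwarzian_solution c \<sigma>1 \<sigma>2 u"
    if "?pair" "\<forall>\<^sub>\<approx>z. u z = \<phi> (z - z0)" for u z0
  proof -
    define s where "s = complex_of_real (sqrt 5) * \<i>"
    have s2: "s ^ 2 = - 5"
      unfolding s_def by (simp add: power_mult_distrib flip: of_real_power)
    have "\<sigma>1 = s \<and> \<sigma>2 = - s \<or> \<sigma>1 = - s \<and> \<sigma>2 = s"
      using that(1) unfolding s_def[symmetric] by (auto simp: doubleton_eq_iff)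
    then have "(x - \<sigma>1) * (x - \<sigma>2) = x ^ 2 + 5" for x
      using s2 by (auto simp: power2_eq_square algebra_simps)
    then show ?thesis
      using \<phi>_shift_transcendental[OF that(2)] \<phi>_shift_solves[OF that(2)] unfolding c by blast
  qed
  show ?thesis
    unfolding formula
  proof (intro conjI allI impI iffI)
    show "elliptic_fun u" if "transcendental_meromorphic u \<and> schwarzian_solution c \<sigma>1 \<sigma>2 u" for u
      using necessary that \<phi>_shift_elliptic by blast
    show ?pair if "\<exists>u. transcendental_meromorphic u \<and> schwarzian_solution c \<sigma>1 \<sigma>2 u"
      using necessary that by blast
    show "\<exists>u. transcendental_meromorphic u \<and> schwarzian_solution c \<sigma>1 \<sigma>2 u" if ?pair
      using sufficient[OF that, of "\<lambda>z. \<phi> (z - 0)" 0] by (intro exI) auto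
    show "\<exists>z0. \<forall>\<^sub>\<approx>z. u z = \<phi> (z - z0)"
      if "transcendental_meromorphic u \<and> schwarzian_solution c \<sigma>1 \<sigma>2 u" for u
      using necessary that by blast
    show "transcendental_meromorphic u" "schwarzian_solution c \<sigma>1 \<sigma>2 u"
      if ?pair "\<exists>z0. \<forall>\<^sub>\<approx>z. u z = \<phi> (z - z0)" for u
      using sufficient that by blast+
  qed
qed

end
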